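(* Let $\mathcal W$ be a $2$-Weyl graph of type $M$, where $M$ is a Coxeter matrix on a finite set $S$. Then $\mathcal W$ is a Weyl graph if (and only if) all residues of $\mathcal W$ of type $C_3$ and of type $H_3$ are Weyl graphs.
   Context: Setting. $M=(m_{st})_{s,t\in S}$ is a Coxeter matrix on a finite set $S$, and $W=\langle S\mid (st)^{m_{st}}=1,\ m_{st}<\infty\rangle$ is its Coxeter group. A word over $S$ is reduced if no shorter word represents the same element of $W$. For $s\ne t$ let $p_m(s,t)=stst\cdots$ ($m$ letters), and if $m_{st}<\infty$ let $p(s,t)=p_{m_{st}}(s,t)$. Groupoids are small and non-empty, with composition $g;h$ (or $gh$) written left to right, defined when $\tau(g)=\iota(h)$, where $\iota,\tau$ denote initial and terminal vertices. Weyl data. A generalized chamber system $\mathcal W$ of type $M$ is a set $\mathcal W_0$ of chambers with a family of groupoids $(\mathcal W_s)_{s\in S}$ (panel groupoids), each with vertex set $\mathcal W_0$. An edge of $\mathcal W$ of type $s$ is a non-identity edge of $\mathcal W_s$ (edges of different types are distinct). An $s$-panel is a connected component of $\mathcal W_s$. A gallery $\beta$ is a finite sequence of consecutive edges (a trivial gallery is a single chamber with no edges), with initial chamber $\iota(\beta)$, terminal chamber $\tau(\beta)$, type $\beta_S$ (the word of types of its edges), and $W$-length $\beta_W\in W$ (the element represented by $\beta_S$). It is a cycle if $\iota(\beta)=\tau(\beta)$, and a geodesic if $\beta_S$ is reduced. For $s\neq t$ with $m_{st}<\infty$: an $(s,t)$-geodesic is a geodesic of type $p_m(s,t)$ for some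 $m$; a maximal $(s,t)$-geodesic is a gallery of type $p(s,t)$; an $(s,t)$-cycle is a cycle of type $p_{2m_{st}}(s,t)$. An alternating geodesic is an $(s,t)$-geodesic for some $s,t$; trivial galleries and one-edge galleries count as alternating geodesics. Weyl data of type $M$ is a generalized chamber system of type $M$ together with, for each ordered pair $(s,t)$ with $s\neq t$, $m_{st}<\infty$, a set of $(s,t)$-cycles called defining suites. Homotopy. Elementary homotopies of galleries are the following moves on subgalleries and their inverses: delete $i\,i^{-1}$; replace $i\,i'$ ($i,i'$ of the same type, $i'\ne i^{-1}$) by the single edge $i;i'$; delete a defining suite. Galleries are homotopic ($\sim$) if related by finitely many such moves. A pre-Weyl graph is Weyl data satisfying (PW0) no panel is a trivial groupoid (one vertex, one edge), and (PW1) each maximal $(s,t)$-geodesic is homotopic to a maximal $(t,s)$-geodesic. A $2$-Weyl graph is a pre-Weyl graph satisfying (2W) homotopic alternating geodesics have the same $W$-length. A Weyl graph is a pre-Weyl graph satisfying (W) homotopic geodesics have the same $W$-length. Residues. For $J\subseteq S$ let $M_J$ be the restriction of $M$ to $J\times J$. The $J$-restriction $\mathcal W_J$ is the Weyl data of type $M_J$ with the same chambers, the panel groupoids $\mathcal W_s$ for $s\in J$, and the defining $(s,t)$-suites of $\mathcal W$ for $s,t\in J$. The $J$-residue at a chamber $C$ is the connected component of $\mathcal W_J$ containing $C$, as Weyl data of type $M_J$ (chambers joined to $C$ by galleries with all types in $J$, all edges of $\mathcal W_J$ between them, and the defining suites of $\mathcal W_J$ contained in it). Such a residue has type $C_3$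 (respectively $H_3$) if $|J|=3$ and $M_J$ is the Coxeter matrix of type $C_3$ (respectively $H_3$), i.e. the off-diagonal entries are $2,3,4$ (respectively $2,3,5$).
   Formalization: The "only if" part is stated only for residues of type C_3 or H_3 that are pre-Weyl graphs: a residue has only its own defining suites, so (PW1) can fail in it (thin C_3×A_1 with the suites in one C_3-residue dropped), and "only if" is false as stated. The "if" part is unchanged. *)

theory Defs
  imports "HOL-Library.Extended_Nat"
begin

text \<open>A matrix over the index set \<open>S\<close> is a function of which only the values on \<open>S \<times> S\<close> are
  ever used; accordingly the restriction of \<open>M\<close> to \<open>J \<times> J\<close> is the pair \<open>J, M\<close>.\<close>

locale coxeter_matrix =
  fixes S :: "'s set" and M :: "'s \<Rightarrow> 's \<Rightarrow> enat"
  assumes diag: "s \<in> S \<Longrightarrow> M s s = 1"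
    and sym: "s \<in> S \<Longrightarrow> t \<in> S \<Longrightarrow> M s t = M t s"
    and off_diag: "s \<in> S \<Longrightarrow> t \<in> S \<Longrightarrow> s \<noteq> t \<Longrightarrow> 2 \<le> M s t"

text \<open>The Coxeter group is the group presented by \<open>(s t)\<^bsup>m s t\<^esup> = 1\<close> for all \<open>s, t \<in> S\<close>
  (including \<open>s = t\<close>) with finite \<open>m s t\<close>. Its elements are classes of words in the formal letters
  \<open>(s, True)\<close>, standing for \<open>s\<close>, and \<open>(s, False)\<close>, standing for the inverse of \<open>s\<close>.\<close>

definition pos :: "'s list \<Rightarrow> ('s \<times> bool) list" where
  "pos w = map (\<lambda>s. (s, True)) w"

inductive cox_step :: "'s set \<Rightarrow> ('s \<Rightarrow> 's \<Rightarrow> enat) \<Rightarrow> ('s \<times> bool) list \<Rightarrow> ('s \<times> bool) list \<Rightarrow> bool"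
  for S M where
  cancel: "s \<in> S \<Longrightarrow> cox_step S M (u @ [(s, b), (s, \<not> b)] @ v) (u @ v)"
| relator: "\<lbrakk>s \<in> S; t \<in> S; M s t \<noteq> \<infinity>\<rbrakk> \<Longrightarrow>
    cox_step S M (u @ pos (concat (replicate (the_enat (M s t)) [s, t])) @ v) (u @ v)"

definition cox_elt :: "'s set \<Rightarrow> ('s \<Rightarrow> 's \<Rightarrow> enat) \<Rightarrow> 's list \<Rightarrow> ('s \<times> bool) list set" where
  "cox_elt S M w = {v. equivclp (cox_step S M) (pos w) v}"

definition reduced :: "'s set \<Rightarrow> ('s \<Rightarrow> 's \<Rightarrow> enat) \<Rightarrow> 's list \<Rightarrow> bool" where
  "reduced S M w \<longleftrightarrow> set w \<subseteq> S \<and>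
    \<not> (\<exists>v. set v \<subseteq> S \<and> length v < length w \<and> cox_elt S M v = cox_elt S M w)"

fun alt_word :: "nat \<Rightarrow> 's \<Rightarrow> 's \<Rightarrow> 's list" where
  "alt_word 0 s t = []"
| "alt_word (Suc m) s t = s # alt_word m t s"

definition type_C3 :: "'s set \<Rightarrow> ('s \<Rightarrow> 's \<Rightarrow> enat) \<Rightarrow> bool" where
  "type_C3 J M \<longleftrightarrow> card J = 3 \<and> coxeter_matrix J M \<and>
    (\<exists>r s t. J = {r, s, t} \<and> M r s = 3 \<and> M s t = 4 \<and> M r t = 2)"

definition type_H3 :: "'s set \<Rightarrow> ('s \<Rightarrow> 's \<Rightarrow> enat) \<Rightarrow> bool" where
  "type_H3 J M \<longleftrightarrow> card J = 3 \<and> coxeter_matrix J M \<and>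
    (\<exists>r s t. J = {r, s, t} \<and> M r s = 3 \<and> M s t = 5 \<and> M r t = 2)"

record ('v, 'e) groupoid =
  verts :: "'v set"
  edges :: "'e set"
  src :: "'e \<Rightarrow> 'v"
  tgt :: "'e \<Rightarrow> 'v"
  gcomp :: "'e \<Rightarrow> 'e \<Rightarrow> 'e"  \<comment> \<open>diagrammatic order: \<open>gcomp G e f\<close> is first \<open>e\<close>, then \<open>f\<close>\<close>
  gid :: "'v \<Rightarrow> 'e"
  ginv :: "'e \<Rightarrow> 'e"

locale groupoid =
  fixes G :: "('v, 'e) groupoid"
  assumes nonempty: "verts G \<noteq> {}"
    and src_in: "e \<in> edges G \<Longrightarrow> src G e \<in> verts G"
    and tgt_in: "e \<in> edges G \<Longrightarrow> tgt G e \<in> verts G"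
    and comp_in: "\<lbrakk>e \<in> edges G; f \<in> edges G; tgt G e = src G f\<rbrakk> \<Longrightarrow> gcomp G e f \<in> edges G"
    and src_comp: "\<lbrakk>e \<in> edges G; f \<in> edges G; tgt G e = src G f\<rbrakk> \<Longrightarrow> src G (gcomp G e f) = src G e"
    and tgt_comp: "\<lbrakk>e \<in> edges G; f \<in> edges G; tgt G e = src G f\<rbrakk> \<Longrightarrow> tgt G (gcomp G e f) = tgt G f"
    and assoc: "\<lbrakk>e \<in> edges G; f \<in> edges G; g \<in> edges G; tgt G e = src G f; tgt G f = src G g\<rbrakk>
      \<Longrightarrow> gcomp G (gcomp G e f) g = gcomp G e (gcomp G f g)"
    and id_in: "v \<in> verts G \<Longrightarrow> gid G v \<in> edges G"
    and src_id: "v \<in> verts G \<Longrightarrow> src G (gid G v) = v"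
    and tgt_id: "v \<in> verts G \<Longrightarrow> tgt G (gid G v) = v"
    and id_left: "e \<in> edges G \<Longrightarrow> gcomp G (gid G (src G e)) e = e"
    and id_right: "e \<in> edges G \<Longrightarrow> gcomp G e (gid G (tgt G e)) = e"
    and inv_in: "e \<in> edges G \<Longrightarrow> ginv G e \<in> edges G"
    and src_inv: "e \<in> edges G \<Longrightarrow> src G (ginv G e) = tgt G e"
    and tgt_inv: "e \<in> edges G \<Longrightarrow> tgt G (ginv G e) = src G e"
    and inv_right: "e \<in> edges G \<Longrightarrow> gcomp G e (ginv G e) = gid G (src G e)"
    and inv_left: "e \<in> edges G \<Longrightarrow> gcomp G (ginv G e) e = gid G (tgt G e)"

definition full_subgroupoid :: "'v set \<Rightarrow> ('v, 'e) groupoid \<Rightarrow> ('v, 'e) groupoid" where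
  "full_subgroupoid V G =
    G\<lparr>verts := verts G \<inter> V, edges := {e \<in> edges G. src G e \<in> V \<and> tgt G e \<in> V}\<rparr>"

definition component :: "('v, 'e) groupoid \<Rightarrow> 'v \<Rightarrow> ('v, 'e) groupoid" where
  "component G v = full_subgroupoid {w. \<exists>e\<in>edges G. src G e = v \<and> tgt G e = w} G"

definition trivial_groupoid :: "('v, 'e) groupoid \<Rightarrow> bool" where
  "trivial_groupoid G \<longleftrightarrow> card (verts G) = 1 \<and> card (edges G) = 1"

text \<open>Edges of \<open>\<W>\<close> are pairs of a type \<open>s\<close> and an edge of the panel groupoid of \<open>s\<close>, so that edges
  of different types are distinct. A gallery is its initial chamber together with its list of
  edges.\<close>

type_synonym ('c, 'e, 's) gallery = "'c \<times> ('s \<times> 'e) list"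

record ('c, 'e, 's) weyl_data =
  chambers :: "'c set"
  panels :: "'s \<Rightarrow> ('c, 'e) groupoid"
  suites :: "'s \<Rightarrow> 's \<Rightarrow> ('c, 'e, 's) gallery set"

definition cs_edge :: "'s set \<Rightarrow> ('c, 'e, 's) weyl_data \<Rightarrow> 's \<times> 'e \<Rightarrow> bool" where
  "cs_edge S W x \<longleftrightarrow> fst x \<in> S \<and> snd x \<in> edges (panels W (fst x)) \<and>
    snd x \<notin> gid (panels W (fst x)) ` verts (panels W (fst x))"

definition edge_src :: "('c, 'e, 's) weyl_data \<Rightarrow> 's \<times> 'e \<Rightarrow> 'c" where
  "edge_src W x = src (panels W (fst x)) (snd x)"

definition edge_tgt :: "('c, 'e, 's) weyl_data \<Rightarrow> 's \<times> 'e \<Rightarrow> 'c" where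
  "edge_tgt W x = tgt (panels W (fst x)) (snd x)"

fun edge_path :: "'s set \<Rightarrow> ('c, 'e, 's) weyl_data \<Rightarrow> 'c \<Rightarrow> ('s \<times> 'e) list \<Rightarrow> bool" where
  "edge_path S W c [] \<longleftrightarrow> c \<in> chambers W"
| "edge_path S W c (x # xs) \<longleftrightarrow>
    c \<in> chambers W \<and> cs_edge S W x \<and> edge_src W x = c \<and> edge_path S W (edge_tgt W x) xs"

definition gallery :: "'s set \<Rightarrow> ('c, 'e, 's) weyl_data \<Rightarrow> ('c, 'e, 's) gallery \<Rightarrow> bool" where
  "gallery S W \<beta> \<longleftrightarrow> edge_path S W (fst \<beta>) (snd \<beta>)"

definition initial :: "('c, 'e, 's) gallery \<Rightarrow> 'c" where
  "initial \<beta> = fst \<beta>"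

definition terminal :: "('c, 'e, 's) weyl_data \<Rightarrow> ('c, 'e, 's) gallery \<Rightarrow> 'c" where
  "terminal W \<beta> = (if snd \<beta> = [] then fst \<beta> else edge_tgt W (last (snd \<beta>)))"

definition gallery_chambers :: "('c, 'e, 's) weyl_data \<Rightarrow> ('c, 'e, 's) gallery \<Rightarrow> 'c set" where
  "gallery_chambers W \<beta> = insert (fst \<beta>) (edge_tgt W ` set (snd \<beta>))"

definition gtype :: "('c, 'e, 's) gallery \<Rightarrow> 's list" where
  "gtype \<beta> = map fst (snd \<beta>)"

definition W_length ::
  "'s set \<Rightarrow> ('s \<Rightarrow> 's \<Rightarrow> enat) \<Rightarrow> ('c, 'e, 's) gallery \<Rightarrow> ('s \<times> bool) list set" where
  "W_length S M \<beta> = cox_elt S M (gtype \<beta>)"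

definition is_cycle :: "'s set \<Rightarrow> ('c, 'e, 's) weyl_data \<Rightarrow> ('c, 'e, 's) gallery \<Rightarrow> bool" where
  "is_cycle S W \<beta> \<longleftrightarrow> gallery S W \<beta> \<and> initial \<beta> = terminal W \<beta>"

definition geodesic ::
  "'s set \<Rightarrow> ('s \<Rightarrow> 's \<Rightarrow> enat) \<Rightarrow> ('c, 'e, 's) weyl_data \<Rightarrow> ('c, 'e, 's) gallery \<Rightarrow> bool" where
  "geodesic S M W \<beta> \<longleftrightarrow> gallery S W \<beta> \<and> reduced S M (gtype \<beta>)"

definition finite_pair :: "'s set \<Rightarrow> ('s \<Rightarrow> 's \<Rightarrow> enat) \<Rightarrow> 's \<Rightarrow> 's \<Rightarrow> bool" where
  "finite_pair S M s t \<longleftrightarrow> s \<in> S \<and> t \<in> S \<and> s \<noteq> t \<and> M s t \<noteq> \<infinity>"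

definition st_geodesic ::
  "'s set \<Rightarrow> ('s \<Rightarrow> 's \<Rightarrow> enat) \<Rightarrow> ('c, 'e, 's) weyl_data \<Rightarrow> 's \<Rightarrow> 's \<Rightarrow> ('c, 'e, 's) gallery \<Rightarrow> bool"
  where "st_geodesic S M W s t \<beta> \<longleftrightarrow> geodesic S M W \<beta> \<and> (\<exists>m. gtype \<beta> = alt_word m s t)"

definition max_st_geodesic ::
  "'s set \<Rightarrow> ('s \<Rightarrow> 's \<Rightarrow> enat) \<Rightarrow> ('c, 'e, 's) weyl_data \<Rightarrow> 's \<Rightarrow> 's \<Rightarrow> ('c, 'e, 's) gallery \<Rightarrow> bool"
  where "max_st_geodesic S M W s t \<beta> \<longleftrightarrow>
    gallery S W \<beta> \<and> gtype \<beta> = alt_word (the_enat (M s t)) s t"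

definition st_cycle ::
  "'s set \<Rightarrow> ('s \<Rightarrow> 's \<Rightarrow> enat) \<Rightarrow> ('c, 'e, 's) weyl_data \<Rightarrow> 's \<Rightarrow> 's \<Rightarrow> ('c, 'e, 's) gallery \<Rightarrow> bool"
  where "st_cycle S M W s t \<beta> \<longleftrightarrow>
    is_cycle S W \<beta> \<and> gtype \<beta> = alt_word (2 * the_enat (M s t)) s t"

definition alternating_geodesic ::
  "'s set \<Rightarrow> ('s \<Rightarrow> 's \<Rightarrow> enat) \<Rightarrow> ('c, 'e, 's) weyl_data \<Rightarrow> ('c, 'e, 's) gallery \<Rightarrow> bool" where
  "alternating_geodesic S M W \<beta> \<longleftrightarrow> gallery S W \<beta> \<and>
    (length (snd \<beta>) \<le> 1 \<or> (\<exists>s t. finite_pair S M s t \<and> st_geodesic S M W s t \<beta>))"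

locale generalized_chamber_system =
  fixes S :: "'s set" and W :: "('c, 'e, 's) weyl_data"
  assumes panel_groupoid: "s \<in> S \<Longrightarrow> groupoid (panels W s)"
    and verts_panel: "s \<in> S \<Longrightarrow> verts (panels W s) = chambers W"

locale weyl_data = generalized_chamber_system S W
  for S :: "'s set" and M :: "'s \<Rightarrow> 's \<Rightarrow> enat" and W :: "('c, 'e, 's) weyl_data" +
  assumes suites: "finite_pair S M s t \<Longrightarrow> \<beta> \<in> suites W s t \<Longrightarrow> st_cycle S M W s t \<beta>"

inductive elementary_homotopy ::
  "'s set \<Rightarrow> ('s \<Rightarrow> 's \<Rightarrow> enat) \<Rightarrow> ('c, 'e, 's) weyl_data
    \<Rightarrow> ('c, 'e, 's) gallery \<Rightarrow> ('c, 'e, 's) gallery \<Rightarrow> bool"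
  for S M W where
  cancel: "gallery S W (c, xs @ [(s, e), (s, ginv (panels W s) e)] @ ys) \<Longrightarrow>
    elementary_homotopy S M W (c, xs @ [(s, e), (s, ginv (panels W s) e)] @ ys) (c, xs @ ys)"
| compose: "\<lbrakk>gallery S W (c, xs @ [(s, e), (s, f)] @ ys); f \<noteq> ginv (panels W s) e\<rbrakk> \<Longrightarrow>
    elementary_homotopy S M W (c, xs @ [(s, e), (s, f)] @ ys)
      (c, xs @ [(s, gcomp (panels W s) e f)] @ ys)"
| suite: "\<lbrakk>gallery S W (c, xs @ zs @ ys); finite_pair S M s t;
     (terminal W (c, xs), zs) \<in> suites W s t\<rbrakk> \<Longrightarrow>
    elementary_homotopy S M W (c, xs @ zs @ ys) (c, xs @ ys)"

definition homotopic ::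
  "'s set \<Rightarrow> ('s \<Rightarrow> 's \<Rightarrow> enat) \<Rightarrow> ('c, 'e, 's) weyl_data
    \<Rightarrow> ('c, 'e, 's) gallery \<Rightarrow> ('c, 'e, 's) gallery \<Rightarrow> bool" where
  "homotopic S M W = equivclp (elementary_homotopy S M W)"

locale pre_weyl_graph = weyl_data S M W
  for S :: "'s set" and M :: "'s \<Rightarrow> 's \<Rightarrow> enat" and W :: "('c, 'e, 's) weyl_data" +
  assumes PW0: "s \<in> S \<Longrightarrow> C \<in> chambers W \<Longrightarrow> \<not> trivial_groupoid (component (panels W s) C)"
    and PW1: "finite_pair S M s t \<Longrightarrow> max_st_geodesic S M W s t \<beta> \<Longrightarrow>
      \<exists>\<gamma>. max_st_geodesic S M W t s \<gamma> \<and> homotopic S M W \<beta> \<gamma>"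

locale two_weyl_graph = pre_weyl_graph S M W
  for S :: "'s set" and M :: "'s \<Rightarrow> 's \<Rightarrow> enat" and W :: "('c, 'e, 's) weyl_data" +
  assumes two_W: "\<lbrakk>alternating_geodesic S M W \<beta>; alternating_geodesic S M W \<gamma>;
      homotopic S M W \<beta> \<gamma>\<rbrakk> \<Longrightarrow> W_length S M \<beta> = W_length S M \<gamma>"

locale weyl_graph = pre_weyl_graph S M W
  for S :: "'s set" and M :: "'s \<Rightarrow> 's \<Rightarrow> enat" and W :: "('c, 'e, 's) weyl_data" +
  assumes W: "\<lbrakk>geodesic S M W \<beta>; geodesic S M W \<gamma>; homotopic S M W \<beta> \<gamma>\<rbrakk>
      \<Longrightarrow> W_length S M \<beta> = W_length S M \<gamma>"

text \<open>No notion above consults panel groupoids or suites of types outside its set of types, so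
  the \<open>J\<close>-restriction of \<open>W\<close> is \<open>W\<close> itself, read over \<open>J\<close> instead of \<open>S\<close>; the residue below is
  likewise Weyl data over \<open>J\<close>.

  Homotopy in a residue uses the defining suites of that residue only. It can be strictly finer
  than homotopy in \<open>W\<close>, and therefore \<open>PW1\<close> need not pass from \<open>W\<close> to its residues: in the thin
  Weyl graph of type \<open>C\<^sub>3 \<times> A\<^sub>1\<close> with all suites defining, drop those inside one of the two \<open>C\<^sub>3\<close>-residues;
  they remain null-homotopic through the other one, so only that residue is affected.\<close>

definition residue_chambers :: "'s set \<Rightarrow> ('c, 'e, 's) weyl_data \<Rightarrow> 'c \<Rightarrow> 'c set" where
  "residue_chambers J W C = {D. \<exists>\<beta>. gallery J W \<beta> \<and> initial \<beta> = C \<and> terminal W \<beta> = D}"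

definition residue :: "'s set \<Rightarrow> ('c, 'e, 's) weyl_data \<Rightarrow> 'c \<Rightarrow> ('c, 'e, 's) weyl_data" where
  "residue J W C =
    \<lparr>chambers = residue_chambers J W C,
     panels = (\<lambda>s. full_subgroupoid (residue_chambers J W C) (panels W s)),
     suites = (\<lambda>s t. {\<beta> \<in> suites W s t. gallery_chambers W \<beta> \<subseteq> residue_chambers J W C})\<rparr>"

end

theory Submission
  imports Defs Complex_Main
begin

text \<open>Following Tits, fix a chamber \<open>c\<close> and consider geodesics from \<open>c\<close> up to braiding, i.e. replacing
  maximal \<open>(s,t)\<close>-geodesics by homotopic maximal \<open>(t,s)\<close>-geodesics. If braiding never identifies two
  geodesics that have the same reduced type, then the edges of the graph act on the braid classes
  compatibly with all elementary homotopies (for a defining suite this is a rank 2 statement, where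
  \<open>2W\<close> applies), so that homotopic geodesics are braid equivalent and in particular have the same
  \<open>W\<close>-length.

  The absence of such identifications is shown by induction on the length. Changing the last letter
  of a geodesic from \<open>s\<close> to \<open>t\<close> to \<open>r\<close> and back to \<open>s\<close> takes place inside a residue of type
  \<open>{r,s,t}\<close>, and \<open>r, s, t\<close> being descents of one element forces this type to be spherical. Types
  \<open>A\<^sub>1 \<times> I\<^sub>2(m)\<close> and \<open>A\<^sub>3\<close> reduce to \<open>2W\<close> by a suitable choice of longest word; types \<open>C\<^sub>3\<close> and
  \<open>H\<^sub>3\<close> are the hypothesis.\<close>

subsection \<open>Words in the Coxeter group and the exchange condition\<close>

text \<open>By PW1 every braid move on the type of a gallery lifts to the gallery, and by 2W the
  lift is unique. So the geodesics over the reduced words of one element form a covering of the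
  graph of these words and their braid moves, and the question is whether closed chains of braid
  moves act trivially on it. Such chains only have to be examined where three letters are descents
  of one element. Two points shape the details. Homotopy in a residue can be finer than homotopy in
  \<open>W\<close>, so the hypothesis on residues says nothing directly about galleries homotopic in
  \<open>W\<close>. It is applied only to braids: PW1 of the residue together with uniqueness in
  rank 2 turns each single move into a homotopy of the residue. Secondly, finiteness of a type is
  tested through lengths: reduced words over a set of common descents of \<open>w\<close> are no
  longer than \<open>w\<close>, whereas affine diagrams carry arbitrarily long reduced words,
  recognised by small automata.\<close>

lemma length_alt_word [simp]: "length (alt_word n s t) = n"
  by (induction n arbitrary: s t) auto

lemma set_alt_word_subset: "set (alt_word n s t) \<subseteq> {s, t}"
proof (induction n arbitrary: s t)
  case (Suc n)
  show ?case using Suc[of t s] by auto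
qed simp

lemma set_alt_word: "2 \<le> n \<Longrightarrow> set (alt_word n s t) = {s, t}"
  using set_alt_word_subset[of n s t] by (cases n; cases "n - 1") auto

lemma alt_word_add:
  "alt_word (m + n) s t = alt_word m s t @ (if even m then alt_word n s t else alt_word n t s)"
  by (induction m arbitrary: s t) auto

lemma alt_word_snoc: "alt_word (Suc n) s t = alt_word n s t @ [if even n then s else t]"
  using alt_word_add[of n 1 s t] by auto

lemma rev_alt_word: "rev (alt_word n s t) = (if odd n then alt_word n s t else alt_word n t s)"
proof (induction n arbitrary: s t)
  case (Suc n)
  have "rev (alt_word (Suc n) s t) = rev (alt_word n t s) @ [s]" by simp
  also have "\<dots> = (if odd (Suc n) then alt_word (Suc n) s t else alt_word (Suc n) t s)"
    unfolding Suc[of t s] alt_word_snoc by simp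
  finally show ?case .
qed simp

lemma alt_word_double: "alt_word (2 * n) s t = concat (replicate n [s, t])"
  by (induction n) auto

text \<open>The relators with \<open>s = t\<close> are the squares \<open>[s, s]\<close>, which make
  every letter its own inverse. Positive words therefore suffice, and the formal inverses of
  \<open>cox_step\<close> need not be carried through the theory of words;
  \<open>cox_elt_eq_iff\<close> matches the two presentations.\<close>

inductive rel_step :: "'s set \<Rightarrow> ('s \<Rightarrow> 's \<Rightarrow> enat) \<Rightarrow> 's list \<Rightarrow> 's list \<Rightarrow> bool"
  for S M where
  "\<lbrakk>s \<in> S; t \<in> S; M s t \<noteq> \<infinity>\<rbrakk> \<Longrightarrow> rel_step S M (u @ alt_word (2 * the_enat (M s t)) s t @ v) (u @ v)"

inductive braid_step :: "'s set \<Rightarrow> ('s \<Rightarrow> 's \<Rightarrow> enat) \<Rightarrow> 's list \<Rightarrow> 's list \<Rightarrow> bool"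
  for S M where
  "finite_pair S M s t \<Longrightarrow>
    braid_step S M (u @ alt_word (the_enat (M s t)) s t @ v) (u @ alt_word (the_enat (M s t)) t s @ v)"

text \<open>For each letter \<open>x\<close> with suffix \<open>b\<close> behind it, a palindrome
  representing the conjugate of \<open>x\<close> by \<open>b\<close>. Multiplying the whole word on
  the right by this reflection deletes that \<open>x\<close>, which is how the exchange condition
  arises.\<close>

fun reflections :: "'s list \<Rightarrow> 's list list" where
  "reflections [] = []"
| "reflections (x # f) = (rev f @ [x] @ f) # reflections f"

lemma reflections_append:
  "reflections (f @ g) = map (\<lambda>r. rev g @ r @ g) (reflections f) @ reflections g"
  by (induction f) auto

lemma in_reflections_iff: "r \<in> set (reflections f) \<longleftrightarrow> (\<exists>a x b. f = a @ [x] @ b \<and> r = rev b @ [x] @ b)"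
proof (induction f)
  case (Cons y f)
  show ?case
  proof
    assume "r \<in> set (reflections (y # f))"
    then consider "r = rev f @ [y] @ f" | "r \<in> set (reflections f)" by auto
    then show "\<exists>a x b. y # f = a @ [x] @ b \<and> r = rev b @ [x] @ b"
    proof cases
      case 1
      then show ?thesis by (intro exI[of _ "[]"] exI[of _ y] exI[of _ f]) simp
    next
      case 2
      then obtain a x b where "f = a @ [x] @ b" "r = rev b @ [x] @ b" using Cons by blast
      then show ?thesis by (intro exI[of _ "y # a"] exI[of _ x] exI[of _ b]) simp
    qed
  next
    assume "\<exists>a x b. y # f = a @ [x] @ b \<and> r = rev b @ [x] @ b"
    then obtain a x b where *: "y # f = a @ [x] @ b" "r = rev b @ [x] @ b" by blast
    show "r \<in> set (reflections (y # f))"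
    proof (cases a)
      case Nil
      with * show ?thesis by auto
    next
      case (Cons z a')
      with * have "f = a' @ [x] @ b" by auto
      with * Cons.IH show ?thesis by auto
    qed
  qed
qed simp

text \<open>\<open>x\<close> is the last letter of the alternating word and \<open>y\<close> the
  other one. Conjugating the letter that has \<open>k\<close> letters behind it gives the
  alternating word of length \<open>2 * k + 1\<close> starting with \<open>x\<close>; the list is
  reversed since the first letter has the longest suffix.\<close>

lemma reflections_alt_word:
  assumes "odd n \<Longrightarrow> x = s" "odd n \<Longrightarrow> y = t" "even n \<Longrightarrow> x = t" "even n \<Longrightarrow> y = s"
  shows "reflections (alt_word n s t) = map (\<lambda>k. alt_word (2 * k + 1) x y) (rev [0..<n])"
  using assms
proof (induction n arbitrary: s t x y)
  case (Suc n)
  have 1: "rev (alt_word n t s) = (if odd n then alt_word n t s else alt_word n s t)"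
    by (rule rev_alt_word)
  have 2: "rev (alt_word n t s) @ [s] @ alt_word n t s = alt_word (2 * n + 1) x y"
  proof (cases "odd n")
    case True
    with Suc.prems have "x = t" "y = s" by auto
    moreover have "alt_word (2 * n + 1) t s = alt_word (n + (n + 1)) t s" by (simp add: mult_2)
    ultimately show ?thesis unfolding 1 using True alt_word_add[of n "n+1" t s] by simp
  next
    case False
    with Suc.prems have "x = s" "y = t" by auto
    moreover have "alt_word (2 * n + 1) s t = alt_word (n + (n + 1)) s t" by (simp add: mult_2)
    ultimately show ?thesis unfolding 1 using False alt_word_add[of n "n+1" s t] by simp
  qed
  have 3: "reflections (alt_word n t s) = map (\<lambda>k. alt_word (2 * k + 1) x y) (rev [0..<n])"
    by (rule Suc.IH) (use Suc.prems in auto)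
  show ?case using 2 3 by simp
qed simp

lemma map_fst_pos [simp]: "map fst (pos w) = w"
  by (simp add: pos_def comp_def)

lemma pos_append [simp]: "pos (u @ v) = pos u @ pos v"
  by (simp add: pos_def)

context coxeter_matrix
begin

section \<open>Equality of positive words in the Coxeter group\<close>

abbreviation word_eq (infix "\<simeq>" 50) where "f \<simeq> g \<equiv> equivclp (rel_step S M) f g"

lemma word_eq_trans [trans]: "f \<simeq> g \<Longrightarrow> g \<simeq> h \<Longrightarrow> f \<simeq> h"
  by (rule equivclp_trans)

lemma word_eq_sym: "f \<simeq> g \<longleftrightarrow> g \<simeq> f"
  by (blast intro: equivclp_sym)

lemma rel_step_context: "rel_step S M f g \<Longrightarrow> rel_step S M (u @ f @ v) (u @ g @ v)"
proof (induction rule: rel_step.induct)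
  case (1 s t u' v')
  then show ?case using rel_step.intros[of s S t M "u @ u'" "v' @ v"] by simp
qed

lemma word_eq_context: "f \<simeq> g \<Longrightarrow> u @ f @ v \<simeq> u @ g @ v"
proof (induction rule: equivclp_induct)
  case (step y z)
  then have "u @ y @ v \<simeq> u @ z @ v" using rel_step_context by blast
  with step show ?case by (blast intro: word_eq_trans)
qed simp

lemma word_eq_append: "f \<simeq> f' \<Longrightarrow> g \<simeq> g' \<Longrightarrow> f @ g \<simeq> f' @ g'"
  using word_eq_context[of f f' "[]" g] word_eq_context[of g g' f' "[]"] by (auto intro: word_eq_trans)

lemma word_eq_relator: "\<lbrakk>s \<in> S; t \<in> S; M s t \<noteq> \<infinity>\<rbrakk> \<Longrightarrow> alt_word (2 * the_enat (M s t)) s t \<simeq> []"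
  using rel_step.intros[of s S t M "[]" "[]"] by auto

lemma word_eq_square: "s \<in> S \<Longrightarrow> [s, s] \<simeq> []"
  using word_eq_relator[of s s] diag[of s] by (simp add: one_enat_def numeral_eq_Suc)

lemma word_eq_rev_right: "set w \<subseteq> S \<Longrightarrow> w @ rev w \<simeq> []"
proof (induction w)
  case (Cons s w)
  have "[s] @ (w @ rev w) @ [s] \<simeq> [s] @ [] @ [s]"
    by (rule word_eq_context) (use Cons in auto)
  also have "[s] @ [] @ [s] \<simeq> []" using word_eq_square[of s] Cons by simp
  finally show ?case by simp
qed simp

lemma word_eq_rev_left: "set w \<subseteq> S \<Longrightarrow> rev w @ w \<simeq> []"
  using word_eq_rev_right[of "rev w"] by simp

lemma word_eq_delete: "w \<simeq> [] \<Longrightarrow> u @ w @ v \<simeq> u @ v"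
  using word_eq_context[of w "[]" u v] by simp

lemma rel_step_cox_step: "rel_step S M f g \<Longrightarrow> cox_step S M (pos f) (pos g)"
proof (induction rule: rel_step.induct)
  case (1 s t u v)
  then show ?case using cox_step.relator[of s S t M "pos u" "pos v"] by (simp add: alt_word_double)
qed

text \<open>Forgetting the inverse marks turns the cancellation of a letter against its inverse into
  the deletion of a square, which is itself a relator. This makes \<open>map fst\<close> well
  defined on group elements.\<close>

lemma cox_step_word_eq: "cox_step S M f g \<Longrightarrow> map fst f \<simeq> map fst g"
proof (induction rule: cox_step.induct)
  case (cancel s u b v)
  show ?case using word_eq_delete[OF word_eq_square[OF cancel], of "map fst u" "map fst v"] by simp
next
  case (relator s t u v)
  show ?case
    using word_eq_delete[OF word_eq_relator[OF relator], of "map fst u" "map fst v"]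
    by (simp add: alt_word_double)
qed

lemma cox_elt_eq_iff: "cox_elt S M f = cox_elt S M g \<longleftrightarrow> f \<simeq> g"
proof
  assume "cox_elt S M f = cox_elt S M g"
  then have "equivclp (cox_step S M) (pos f) (pos g)"
    unfolding cox_elt_def by (metis equivclp_refl mem_Collect_eq)
  then have "map fst (pos f) \<simeq> map fst (pos g)"
  proof (induction rule: equivclp_induct)
    case (step y z)
    then have "map fst y \<simeq> map fst z" using cox_step_word_eq word_eq_sym by blast
    with step show ?case by (blast intro: word_eq_trans)
  qed simp
  then show "f \<simeq> g" by simp
next
  assume "f \<simeq> g"
  then have "equivclp (cox_step S M) (pos f) (pos g)"
  proof (induction rule: equivclp_induct)
    case (step y z)
    then have "equivclp (cox_step S M) (pos y) (pos z)" using rel_step_cox_step by blast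
    with step show ?case by (blast intro: equivclp_trans)
  qed simp
  then show "cox_elt S M f = cox_elt S M g"
    unfolding cox_elt_def by (auto intro: equivclp_trans equivclp_sym)
qed

section \<open>Reduced words, reflections and the exchange condition\<close>

abbreviation red where "red f \<equiv> reduced S M f"

abbreviation braids where "braids \<equiv> (braid_step S M)\<^sup>*\<^sup>*"

abbreviation max_word where "max_word s t \<equiv> alt_word (the_enat (M s t)) s t"

abbreviation opp_word where "opp_word s t \<equiv> alt_word (the_enat (M s t)) t s"

lemma reduced_iff: "red f \<longleftrightarrow> set f \<subseteq> S \<and> (\<forall>g. set g \<subseteq> S \<and> g \<simeq> f \<longrightarrow> length f \<le> length g)"
  unfolding reduced_def cox_elt_eq_iff by (auto simp: not_less)

lemma reduced_subset: "red f \<Longrightarrow> set f \<subseteq> S"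
  by (simp add: reduced_iff)

lemma rel_step_even: "rel_step S M f g \<Longrightarrow> even (length f) \<longleftrightarrow> even (length g)"
  by (induction rule: rel_step.induct) auto

lemma word_eq_even: "f \<simeq> g \<Longrightarrow> even (length f) \<longleftrightarrow> even (length g)"
  by (induction rule: equivclp_induct) (auto dest: rel_step_even)

lemma ex_reduced: "set f \<subseteq> S \<Longrightarrow> \<exists>g. red g \<and> g \<simeq> f"
proof -
  assume f: "set f \<subseteq> S"
  obtain g where "set g \<subseteq> S \<and> g \<simeq> f" "\<And>h. set h \<subseteq> S \<and> h \<simeq> f \<Longrightarrow> length g \<le> length h"
    using f ex_has_least_nat[of "\<lambda>g. set g \<subseteq> S \<and> g \<simeq> f" f length] by auto
  then show ?thesis unfolding reduced_iff by (meson word_eq_trans)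
qed

lemma reduced_length_le: "red f \<Longrightarrow> set g \<subseteq> S \<Longrightarrow> f \<simeq> g \<Longrightarrow> length f \<le> length g"
  using reduced_iff word_eq_sym by blast

lemma reduced_length_eq: "red f \<Longrightarrow> red g \<Longrightarrow> f \<simeq> g \<Longrightarrow> length f = length g"
  by (meson le_antisym reduced_iff word_eq_sym)

lemma reduced_if_word_eq:
  "red f \<Longrightarrow> f \<simeq> g \<Longrightarrow> set g \<subseteq> S \<Longrightarrow> length g \<le> length f \<Longrightarrow> red g"
  unfolding reduced_iff by (meson le_trans word_eq_sym word_eq_trans)

lemma reduced_infix: "red (u @ f @ v) \<Longrightarrow> red f"
  unfolding reduced_iff
proof (intro conjI allI impI, goal_cases)
  case (2 g)
  then have "u @ g @ v \<simeq> u @ f @ v" by (intro word_eq_context) blast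
  with 2 have "length (u @ f @ v) \<le> length (u @ g @ v)" by (metis le_sup_iff set_append)
  then show ?case by simp
qed auto

lemma reduced_prefix: "red (f @ v) \<Longrightarrow> red f"
  using reduced_infix[of "[]" f v] by simp

lemma reduced_suffix: "red (u @ f) \<Longrightarrow> red f"
  using reduced_infix[of u f "[]"] by simp

lemma not_reduced_square: "\<not> red (u @ [s, s] @ v)"
proof
  assume r: "red (u @ [s, s] @ v)"
  then have "s \<in> S" by (auto dest: reduced_subset)
  then have "u @ [s, s] @ v \<simeq> u @ v" by (intro word_eq_delete word_eq_square)
  then show False using reduced_length_le[OF r, of "u @ v"] reduced_subset[OF r] by auto
qed

lemma reduced_Nil [simp]: "red []"
  by (simp add: reduced_iff)

lemma word_eq_rev: "f \<simeq> g \<Longrightarrow> rev f \<simeq> rev g"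
proof (induction rule: equivclp_induct)
  case (step y z)
  have "rev a \<simeq> rev b" if "rel_step S M a b" for a b
    using that
  proof (induction rule: rel_step.induct)
    case (1 s t u v)
    then have "alt_word (2 * the_enat (M s t)) t s \<simeq> []" using word_eq_relator[of t s] sym[of s t] by simp
    from word_eq_delete[OF this] show ?case by (simp add: rev_alt_word)
  qed
  with step have "rev y \<simeq> rev z" using word_eq_sym by blast
  with step show ?case by (blast intro: word_eq_trans)
qed simp

lemma reduced_rev: "red (rev f) \<longleftrightarrow> red f"
proof -
  have "red (rev f)" if "red f" for f
    using that unfolding reduced_iff by (metis length_rev rev_rev_ident set_rev word_eq_rev)
  from this[of f] this[of "rev f"] show ?thesis by auto
qed

lemma word_eq_cancel_left: "set u \<subseteq> S \<Longrightarrow> u @ f \<simeq> u @ g \<Longrightarrow> f \<simeq> g"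
proof -
  assume u: "set u \<subseteq> S" and fg: "u @ f \<simeq> u @ g"
  have "rev u @ u @ f \<simeq> rev u @ u @ g" by (rule word_eq_append[OF equivclp_refl fg])
  moreover have "rev u @ u @ h \<simeq> h" for h
    using word_eq_delete[OF word_eq_rev_left[OF u], of "[]" h] by simp
  ultimately show "f \<simeq> g" by (meson word_eq_sym word_eq_trans)
qed

lemma word_eq_cancel_right: "set u \<subseteq> S \<Longrightarrow> f @ u \<simeq> g @ u \<Longrightarrow> f \<simeq> g"
  using word_eq_cancel_left[of "rev u" "rev f" "rev g"] word_eq_rev[of "f @ u" "g @ u"]
    word_eq_rev[of "rev f" "rev g"] by simp

text \<open>By the next two lemmas the parity of the number of reflections of a word that equal a given
  element depends only on the element represented by the word.\<close>

definition refl_count where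
  "refl_count r f = length (filter (\<lambda>q. q \<simeq> r) (reflections f))"

lemma alt_word_relator_reflections:
  assumes "s \<in> S" "t \<in> S" "M s t \<noteq> \<infinity>"
  shows "even (length (filter (\<lambda>q. u @ q @ v \<simeq> r)
    (reflections (alt_word (2 * the_enat (M s t)) s t))))"
proof -
  define m where "m = the_enat (M s t)"
  \<comment> \<open>Prepending a relator shifts \<open>k\<close> by \<open>m\<close> without
    changing the element, so the \<open>2 * m\<close> reflections of a relator fall into
    \<open>m\<close> pairs of equal ones.\<close>
  have 1: "alt_word (2 * (k + m) + 1) t s \<simeq> alt_word (2 * k + 1) t s" for k
  proof -
    have "alt_word (2 * m) t s \<simeq> []" using word_eq_relator[of t s] sym[of s t] assms m_def by simp
    from word_eq_delete[OF this, of "[]" "alt_word (2 * k + 1) t s"] show ?thesis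
      using alt_word_add[of "2 * m" "2 * k + 1" t s] by (simp add: add.commute algebra_simps)
  qed
  let ?P = "\<lambda>k. u @ alt_word (2 * k + 1) t s @ v \<simeq> r"
  have P: "?P (k + m) \<longleftrightarrow> ?P k" for k
    using word_eq_context[OF 1, of u k v] by (meson word_eq_sym word_eq_trans)
  have "reflections (alt_word (2 * m) s t) = map (\<lambda>k. alt_word (2 * k + 1) t s) (rev [0..<2 * m])"
    by (rule reflections_alt_word) auto
  then have "length (filter (\<lambda>q. u @ q @ v \<simeq> r) (reflections (alt_word (2 * m) s t))) =
    length (filter ?P [0..<2 * m])"
    by (simp only: filter_map length_map comp_def rev_filter[symmetric] length_rev)
  also have "[0..<2 * m] = [0..<m] @ map (\<lambda>k. k + m) [0..<m]"
    by (simp add: map_add_upt upt_add_eq_append mult_2 flip: upt_add_eq_append)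
  also have "length (filter ?P \<dots>) = 2 * length (filter ?P [0..<m])"
    by (simp only: filter_append filter_map comp_def length_append length_map P)
  finally show ?thesis by (simp add: m_def)
qed

lemma refl_count_parity:
  assumes "f \<simeq> g"
  shows "even (refl_count r f) \<longleftrightarrow> even (refl_count r g)"
  using assms
proof (induction rule: equivclp_induct)
  case (step y z)
  have "even (refl_count r a) \<longleftrightarrow> even (refl_count r b)" if "rel_step S M a b" for a b
    using that
  proof (induction rule: rel_step.induct)
    case (1 s t u v)
    let ?R = "alt_word (2 * the_enat (M s t)) s t"
    have R: "?R \<simeq> []" "rev ?R \<simeq> []"
      using word_eq_relator[OF 1] word_eq_rev[OF word_eq_relator[OF 1]] by simp_all
    \<comment> \<open>Deleting the relator \<open>?R\<close> only conjugates the reflections of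
      \<open>u\<close> by a trivial element, and those of \<open>v\<close> stay. The counts differ
      by the reflections that belong to \<open>?R\<close>, an even number.\<close>
    have "rev v @ rev ?R @ q @ ?R @ v \<simeq> rev v @ q @ v" for q
      using word_eq_delete[OF R(2), of "rev v" "q @ ?R @ v"] word_eq_delete[OF R(1), of "rev v @ q" v]
      by (auto intro: word_eq_trans)
    then have *: "rev v @ rev ?R @ q @ ?R @ v \<simeq> r \<longleftrightarrow> rev v @ q @ v \<simeq> r" for q
      by (meson word_eq_sym word_eq_trans)
    show ?case
      using alt_word_relator_reflections[OF 1, of "rev v" v r]
      by (simp add: refl_count_def reflections_append filter_map comp_def *)
  qed
  with step show ?case by blast
qed simp

lemma word_eq_delete_reflection:
  assumes "set (a @ [x] @ b) \<subseteq> S"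
  shows "(a @ [x] @ b) @ rev b @ [x] @ b \<simeq> a @ b"
proof -
  have "(a @ [x]) @ (b @ rev b) @ ([x] @ b) \<simeq> (a @ [x]) @ ([x] @ b)"
    by (rule word_eq_delete) (use assms in \<open>auto intro: word_eq_rev_right\<close>)
  also have "(a @ [x]) @ ([x] @ b) \<simeq> a @ b"
    using word_eq_delete[OF word_eq_square[of x], of a b] assms by simp
  finally show ?thesis by simp
qed

text \<open>A letter of \<open>g\<close> with the same reflection could be deleted together with the
  final \<open>s\<close>, making \<open>g @ [s]\<close> equal to a word two letters shorter.\<close>

lemma refl_count_last:
  assumes "red (g @ [s])"
  shows "refl_count [s] (g @ [s]) = 1"
proof -
  have S: "s \<in> S" "set g \<subseteq> S" using reduced_subset[OF assms] by auto
  have "\<not> [s] @ q @ [s] \<simeq> [s]" if q: "q \<in> set (reflections g)" for q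
  proof
    assume a: "[s] @ q @ [s] \<simeq> [s]"
    then have "q @ [s] \<simeq> []" using word_eq_cancel_left[of "[s]" "q @ [s]" "[]"] S by simp
    also have "[] \<simeq> [s] @ [s]" using word_eq_square[OF S(1)] word_eq_sym by simp
    finally have qs: "q \<simeq> [s]" using word_eq_cancel_right[of "[s]"] S by simp
    from q obtain a x b where abx: "g = a @ [x] @ b" "q = rev b @ [x] @ b"
      unfolding in_reflections_iff by blast
    have "g @ [s] \<simeq> g @ q" using qs word_eq_sym by (intro word_eq_append) auto
    also have "g @ q \<simeq> a @ b" using word_eq_delete_reflection[of a x b] S abx by simp
    finally show False using reduced_length_le[OF assms, of "a @ b"] S abx by auto
  qed
  then have "filter (\<lambda>q. s # q @ [s] \<simeq> [s]) (reflections g) = []" by (simp add: filter_empty_conv)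
  then show ?thesis by (simp add: refl_count_def reflections_append filter_map comp_def)
qed

text \<open>Multiplication by \<open>s\<close> changes the parity of the length, so a shorter word
  \<open>v\<close> for \<open>f @ [s]\<close> is even shorter than \<open>f\<close>, and
  \<open>v @ [s]\<close> is then a shortest word for \<open>f\<close>.\<close>

lemma shorter_if_not_reduced_snoc:
  assumes "red f" "s \<in> S" "\<not> red (f @ [s])"
  obtains v where "red (v @ [s])" "v @ [s] \<simeq> f" "v \<simeq> f @ [s]"
proof -
  have fS: "set f \<subseteq> S" using assms reduced_subset by blast
  obtain v where v: "set v \<subseteq> S" "v \<simeq> f @ [s]" "length v < Suc (length f)"
    using assms fS unfolding reduced_iff by (auto simp: not_le)
  have "length v \<noteq> length f" using word_eq_even[OF v(2)] by auto
  then have len: "length (v @ [s]) \<le> length f" using v by auto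
  have "v @ [s] \<simeq> (f @ [s]) @ [s]" using v by (intro word_eq_append) auto
  also have "(f @ [s]) @ [s] \<simeq> f" using word_eq_delete[OF word_eq_square[OF assms(2)], of f "[]"] by simp
  finally have vs: "v @ [s] \<simeq> f" .
  then have "red (v @ [s])" using reduced_if_word_eq[OF assms(1), of "v @ [s]"] word_eq_sym v assms len by auto
  with vs v that show ?thesis by blast
qed

text \<open>\<open>f\<close> is the same element as a reduced word ending in \<open>s\<close>, which
  has the reflection \<open>s\<close> exactly once; by parity at least one occurrence remains in
  \<open>f\<close>.\<close>

lemma exchange_reflection:
  assumes "red f" "s \<in> S" "\<not> red (f @ [s])"
  obtains q where "q \<in> set (reflections f)" "q \<simeq> [s]"
proof -
  obtain v where v: "red (v @ [s])" "v @ [s] \<simeq> f"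
    by (rule shorter_if_not_reduced_snoc[OF assms])
  have "odd (refl_count [s] f)" using refl_count_parity[OF v(2), of "[s]"] refl_count_last[OF v(1)] by simp
  then have "refl_count [s] f \<noteq> 0" by (metis even_zero)
  with that show ?thesis by (auto simp: refl_count_def filter_empty_conv)
qed

lemma exchange:
  assumes "red f" "s \<in> S" "\<not> red (f @ [s])"
  obtains a x b where "f = a @ [x] @ b" "f @ [s] \<simeq> a @ b"
proof -
  have fS: "set f \<subseteq> S" using assms reduced_subset by blast
  obtain q where q: "q \<in> set (reflections f)" "q \<simeq> [s]"
    by (rule exchange_reflection[OF assms])
  then obtain a x b where ax: "f = a @ [x] @ b" "q = rev b @ [x] @ b"
    unfolding in_reflections_iff by blast
  have "f @ [s] \<simeq> f @ q" using q word_eq_sym by (intro word_eq_append) auto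
  also have "f @ q \<simeq> a @ b" using word_eq_delete_reflection[of a x b] fS ax by simp
  finally show ?thesis using that ax by blast
qed

end

subsection \<open>The dual geometric representation\<close>

text \<open>This is the Chebyshev recurrence, solved by the addition theorem of the sine. The factor
  \<open>sin \<theta>\<close> stays on the left so that no division occurs.\<close>

lemma dihedral_recurrence:
  fixes a :: "nat \<Rightarrow> real"
  assumes "\<And>j. a (Suc (Suc j)) = 2 * cos \<theta> * a (Suc j) - a j"
  shows "a j * sin \<theta> = a 1 * sin (real j * \<theta>) - a 0 * sin (real j * \<theta> - \<theta>)"
proof -
  have step: "sin (x + \<theta> + \<theta>) = 2 * cos \<theta> * sin (x + \<theta>) - sin x" for x :: real
  proof -
    have "sin (y + \<theta>) + sin (y - \<theta>) = 2 * cos \<theta> * sin y" for y :: real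
      by (simp add: sin_add sin_diff)
    from this[of "x + \<theta>"] show ?thesis by simp
  qed
  have "a j * sin \<theta> = a 1 * sin (real j * \<theta>) - a 0 * sin (real j * \<theta> - \<theta>) \<and>
    a (Suc j) * sin \<theta> = a 1 * sin (real (Suc j) * \<theta>) - a 0 * sin (real (Suc j) * \<theta> - \<theta>)"
  proof (induction j)
    case (Suc j)
    have 1: "sin (real (Suc (Suc j)) * \<theta>) =
      2 * cos \<theta> * sin (real (Suc j) * \<theta>) - sin (real j * \<theta>)"
      using step[of "real j * \<theta>"] by (simp add: algebra_simps)
    have 2: "sin (real (Suc (Suc j)) * \<theta> - \<theta>) =
      2 * cos \<theta> * sin (real (Suc j) * \<theta> - \<theta>) - sin (real j * \<theta> - \<theta>)"
      using step[of "real j * \<theta> - \<theta>"] by (simp add: algebra_simps)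
    have "a (Suc (Suc j)) * sin \<theta> = 2 * cos \<theta> * (a (Suc j) * sin \<theta>) - a j * sin \<theta>"
      by (simp add: assms algebra_simps)
    also have "\<dots> = a 1 * sin (real (Suc (Suc j)) * \<theta>) - a 0 * sin (real (Suc (Suc j)) * \<theta> - \<theta>)"
      unfolding 1 2 conjunct1[OF Suc] conjunct2[OF Suc] by (simp add: algebra_simps)
    finally show ?case using Suc by simp
  qed simp
  then show ?thesis by blast
qed

context coxeter_matrix
begin

text \<open>The Gram matrix of the simple roots, normalised to 1 on the diagonal:
  \<open>M s s = 1\<close> gives minus the cosine of pi. The factor 2 of the reflection formula is
  not built in.\<close>

definition cartan :: "'s \<Rightarrow> 's \<Rightarrow> real" where
  "cartan s t = (if M s t = \<infinity> then -1 else - cos (pi / real (the_enat (M s t))))"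

text \<open>The dual of the geometric representation, on all of \<open>S \<rightarrow> \<real>\<close>: the value at \<open>u\<close> is the
  value on the simple root of \<open>u\<close>.\<close>

definition simple_reflection :: "'s \<Rightarrow> ('s \<Rightarrow> real) \<Rightarrow> 's \<Rightarrow> real" where
  "simple_reflection s l = (\<lambda>u. l u - 2 * cartan s u * l s)"

lemma cartan_diag: "s \<in> S \<Longrightarrow> cartan s s = 1"
  by (simp add: cartan_def diag one_enat_def)

lemma cartan_sym: "s \<in> S \<Longrightarrow> t \<in> S \<Longrightarrow> cartan s t = cartan t s"
  by (simp add: cartan_def sym)

definition orbit where
  "orbit s t l j = fold simple_reflection (alt_word j s t) l"

text \<open>The coordinate at the letter that is read next, which is the one value of the functional
  that scales the next displacement.\<close>

definition orbit_coord where
  "orbit_coord s t l j = orbit s t l j (if even j then s else t)"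

lemma orbit_Suc:
  "orbit s t l (Suc j) u = orbit s t l j u - 2 * cartan (if even j then s else t) u * orbit_coord s t l j"
  by (simp add: orbit_def orbit_coord_def alt_word_snoc simple_reflection_def del: alt_word.simps)

text \<open>A reflection negates its own coordinate, so the coordinate used two steps later is the
  negated old one, corrected by the step in between.\<close>

lemma orbit_coord_recurrence:
  assumes "s \<in> S" "t \<in> S"
  shows "orbit_coord s t l (Suc (Suc j)) = - 2 * cartan s t * orbit_coord s t l (Suc j) - orbit_coord s t l j"
proof -
  let ?x = "if even j then s else t" and ?y = "if even j then t else s"
  have "orbit_coord s t l (Suc (Suc j)) =
    orbit s t l (Suc j) ?x - 2 * cartan ?y ?x * orbit_coord s t l (Suc j)"
    unfolding orbit_coord_def[of s t l "Suc (Suc j)"] orbit_Suc[of s t l "Suc j"] by simp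
  moreover have "orbit s t l (Suc j) ?x = - orbit_coord s t l j"
    unfolding orbit_Suc[of s t l j] using assms cartan_diag by (simp add: orbit_coord_def)
  ultimately show ?thesis using cartan_sym[OF assms] by simp
qed

text \<open>Coordinates at letters \<open>u\<close> outside \<open>{s, t}\<close> move as well.
  Their total displacement depends only on the sums of the coordinates used at the even and at the
  odd steps.\<close>

lemma orbit_even:
  "orbit s t l (2 * n) u = l u - 2 * cartan s u * (\<Sum>i<n. orbit_coord s t l (2 * i))
    - 2 * cartan t u * (\<Sum>i<n. orbit_coord s t l (2 * i + 1))"
proof (induction n)
  case 0
  then show ?case by (simp add: orbit_def)
next
  case (Suc n)
  then show ?case by (simp add: orbit_Suc algebra_simps)
qed

text \<open>The coordinates used are periodic with period \<open>2 * m\<close>, and it remains to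
  see that the displacement over one period vanishes. Summing the recurrence over a period gives E =
  cos(\<theta>) F and F = cos(\<theta>) E for the even and odd sums, hence
  \<open>E * (sin \<theta>)\<^sup>2 = 0\<close> and both are zero. The case \<open>s = t\<close> is
  separate because there m = 1 and the sine vanishes.\<close>

lemma orbit_relator:
  assumes st: "s \<in> S" "t \<in> S" "M s t \<noteq> \<infinity>"
  shows "orbit s t l (2 * the_enat (M s t)) = l"
proof (cases "s = t")
  case True
  then have "M s t = 1" using diag st by simp
  then have "orbit s t l (2 * the_enat (M s t)) = simple_reflection s (simple_reflection s l)"
    using True by (simp add: orbit_def one_enat_def numeral_eq_Suc)
  also have "\<dots> = l" using cartan_diag[OF st(1)] by (simp add: simple_reflection_def)
  finally show ?thesis .
next
  case False
  define m where "m = the_enat (M s t)"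
  have Mm: "M s t = enat m" using st m_def by auto
  then have m2: "2 \<le> m" using off_diag[OF st(1,2) False] by (simp add: numeral_eq_enat)
  define \<theta> where "\<theta> = pi / real m"
  define a where "a = orbit_coord s t l"
  have c: "cartan s t = - cos \<theta>" by (simp add: cartan_def Mm \<theta>_def)
  have rec: "a (Suc (Suc j)) = 2 * cos \<theta> * a (Suc j) - a j" for j
    unfolding a_def by (subst orbit_coord_recurrence[OF st(1,2)]) (simp add: c)
  have sin_pos: "sin \<theta> > 0"
    by (rule sin_gt_zero) (use m2 in \<open>auto simp: \<theta>_def field_simps\<close>)
  have per: "a (j + 2 * m) = a j" for j
  proof -
    have *: "real (j + 2 * m) * \<theta> = real j * \<theta> + 2 * pi" using m2 by (simp add: \<theta>_def field_simps)
    have **: "sin (real (j + 2 * m) * \<theta>) = sin (real j * \<theta>)"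
      "sin (real (j + 2 * m) * \<theta> - \<theta>) = sin (real j * \<theta> - \<theta>)"
      unfolding * using sin_periodic[of "real j * \<theta> - \<theta>"] sin_periodic[of "real j * \<theta>"] by (simp_all add: algebra_simps)
    have "a (j + 2 * m) * sin \<theta> = a j * sin \<theta>"
      unfolding dihedral_recurrence[of a, OF rec] ** ..
    then show ?thesis using sin_pos by simp
  qed
  define E where "E = (\<Sum>i<m. a (2 * i))"
  define F where "F = (\<Sum>i<m. a (2 * i + 1))"
  have tele: "(\<Sum>i<m. f (Suc i)) = (\<Sum>i<m. f i) + f m - f 0" for f :: "nat \<Rightarrow> real"
    using sum.lessThan_Suc_shift[of f m] by simp
  have "E = (\<Sum>i<m. a (2 * Suc i))"
    using tele[of "\<lambda>i. a (2 * i)"] per[of 0] by (simp add: E_def)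
  also have "\<dots> = (\<Sum>i<m. 2 * cos \<theta> * a (2 * i + 1) - a (2 * i))"
    by (rule sum.cong) (simp_all add: rec)
  finally have 1: "2 * E = 2 * cos \<theta> * F"
    by (simp add: sum_subtractf sum_distrib_left E_def F_def)
  have "F = (\<Sum>i<m. a (2 * Suc i + 1))"
    using tele[of "\<lambda>i. a (2 * i + 1)"] per[of 1] by (simp add: F_def)
  also have "\<dots> = (\<Sum>i<m. 2 * cos \<theta> * a (2 * Suc i) - a (2 * i + 1))"
    by (rule sum.cong) (simp_all add: rec)
  also have "\<dots> = 2 * cos \<theta> * (\<Sum>i<m. a (2 * Suc i)) - F"
    by (simp add: sum_subtractf sum_distrib_left F_def)
  also have "(\<Sum>i<m. a (2 * Suc i)) = E"
    using tele[of "\<lambda>i. a (2 * i)"] per[of 0] by (simp add: E_def)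
  finally have 2: "2 * F = 2 * cos \<theta> * E" by simp
  have "E * (sin \<theta>)\<^sup>2 = E - cos \<theta> * (cos \<theta> * E)"
    unfolding sin_squared_eq by (simp add: power2_eq_square algebra_simps)
  also have "\<dots> = 0" using 1 2 by simp
  finally have "E = 0" using sin_pos by simp
  with 2 have "F = 0" by simp
  have "orbit s t l (2 * m) u = l u" for u
    unfolding orbit_even using \<open>E = 0\<close> \<open>F = 0\<close> by (simp add: E_def F_def a_def)
  then show ?thesis unfolding m_def by blast
qed

lemma word_eq_simple_reflection:
  assumes "f \<simeq> g"
  shows "fold simple_reflection f = fold simple_reflection g"
  using assms
proof (induction rule: equivclp_induct)
  case (step y z)
  have "fold simple_reflection a = fold simple_reflection b" if "rel_step S M a b" for a b
    using that
  proof (induction rule: rel_step.induct)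
    case (1 s t u v)
    then show ?case using orbit_relator[OF 1] by (auto simp: orbit_def)
  qed
  with step show ?case by metis
qed simp

text \<open>On the functional that is 1 at \<open>t\<close> and 0 elsewhere, the coordinates used
  start with 0, 1, so the i-th one is sin(i \<theta>) / sin(\<theta>), or i if \<open>M s t\<close>
  is infinite. Finding 0, 1 again after \<open>2 * j\<close> steps would force \<open>M s t\<close>
  to divide \<open>j\<close> in the finite case and \<open>j\<close> to be 0 in the infinite
  one.\<close>

lemma alt_word_nontrivial:
  assumes st: "s \<in> S" "t \<in> S" "s \<noteq> t" and j: "0 < j" "enat j < M s t"
  shows "\<not> alt_word (2 * j) s t \<simeq> []"
proof
  assume "alt_word (2 * j) s t \<simeq> []"
  define l where "l = (\<lambda>u. if u = t then 1 else 0 :: real)"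
  from \<open>alt_word (2 * j) s t \<simeq> []\<close> have L: "orbit s t l (2 * j) = l"
    using word_eq_simple_reflection by (fastforce simp: orbit_def)
  define a where "a = orbit_coord s t l"
  have rec: "a (Suc (Suc j)) = - 2 * cartan s t * a (Suc j) - a j" for j
    unfolding a_def by (rule orbit_coord_recurrence[OF st(1,2)])
  have a0: "a 0 = 0" using st by (simp add: a_def orbit_coord_def orbit_def l_def)
  have a1: "a 1 = 1"
    using st orbit_Suc[of s t l 0 t] a0 by (simp add: a_def orbit_coord_def) (simp add: orbit_def l_def)
  have aj: "a (2 * j) = 0" "a (2 * j + 1) = 1"
    using st(3) orbit_Suc[of s t l "2 * j" t] unfolding a_def orbit_coord_def L by (simp_all add: l_def)
  show False
  proof (cases "M s t")
    case infinity
    then have "a (Suc (Suc i)) = 2 * a (Suc i) - a i" for i using rec by (simp add: cartan_def)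
    then have "a i = real i \<and> a (Suc i) = real (Suc i)" for i
      by (induction i) (use a0 a1 in auto)
    with aj j show False by (metis less_numeral_extra(3) mult_eq_0_iff of_nat_eq_0_iff zero_neq_numeral)
  next
    case (enat m)
    then have m2: "2 \<le> m" using off_diag[OF st] by (simp add: numeral_eq_enat)
    define \<theta> where "\<theta> = pi / real m"
    have c: "cartan s t = - cos \<theta>" by (simp add: cartan_def enat \<theta>_def)
    have sin_pos: "sin \<theta> > 0"
      by (rule sin_gt_zero) (use m2 in \<open>auto simp: \<theta>_def field_simps\<close>)
    have rec': "a (Suc (Suc i)) = 2 * cos \<theta> * a (Suc i) - a i" for i using rec[of i] c by simp
    have sol: "a i * sin \<theta> = sin (real i * \<theta>)" for i
      using dihedral_recurrence[of a, OF rec', of i] a0 a1 by simp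
    have s0: "sin (real (2 * j) * \<theta>) = 0" using sol[of "2 * j"] aj by simp
    have "sin (real (2 * j) * \<theta> + \<theta>) = sin \<theta>"
      using sol[of "2 * j + 1"] aj(2) by (simp add: algebra_simps)
    then have "cos (real (2 * j) * \<theta>) = 1" using sin_pos unfolding sin_add s0 by simp
    then obtain n :: int where n: "real (2 * j) * \<theta> = real_of_int n * 2 * pi"
      using cos_one_2pi_int by blast
    then have "real j = real_of_int n * real m" using m2 by (simp add: \<theta>_def field_simps)
    then have "int j = n * int m" by (metis of_int_eq_iff of_int_mult of_int_of_nat_eq)
    moreover have "j < m" using j enat by simp
    ultimately show False using j(1)
      by (metis dvd_triv_right int_dvd_int_iff nat_dvd_not_less)
  qed
qed

text \<open>If appending \<open>x\<close> spoiled reducedness, \<open>x\<close> would equal a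
  reflection of the shorter word, that is, an alternating word of odd length
  \<open>2 * j + 1\<close>. Then an alternating word of length \<open>2 * (j + 1)\<close> would be
  trivial although \<open>j + 1\<close> is below \<open>M s t\<close>.\<close>

lemma reduced_alt_word:
  assumes st: "s \<in> S" "t \<in> S" "s \<noteq> t" and "enat k \<le> M s t"
  shows "red (alt_word k s t)"
  using assms(4)
proof (induction k)
  case (Suc k)
  then have k: "enat k < M s t" by (simp add: Suc_ile_eq)
  then have IH: "red (alt_word k s t)" using Suc by simp
  define x where "x = (if even k then s else t)"
  define y where "y = (if even k then t else s)"
  have xy: "x \<in> S" "y \<in> S" "y \<noteq> x" "M y x = M s t" using st sym[of s t] by (auto simp: x_def y_def)
  show ?case
  proof (rule ccontr)
    assume "\<not> red (alt_word (Suc k) s t)"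
    then have nr: "\<not> red (alt_word k s t @ [x])" unfolding alt_word_snoc x_def .
    obtain q where q: "q \<in> set (reflections (alt_word k s t))" "q \<simeq> [x]"
      by (rule exchange_reflection[OF IH xy(1) nr])
    have "reflections (alt_word k s t) = map (\<lambda>j. alt_word (2 * j + 1) y x) (rev [0..<k])"
      by (rule reflections_alt_word) (auto simp: x_def y_def)
    with q obtain j where j: "j < k" "alt_word (2 * j + 1) y x \<simeq> [x]" by auto
    have "alt_word (2 * (j + 1)) y x = alt_word (2 * j + 1) y x @ [x]"
      using alt_word_snoc[of "2 * j + 1" y x] by simp
    also have "\<dots> \<simeq> [x] @ [x]" by (rule word_eq_append[OF j(2)]) simp
    also have "[x] @ [x] \<simeq> []" using word_eq_square[OF xy(1)] by simp
    finally have "alt_word (2 * (j + 1)) y x \<simeq> []" .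
    moreover have "enat (j + 1) < M y x"
      using j(1) k xy(4) by (metis Suc_eq_plus1 enat_ord_simps(1) less_eq_Suc_le order_le_less_trans)
    ultimately show False using alt_word_nontrivial[OF xy(2,1,3), of "j + 1"] by simp
  qed
qed simp

subsection \<open>Descents and parabolic subgroups\<close>

text \<open>The deleted letter cannot lie in \<open>u\<close>: cancelling \<open>x\<close> on the
  left would then make \<open>u @ [s]\<close> equal to a word shorter than itself.\<close>

lemma exchange_left_part:
  assumes "red (x @ u)" "s \<in> S" "red (u @ [s])" "\<not> red (x @ u @ [s])"
  obtains a y b where "x = a @ [y] @ b" "x @ u @ [s] \<simeq> a @ b @ u"
proof -
  obtain a y b where ayb: "x @ u = a @ [y] @ b" "(x @ u) @ [s] \<simeq> a @ b"
    by (rule exchange[OF assms(1,2)]) (use assms(4) in auto)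
  have xS: "set x \<subseteq> S" "set u \<subseteq> S" using reduced_subset[OF assms(1)] by auto
  show ?thesis
  proof (cases "length a < length x")
    case True
    then obtain b' where "x = a @ [y] @ b'" "b = b' @ u"
      using ayb(1) by (auto simp: append_eq_append_conv2 append_eq_Cons_conv)
    with ayb that show ?thesis by simp
  next
    case False
    then obtain a' where a': "a = x @ a'" "u = a' @ [y] @ b"
      using ayb(1) by (auto simp: append_eq_append_conv2 append_eq_Cons_conv)
    then have "u @ [s] \<simeq> a' @ b" using ayb(2) xS(1) word_eq_cancel_left[of x] by simp
    then have "length (u @ [s]) \<le> length (a' @ b)"
      by (rule reduced_length_le[OF assms(3), rotated]) (use xS a' in auto)
    then show ?thesis using a' by simp
  qed
qed

text \<open>The letters of \<open>u\<close> are attached one at a time. Each is a descent of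
  \<open>w\<close>, so the exchange condition removes a letter, and this comes from the part
  \<open>x\<close> in front because \<open>u\<close> with the new letter is reduced. In particular
  no reduced word over a set of descents of \<open>w\<close> is longer than \<open>w\<close>, which
  is how finiteness of parabolic subgroups enters.\<close>

lemma descents_suffix:
  assumes w: "red w" and J: "J \<subseteq> S" "\<And>s. s \<in> J \<Longrightarrow> \<not> red (w @ [s])"
    and u: "red u" "set u \<subseteq> J"
  shows "\<exists>x. red (x @ u) \<and> x @ u \<simeq> w"
  using u
proof (induction u rule: rev_induct)
  case Nil
  then show ?case using w by (intro exI[of _ w]) simp
next
  case (snoc s u)
  then obtain x where x: "red (x @ u)" "x @ u \<simeq> w"
    using reduced_prefix by auto
  have s: "s \<in> J" "s \<in> S" using snoc J by auto
  have xs: "(x @ u) @ [s] \<simeq> w @ [s]" by (rule word_eq_append[OF x(2)]) simp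
  have "\<not> red (x @ u @ [s])"
  proof
    assume "red (x @ u @ [s])"
    then have "red (w @ [s])"
      using reduced_if_word_eq[of "x @ u @ [s]" "w @ [s]"] xs s reduced_subset[OF w]
        reduced_length_eq[OF x(1) w x(2)] by simp
    with J s show False by blast
  qed
  then obtain a y b where ayb: "x = a @ [y] @ b" "x @ u @ [s] \<simeq> a @ b @ u"
    by (rule exchange_left_part[OF x(1) s(2) snoc.prems(1)])
  have "(a @ b) @ u @ [s] \<simeq> (x @ u @ [s]) @ [s]"
    using word_eq_append[of "a @ b @ u" "x @ u @ [s]" "[s]" "[s]"] ayb(2) word_eq_sym by simp
  also have "(x @ u @ [s]) @ [s] \<simeq> x @ u"
    using word_eq_delete[OF word_eq_square[OF s(2)], of "x @ u" "[]"] by simp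
  finally have *: "(a @ b) @ u @ [s] \<simeq> x @ u" .
  have "red ((a @ b) @ u @ [s])"
    by (rule reduced_if_word_eq[OF x(1)]) (use * word_eq_sym reduced_subset[OF x(1)] s ayb in auto)
  with * x(2) show ?case by (blast intro: word_eq_trans)
qed

section \<open>Braid moves on words and the solution of the word problem\<close>

lemma finite_pair_sym: "finite_pair S M s t \<Longrightarrow> finite_pair S M t s \<and> M t s = M s t"
  using sym by (auto simp: finite_pair_def)

lemma finite_pairD:
  assumes "finite_pair S M s t"
  shows "s \<in> S" "t \<in> S" "s \<noteq> t" "M s t = enat (the_enat (M s t))" "2 \<le> the_enat (M s t)"
proof -
  show *: "s \<in> S" "t \<in> S" "s \<noteq> t" "M s t = enat (the_enat (M s t))"
    using assms by (auto simp: finite_pair_def)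
  show "2 \<le> the_enat (M s t)"
    using off_diag[OF *(1-3)] *(4) by (metis enat_ord_simps(1) numeral_eq_enat)
qed

lemma braid_step_rev:
  assumes "finite_pair S M s t"
  shows "braid_step S M (u @ rev (max_word s t) @ v)
    (u @ rev (opp_word s t) @ v)"
  using braid_step.intros[OF assms, of u v] braid_step.intros[of S M t s u v]
    finite_pair_sym[OF assms] by (simp add: rev_alt_word)

lemma braid_step_sym: "braid_step S M f g \<Longrightarrow> braid_step S M g f"
proof (induction rule: braid_step.induct)
  case (1 s t u v)
  then show ?case using braid_step.intros[of S M t s u v] finite_pair_sym[of s t] by simp
qed

lemma braid_sym: "braids f g \<Longrightarrow> braids g f"
  by (induction rule: rtranclp_induct) (auto intro: converse_rtranclp_into_rtranclp braid_step_sym)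

lemma braid_step_context: "braid_step S M f g \<Longrightarrow> braid_step S M (u @ f @ v) (u @ g @ v)"
proof (induction rule: braid_step.induct)
  case (1 s t u' v')
  then show ?case using braid_step.intros[OF 1, of "u @ u'" "v' @ v"] by simp
qed

lemma braid_context:
  "braids f g \<Longrightarrow> braids (u @ f @ v) (u @ g @ v)"
  by (induction rule: rtranclp_induct) (auto intro: rtranclp.rtrancl_into_rtrancl braid_step_context)

lemma braid_step_word_eq: "braid_step S M f g \<Longrightarrow> f \<simeq> g"
proof (induction rule: braid_step.induct)
  case (1 s t u v)
  define m where "m = the_enat (M s t)"
  have fp: "s \<in> S" "t \<in> S" "M s t \<noteq> \<infinity>" using 1 by (auto simp: finite_pair_def)
  have "alt_word (m + m) s t = alt_word m s t @ rev (alt_word m t s)"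
    unfolding alt_word_add rev_alt_word by simp
  then have "alt_word m s t @ rev (alt_word m t s) \<simeq> []"
    using word_eq_relator[OF fp] by (simp add: mult_2 m_def)
  also have "[] \<simeq> alt_word m t s @ rev (alt_word m t s)"
    using word_eq_rev_right[of "alt_word m t s"] set_alt_word_subset[of m t s] fp word_eq_sym by auto
  finally have "alt_word m s t \<simeq> alt_word m t s"
    by (rule word_eq_cancel_right[rotated]) (use set_alt_word_subset[of m t s] fp in auto)
  then show ?case unfolding m_def by (rule word_eq_context)
qed

lemma braid_word_eq: "braids f g \<Longrightarrow> f \<simeq> g"
  by (induction rule: rtranclp_induct) (auto intro: word_eq_trans braid_step_word_eq)

lemma braid_step_set: "braid_step S M f g \<Longrightarrow> set f = set g"
proof (induction rule: braid_step.induct)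
  case (1 s t u v)
  then show ?case using finite_pairD(5)[OF 1] by (auto simp: set_alt_word)
qed

lemma braid_set: "braids f g \<Longrightarrow> set f = set g"
  by (induction rule: rtranclp_induct) (auto dest: braid_step_set)

lemma braid_step_length: "braid_step S M f g \<Longrightarrow> length f = length g"
  by (induction rule: braid_step.induct) auto

lemma braid_length: "braids f g \<Longrightarrow> length f = length g"
  by (induction rule: rtranclp_induct) (auto dest: braid_step_length)

lemma braid_reduced: "braids f g \<Longrightarrow> red f \<Longrightarrow> red g"
  using reduced_if_word_eq[of f g] braid_word_eq[of f g] braid_set[of f g] braid_length[of f g]
    reduced_subset[of f] by simp

text \<open>Otherwise alternating words of every length are reduced, while a reduced word over two
  descents cannot be longer than \<open>w\<close>.\<close>

lemma descents_finite_pair: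
  assumes w: "red w" and st: "s \<in> S" "t \<in> S" "s \<noteq> t" "\<not> red (w @ [s])" "\<not> red (w @ [t])"
  shows "finite_pair S M s t"
proof (rule ccontr)
  assume "\<not> finite_pair S M s t"
  then have "M s t = \<infinity>" using st by (auto simp: finite_pair_def)
  then have "red (alt_word (Suc (length w)) s t)" by (intro reduced_alt_word[OF st(1-3)]) simp
  then obtain x where "red (x @ alt_word (Suc (length w)) s t)" "x @ alt_word (Suc (length w)) s t \<simeq> w"
    using descents_suffix[OF w, of "{s, t}"] st set_alt_word_subset[of "Suc (length w)" s t]
    by (metis empty_subsetI insert_iff insert_subset singletonD)
  from reduced_length_eq[OF this(1) w this(2)] show False by simp
qed

lemma descent_if_word_eq_snoc:
  assumes "red f" "red (g @ [t])" "f \<simeq> g @ [t]"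
  shows "\<not> red (f @ [t])"
proof
  assume r: "red (f @ [t])"
  have t: "t \<in> S" "set g \<subseteq> S" using reduced_subset[OF assms(2)] by auto
  have "f @ [t] \<simeq> (g @ [t]) @ [t]" by (rule word_eq_append[OF assms(3)]) simp
  also have "(g @ [t]) @ [t] \<simeq> g" using word_eq_delete[OF word_eq_square[OF t(1)], of g "[]"] by simp
  finally have "length (f @ [t]) \<le> length g" using reduced_length_le[OF r] t by blast
  then show False using reduced_length_eq[OF assms] by simp
qed

text \<open>Induction on the length; equal last letters cancel. If the last letters are distinct,
  both are descents, and the element has reduced words \<open>x @ u\<close> and \<open>x @ v\<close>
  in which \<open>u\<close> and \<open>v\<close> are the two longest words in \<open>s\<close> and
  \<open>t\<close>. These two differ by one braid move, and each shares its last letter with one of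
  the given words.\<close>

theorem matsumoto_tits:
  assumes "red f" "red g" "f \<simeq> g"
  shows "braids f g"
  using assms
proof (induction "length f" arbitrary: f g)
  case 0
  then show ?case using reduced_length_eq[of f g] by simp
next
  case (Suc n)
  have len: "length f = length g" using reduced_length_eq Suc.prems by blast
  then obtain f0 s g0 t where fg: "f = f0 @ [s]" "g = g0 @ [t]"
    using Suc(2) by (metis length_0_conv nat.simps(3) rev_exhaust)
  have S: "s \<in> S" "t \<in> S" using reduced_subset Suc.prems fg by force+
  have l0: "length f0 = n" using Suc(2) fg by simp
  have IH: "braids (h @ [x]) (k @ [x])"
    if "red (h @ [x])" "red (k @ [x])" "h @ [x] \<simeq> k @ [x]" "length h = n" for h k x
  proof -
    have "h \<simeq> k" using that word_eq_cancel_right[of "[x]"] reduced_subset by fastforce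
    then have "braids h k" using Suc.hyps(1) that reduced_prefix by blast
    from braid_context[OF this, of "[]" "[x]"] show ?thesis by simp
  qed
  show ?case
  proof (cases "s = t")
    case True
    then show ?thesis using IH[of f0 s g0] Suc.prems l0 unfolding fg by simp
  next
    case False
    have ds: "\<not> red (f @ [s])" using not_reduced_square[of f0 s "[]"] fg by simp
    have dt: "\<not> red (f @ [t])" using descent_if_word_eq_snoc Suc.prems fg by blast
    have fp: "finite_pair S M s t" by (rule descents_finite_pair[OF Suc.prems(1) S False ds dt])
    define m where "m = the_enat (M s t)"
    note D = finite_pairD[OF fp, folded m_def]
    \<comment> \<open>Reversed, an alternating word starting with \<open>s\<close> ends in
      \<open>s\<close> whatever the parity of \<open>m\<close>.\<close>
    define u where "u = rev (alt_word m s t)"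
    define v where "v = rev (alt_word m t s)"
    obtain k where k: "m = Suc k" using D(5) by (cases m) auto
    have uv: "u = rev (alt_word k t s) @ [s]" "v = rev (alt_word k s t) @ [t]" unfolding u_def v_def k by simp_all
    have "red u" unfolding u_def reduced_rev using reduced_alt_word[OF D(1-3)] D(4) by simp
    then obtain x where x: "red (x @ u)" "x @ u \<simeq> f"
      using descents_suffix[OF Suc.prems(1), of "{s, t}" u] S ds dt set_alt_word_subset[of m s t] u_def
      by auto
    have xuv: "braid_step S M (x @ u) (x @ v)"
      using braid_step_rev[OF fp, of x "[]"] by (simp add: u_def v_def m_def)
    then have rv: "red (x @ v)" using braid_reduced x by blast
    have lx: "length (x @ u) = length f" using reduced_length_eq x Suc.prems by blast
    have "braids f (x @ u)"
      using IH[of f0 s "x @ rev (alt_word k t s)"] Suc.prems(1) x(1) equivclp_sym[OF x(2)] l0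
      unfolding fg uv by simp
    moreover have "braids (x @ v) g"
    proof -
      have "x @ v \<simeq> x @ u" using braid_step_word_eq[OF xuv] word_eq_sym by blast
      also note x(2)
      also note \<open>f \<simeq> g\<close>
      finally have "x @ v \<simeq> g" .
      then show ?thesis
        using IH[of "x @ rev (alt_word k s t)" t g0] rv Suc.prems(2) l0 lx unfolding fg uv by simp
    qed
    ultimately show ?thesis using xuv by (meson rtranclp.rtrancl_into_rtrancl rtranclp_trans)
  qed
qed

text \<open>The first letter that spoils reducedness is a descent of the reduced word before it, so
  by Matsumoto's theorem that word can be braided until its last letter equals the new one.\<close>

lemma not_reduced_braid_square:
  assumes "set f \<subseteq> S" "\<not> red f"
  shows "\<exists>u s v. braids f (u @ [s, s] @ v)"
  using assms
proof (induction f rule: rev_induct)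
  case (snoc s f)
  show ?case
  proof (cases "red f")
    case True
    obtain v where v: "red (v @ [s])" "v @ [s] \<simeq> f"
      by (rule shorter_if_not_reduced_snoc[OF True]) (use snoc in auto)
    then have "braids f (v @ [s])" using matsumoto_tits True word_eq_sym by blast
    from braid_context[OF this, of "[]" "[s]"] show ?thesis by fastforce
  next
    case False
    then obtain u x v where "braids f (u @ [x, x] @ v)" using snoc by auto
    from braid_context[OF this, of "[]" "[s]"] show ?thesis by fastforce
  qed
qed simp

lemma reduced_set_eq: "red f \<Longrightarrow> red g \<Longrightarrow> f \<simeq> g \<Longrightarrow> set f = set g"
  using braid_set[OF matsumoto_tits] by blast

section \<open>Standard parabolic subgroups and their cosets\<close>

lemma sub_coxeter_matrix: "J \<subseteq> S \<Longrightarrow> coxeter_matrix J M"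
  using diag sym off_diag by unfold_locales blast+

lemma sub_braid_step: "braid_step J M f g \<Longrightarrow> J \<subseteq> S \<Longrightarrow> braid_step S M f g"
  by (induction rule: braid_step.induct) (auto intro!: braid_step.intros simp: finite_pair_def)

lemma sub_braid: "(braid_step J M)\<^sup>*\<^sup>* f g \<Longrightarrow> J \<subseteq> S \<Longrightarrow> braids f g"
  by (induction rule: rtranclp_induct) (auto intro: rtranclp.rtrancl_into_rtrancl sub_braid_step)

lemma braid_step_sub:
  assumes "braid_step S M f g" "set f \<subseteq> J"
  shows "braid_step J M f g"
  using assms
proof (induction rule: braid_step.induct)
  case (1 s t u v)
  then have "finite_pair J M s t"
    using finite_pairD(5)[of s t] set_alt_word[of "the_enat (M s t)" s t] by (auto simp: finite_pair_def)
  then show ?case by (rule braid_step.intros)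
qed

lemma braid_sub:
  assumes "braids f g" "set f \<subseteq> J"
  shows "(braid_step J M)\<^sup>*\<^sup>* f g"
  using assms
proof (induction rule: rtranclp_induct)
  case (step y z)
  then have "braid_step J M y z" using braid_step_sub braid_set by blast
  with step show ?case by auto
qed simp

lemma sub_word_eq:
  assumes "J \<subseteq> S" "equivclp (rel_step J M) f g"
  shows "f \<simeq> g"
  using assms(2)
proof (induction rule: equivclp_induct)
  case (step y z)
  have "rel_step S M a b" if "rel_step J M a b" for a b
    using that assms(1) by (induction rule: rel_step.induct) (auto intro!: rel_step.intros)
  with step show ?case by (meson equivclp_into_equivclp)
qed simp

text \<open>Reducedness is decided by braid moves and squares, and braid moves introduce no new
  letters, so for a word over \<open>J\<close> the decision is the same over \<open>J\<close> and
  over \<open>S\<close>.\<close>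

lemma sub_reduced_iff:
  assumes "J \<subseteq> S"
  shows "reduced J M f \<longleftrightarrow> set f \<subseteq> J \<and> red f"
proof -
  interpret J: coxeter_matrix J M by (rule sub_coxeter_matrix[OF assms])
  show ?thesis
  proof (intro iffI conjI)
    assume r: "reduced J M f"
    then show f: "set f \<subseteq> J" by (rule J.reduced_subset)
    show "red f"
    proof (rule ccontr)
      assume "\<not> red f"
      then obtain u s v where "braids f (u @ [s, s] @ v)"
        using not_reduced_braid_square f assms by blast
      then have "(braid_step J M)\<^sup>*\<^sup>* f (u @ [s, s] @ v)" using braid_sub f by blast
      then show False using J.braid_reduced[OF _ r] J.not_reduced_square by blast
    qed
  next
    assume r: "set f \<subseteq> J \<and> red f"
    show "reduced J M f"
    proof (rule ccontr)
      assume "\<not> reduced J M f"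
      then obtain u s v where "(braid_step J M)\<^sup>*\<^sup>* f (u @ [s, s] @ v)"
        using J.not_reduced_braid_square r by blast
      then show False using braid_reduced[OF sub_braid[OF _ assms]] not_reduced_square r by blast
    qed
  qed
qed

text \<open>Braid moves that join two reduced words of one element stay over \<open>J\<close> when
  they start there. This is the embedding of the parabolic subgroup.\<close>

lemma sub_word_eq_if_reduced:
  assumes "J \<subseteq> S" "reduced J M f" "reduced J M g" "f \<simeq> g"
  shows "equivclp (rel_step J M) f g"
proof -
  interpret J: coxeter_matrix J M by (rule sub_coxeter_matrix[OF assms(1)])
  have "braids f g" using matsumoto_tits assms sub_reduced_iff by blast
  then show ?thesis using J.braid_word_eq[OF braid_sub] J.reduced_subset[OF assms(2)] by blast
qed

text \<open>\<open>g\<close> is a shortest word in the coset of \<open>w\<close> modulo the subgroup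
  of \<open>I\<close>. If a reduced word over \<open>I\<close> lost length when appended to it, the
  exchange condition would delete a letter of \<open>g\<close> and produce a shorter word in the
  same coset.\<close>

lemma parabolic_decomposition:
  assumes "set w \<subseteq> S" and I: "I \<subseteq> S"
  obtains g h where "w \<simeq> g @ h" "set h \<subseteq> I" "red h"
    "\<And>k. red k \<Longrightarrow> set k \<subseteq> I \<Longrightarrow> red (g @ k)"
proof -
  interpret I: coxeter_matrix I M by (rule sub_coxeter_matrix[OF I])
  define P where "P g \<longleftrightarrow> set g \<subseteq> S \<and> (\<exists>h. set h \<subseteq> I \<and> w \<simeq> g @ h)" for g
  have "P w" using assms by (auto simp: P_def intro: exI[of _ "[]"])
  then obtain g where g: "P g" "\<And>g'. P g' \<Longrightarrow> length g \<le> length g'"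
    using ex_has_least_nat[of P w length] by blast
  then obtain h0 where h0: "set h0 \<subseteq> I" "w \<simeq> g @ h0" unfolding P_def by blast
  have gS: "set g \<subseteq> S" using g P_def by blast
  obtain h where "reduced I M h" "equivclp (rel_step I M) h h0"
    using I.ex_reduced[OF h0(1)] by blast
  then have h: "red h" "set h \<subseteq> I" "h \<simeq> h0" using sub_reduced_iff[OF I] sub_word_eq[OF I] by blast+
  have "g @ h0 \<simeq> g @ h" using word_eq_append[OF _ h(3), of g g] word_eq_sym by simp
  with h0 have wgh: "w \<simeq> g @ h" by (blast intro: word_eq_trans)
  have "red g"
  proof (rule ccontr)
    assume "\<not> red g"
    then obtain g' where "set g' \<subseteq> S" "g' \<simeq> g" "length g' < length g"
      using gS unfolding reduced_iff by (auto simp: not_le)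
    moreover have "w \<simeq> g' @ h" using wgh word_eq_append[of g g' h h] \<open>g' \<simeq> g\<close>
      by (meson equivclp_refl word_eq_sym word_eq_trans)
    ultimately show False using g(2)[of g'] h P_def by fastforce
  qed
  have "red (g @ k)" if "red k" "set k \<subseteq> I" for k
    using that
  proof (induction k rule: rev_induct)
    case (snoc s k)
    then have IH: "red (g @ k)" using reduced_prefix by auto
    have sS: "s \<in> S" "s \<in> I" "set k \<subseteq> I" "set k \<subseteq> S" using snoc I by auto
    show ?case
    proof (rule ccontr)
      assume "\<not> red (g @ k @ [s])"
      then obtain a y b where ayb: "g = a @ [y] @ b" "g @ k @ [s] \<simeq> a @ b @ k"
        by (rule exchange_left_part[OF IH sS(1) snoc.prems(1)])
      \<comment> \<open>Inserting the trivial word \<open>(k @ [s]) @ rev (k @ [s])\<close> behind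
        \<open>g\<close> exhibits \<open>a @ b\<close> as a representative of the coset of
        \<open>w\<close>.\<close>
      have "g @ (k @ [s]) @ rev (k @ [s]) @ h \<simeq> g @ h"
        using word_eq_delete[OF word_eq_rev_right[of "k @ [s]"], of g h] sS by simp
      moreover have "(g @ k @ [s]) @ rev (k @ [s]) @ h \<simeq> (a @ b @ k) @ rev (k @ [s]) @ h"
        by (rule word_eq_append[OF ayb(2)]) simp
      ultimately have "g @ h \<simeq> (a @ b) @ k @ rev (k @ [s]) @ h"
        by simp (meson word_eq_sym word_eq_trans)
      with wgh have "w \<simeq> (a @ b) @ k @ rev (k @ [s]) @ h" by (blast intro: word_eq_trans)
      moreover have "set (k @ rev (k @ [s]) @ h) \<subseteq> I" using sS h by auto
      moreover have "set (a @ b) \<subseteq> S" using gS ayb(1) by auto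
      ultimately have "P (a @ b)" unfolding P_def by blast
      from g(2)[OF this] show False using ayb(1) by simp
    qed
  qed (use \<open>red g\<close> in simp)
  with that wgh h show ?thesis by blast
qed

text \<open>A nonempty factor over \<open>I\<close> split off from \<open>g\<close> would have its
  last letter as a descent of \<open>g\<close>; so \<open>g\<close> is itself shortest in its
  coset.\<close>

lemma reduced_append_if_no_descents:
  assumes g: "red g" and I: "I \<subseteq> S" "\<And>s. s \<in> I \<Longrightarrow> red (g @ [s])" and h: "red h" "set h \<subseteq> I"
  shows "red (g @ h)"
proof -
  obtain g' u where d: "g \<simeq> g' @ u" "set u \<subseteq> I" "red u" "\<And>k. red k \<Longrightarrow> set k \<subseteq> I \<Longrightarrow> red (g' @ k)"
    using parabolic_decomposition[OF reduced_subset[OF g] I(1)] by blast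
  have "u = []"
  proof (rule ccontr)
    assume "u \<noteq> []"
    then obtain v s where u: "u = v @ [s]" by (metis rev_exhaust)
    then have "\<not> red (g @ [s])" using descent_if_word_eq_snoc[OF g, of "g' @ v"] d by simp
    then show False using I u d by simp
  qed
  then have gg: "g' \<simeq> g" "red g'" using d(1) d(4)[of "[]"] word_eq_sym by auto
  then have "g' @ h \<simeq> g @ h" by (intro word_eq_append) auto
  then show ?thesis
    using reduced_if_word_eq[OF d(4)[OF h]] reduced_length_eq[OF gg(2) g gg(1)] reduced_subset[OF g] h I by auto
qed

end

subsection \<open>Longest words of rank 3\<close>

lemma foldl_sink: "(\<And>a. \<delta> z a = z) \<Longrightarrow> foldl \<delta> z w = z"
  by (induction w) auto

lemma alt_word_numeral [simp]: "alt_word (numeral n) s t = s # alt_word (pred_numeral n) t s"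
  by (simp add: numeral_eq_Suc)

text \<open>Transition function with sink 6 that lets pass the words read cyclically along
  \<open>r s t r s t ...\<close>, the pattern for the affine type with all three entries equal to
  3.\<close>

definition A2_step :: "'s \<Rightarrow> 's \<Rightarrow> 's \<Rightarrow> nat \<Rightarrow> 's \<Rightarrow> nat" where
  "A2_step r s t q a =
    (if q = 0 \<and> a = r then 1 else if q = 1 \<and> a = s then 2 else if q = 2 \<and> a = t then 0 else 6)"

text \<open>The analogue for the cyclic pattern \<open>r s t s\<close>, which belongs to the affine
  type with entries 4, 4, 2.\<close>

definition C2_step :: "'s \<Rightarrow> 's \<Rightarrow> 's \<Rightarrow> nat \<Rightarrow> 's \<Rightarrow> nat" where
  "C2_step r s t q a =
    (if q = 0 \<and> a = r then 1 else if q = 1 \<and> a = s then 2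
     else if q = 2 \<and> a = t then 3 else if q = 3 \<and> a = s then 0 else 6)"

text \<open>Accepts the words read along \<open>r t s t s r t s t s \<dots>\<close> in which every \<open>r t\<close> may be replaced by \<open>t r\<close>.\<close>

definition G2_step :: "'s \<Rightarrow> 's \<Rightarrow> 's \<Rightarrow> nat \<Rightarrow> 's \<Rightarrow> nat" where
  "G2_step r s t q a =
    (if q = 0 \<and> a = r then 1 else if q = 0 \<and> a = t then 2 else if q = 1 \<and> a = t then 3
     else if q = 2 \<and> a = r then 3 else if q = 3 \<and> a = s then 4 else if q = 4 \<and> a = t then 5
     else if q = 5 \<and> a = s then 0 else 6)"

lemma state_cases:
  fixes q :: nat
  shows "q = 0 \<or> q = 1 \<or> q = 2 \<or> q = 3 \<or> q = 4 \<or> q = 5 \<or> q > 5"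
  by arith

lemma G2_table:
  assumes "distinct [r, s, t]"
  shows "G2_step r s t 0 r = 1" "G2_step r s t 0 s = 6" "G2_step r s t 0 t = 2"
   "G2_step r s t (Suc 0) r = 6" "G2_step r s t (Suc 0) s = 6" "G2_step r s t (Suc 0) t = 3"
   "G2_step r s t 2 r = 3" "G2_step r s t 2 s = 6" "G2_step r s t 2 t = 6"
   "G2_step r s t 3 r = 6" "G2_step r s t 3 s = 4" "G2_step r s t 3 t = 6"
   "G2_step r s t 4 r = 6" "G2_step r s t 4 s = 6" "G2_step r s t 4 t = 5"
   "G2_step r s t 5 r = 6" "G2_step r s t 5 s = 0" "G2_step r s t 5 t = 6"
   "q > 5 \<Longrightarrow> G2_step r s t q x = 6"
  using assms by (auto simp: G2_step_def)

lemma foldl_alt_word_sink: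
  assumes "\<And>a. \<delta> z a = z" "foldl \<delta> q (alt_word n a b) = z" "n \<le> m"
  shows "foldl \<delta> q (alt_word m a b) = z"
  using alt_word_add[of n "m - n" a b] assms by (simp add: foldl_sink)

context coxeter_matrix
begin

text \<open>A word that is not reduced can be braided to one with a square. The automaton does not
  see braid moves and rejects squares.\<close>

lemma reduced_if_accepted:
  assumes sink: "\<And>a. \<delta> z a = z" and square: "\<And>q a. a \<in> S \<Longrightarrow> foldl \<delta> q [a, a] = z"
    and braid: "\<And>q a b. finite_pair S M a b \<Longrightarrow> 
      foldl \<delta> q (max_word a b) = foldl \<delta> q (opp_word a b)"
    and w: "set w \<subseteq> S" "foldl \<delta> q w \<noteq> z"
  shows "red w"
proof (rule ccontr)
  assume "\<not> red w"
  then obtain u s v where usv: "braids w (u @ [s, s] @ v)"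
    using not_reduced_braid_square w(1) by blast
  have "foldl \<delta> q f = foldl \<delta> q g" if "braid_step S M f g" for f g
    using that by (induction rule: braid_step.induct) (simp add: braid del: alt_word.simps, metis braid)
  with usv have "foldl \<delta> q w = foldl \<delta> q (u @ [s, s] @ v)"
    by (induction rule: rtranclp_induct) metis+
  also have "\<dots> = z"
    using square[of s "foldl \<delta> q u"] braid_set[OF usv] w(1) foldl_sink[of \<delta> z v, OF sink] by auto
  finally show False using w(2) by simp
qed

text \<open>Going round the cycle \<open>p\<close> often enough gives a reduced word over
  \<open>J\<close> longer than \<open>w\<close>, which \<open>descents_suffix\<close> forbids if all
  letters of \<open>J\<close> are descents of \<open>w\<close>.\<close>

lemma no_longest_if_accepting_cycle:
  assumes sink: "\<And>a. \<delta> z a = z" and square: "\<And>q a. foldl \<delta> q [a, a] = z"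
    and braid: "\<And>q a b. finite_pair S M a b \<Longrightarrow>
      foldl \<delta> q (max_word a b) = foldl \<delta> q (opp_word a b)"
    and p: "foldl \<delta> q p = q" "q \<noteq> z" "set p \<subseteq> J" "p \<noteq> []"
    and w: "J \<subseteq> S" "red w" "\<And>s. s \<in> J \<Longrightarrow> \<not> red (w @ [s])"
  shows False
proof -
  have acc: "foldl \<delta> q (concat (replicate k p)) = q" for k by (induction k) (use p(1) in auto)
  let ?u = "concat (replicate (Suc (length w)) p)"
  have u: "set ?u \<subseteq> J" using p(3) by auto
  have "red ?u"
    by (rule reduced_if_accepted[OF sink square braid, where q = q]) (use u w(1) p(2) acc[of "Suc (length w)"] in auto)
  then obtain x where x: "red (x @ ?u)" "x @ ?u \<simeq> w"
    using descents_suffix[OF w(2,1,3) _ u] by blast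
  have "length (concat (replicate k p)) = k * length p" for k by (induction k) auto
  then have "length w < length ?u" using p(4) by (cases p) (auto simp: less_Suc_eq_le)
  then show False using reduced_length_eq[OF x(1) w(2) x(2)] by simp
qed

text \<open>Along \<open>r s t r s t ...\<close> no three consecutive letters alternate, so no braid
  move applies when all entries are at least 3.\<close>

lemma no_longest_large:
  assumes J: "r \<in> S" "s \<in> S" "t \<in> S" "distinct [r, s, t]"
    and M: "3 \<le> M r s" "3 \<le> M s t" "3 \<le> M r t"
    and w: "red w" "\<And>a. a \<in> {r, s, t} \<Longrightarrow> \<not> red (w @ [a])"
  shows False
proof -
  let ?p = "[r, s, t]" and ?d = "A2_step r s t"
  have sink: "?d 6 a = 6" for a by (simp add: A2_step_def)
  have square: "foldl ?d q [a, a] = 6" for q a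
    using state_cases[of q] J(4) by (elim disjE) (auto simp: A2_step_def)
  have braid: "foldl ?d q (max_word a b) = 6" if "finite_pair S M a b" for q a b
  proof -
    note D = finite_pairD[OF that]
    consider "a \<in> {r, s, t}" "b \<in> {r, s, t}" | "a \<notin> {r, s, t} \<or> b \<notin> {r, s, t}" by blast
    then obtain n where "n \<le> the_enat (M a b)" "foldl ?d q (alt_word n a b) = 6"
    proof cases
      case 1
      then have "3 \<le> M a b" using M D(3) sym J by auto
      then have "3 \<le> the_enat (M a b)" using D(4) by (metis enat_ord_simps(1) numeral_eq_enat)
      moreover have "foldl ?d q (alt_word 3 a b) = 6"
        using state_cases[of q] 1 J(4) D(3)
          by (elim disjE) (auto simp: A2_step_def)
      ultimately show ?thesis using that by blast
    next
      case 2
      moreover have "foldl ?d q (alt_word 2 a b) = 6"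
        using state_cases[of q] 2 J(4)
          by (elim disjE) (auto simp: A2_step_def)
      ultimately show ?thesis using that D(5) by blast
    qed
    with foldl_alt_word_sink[of ?d 6, OF sink] show ?thesis by blast
  qed
  have braid': "foldl ?d q (max_word a b) = foldl ?d q (opp_word a b)"
    if "finite_pair S M a b" for q a b
    using braid[OF that, of q] braid[of b a q] finite_pair_sym[OF that] by simp
  have "foldl ?d 0 ?p = 0" using J(4) by (simp add: A2_step_def)
  then show False
    by (rule no_longest_if_accepting_cycle[of ?d 6 0 ?p "{r, s, t}" w, rotated 3])
      (use J w sink square braid' in auto)
qed

text \<open>Along \<open>r s t s r s t s ...\<close> alternating stretches in \<open>r\<close>,
  \<open>s\<close> and in \<open>s\<close>, \<open>t\<close> have length at most 3, and
  \<open>r\<close> and \<open>t\<close> are never adjacent; so no braid move applies.\<close>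

lemma no_longest_C2_affine:
  assumes J: "r \<in> S" "s \<in> S" "t \<in> S" "distinct [r, s, t]"
    and M: "4 \<le> M r s" "4 \<le> M s t"
    and w: "red w" "\<And>a. a \<in> {r, s, t} \<Longrightarrow> \<not> red (w @ [a])"
  shows False
proof -
  let ?p = "[r, s, t, s]" and ?d = "C2_step r s t"
  have sink: "?d 6 a = 6" for a by (simp add: C2_step_def)
  have square: "foldl ?d q [a, a] = 6" for q a
    using state_cases[of q] J(4) by (elim disjE) (auto simp: C2_step_def)
  have braid: "foldl ?d q (max_word a b) = 6" if "finite_pair S M a b" for q a b
  proof -
    note D = finite_pairD[OF that]
    consider "{a, b} = {r, s} \<or> {a, b} = {s, t}" | "{a, b} = {r, t}" | "a \<notin> {r, s, t} \<or> b \<notin> {r, s, t}"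
      using D(3) by blast
    then obtain n where "n \<le> the_enat (M a b)" "foldl ?d q (alt_word n a b) = 6"
    proof cases
      case 1
      then have "4 \<le> M a b" using M D(3) sym J by (auto simp: doubleton_eq_iff)
      then have "4 \<le> the_enat (M a b)" using D(4) by (metis enat_ord_simps(1) numeral_eq_enat)
      moreover have "foldl ?d q (alt_word 4 a b) = 6"
        using state_cases[of q] 1 J(4) D(3)
          by (elim disjE) (auto simp: C2_step_def doubleton_eq_iff)
      ultimately show ?thesis using that by blast
    next
      case 2
      moreover have "foldl ?d q (alt_word 2 a b) = 6"
        using state_cases[of q] 2 J(4)
          by (elim disjE) (auto simp: C2_step_def doubleton_eq_iff)
      ultimately show ?thesis using that D(5) by blast
    next
      case 3
      moreover have "foldl ?d q (alt_word 2 a b) = 6"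
        using state_cases[of q] 3 J(4)
          by (elim disjE) (auto simp: C2_step_def)
      ultimately show ?thesis using that D(5) by blast
    qed
    with foldl_alt_word_sink[of ?d 6, OF sink] show ?thesis by blast
  qed
  have braid': "foldl ?d q (max_word a b) = foldl ?d q (opp_word a b)"
    if "finite_pair S M a b" for q a b
    using braid[OF that, of q] braid[of b a q] finite_pair_sym[OF that] by simp
  have "foldl ?d 0 ?p = 0" using J(4) by (simp add: C2_step_def)
  then show False
    by (rule no_longest_if_accepting_cycle[of ?d 6 0 ?p "{r, s, t}" w, rotated 3])
      (use J w sink square braid' in auto)
qed

text \<open>The commutation of \<open>r\<close> and \<open>t\<close> does apply along
  \<open>r t s t s r t s t s ...\<close>, but even then alternating stretches in \<open>s\<close>,
  \<open>t\<close> have length at most 5 and those in \<open>r\<close>, \<open>s\<close> length at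
  most 2. The words of the other braid moves therefore lead to the sink from every state.\<close>

lemma no_longest_G2_affine:
  assumes J: "r \<in> S" "s \<in> S" "t \<in> S" "distinct [r, s, t]"
    and M: "M r t = 2" "3 \<le> M r s" "6 \<le> M s t"
    and w: "red w" "\<And>a. a \<in> {r, s, t} \<Longrightarrow> \<not> red (w @ [a])"
  shows False
proof -
  let ?p = "[r, t, s, t, s]" and ?d = "G2_step r s t"
  have sink: "?d 6 a = 6" for a by (simp add: G2_step_def)
  have square: "foldl ?d q [a, a] = 6" for q a
    using state_cases[of q] J(4) by (elim disjE) (auto simp: G2_step_def)
  have braid: "foldl ?d q (max_word a b) = foldl ?d q (opp_word a b)"
    if "finite_pair S M a b" for q a b
  proof -
    note D = finite_pairD[OF that]
    have s: "foldl ?d q (max_word a b) = 6 \<and> foldl ?d q (opp_word a b) = 6"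
      if "n \<le> the_enat (M a b)" "foldl ?d q (alt_word n a b) = 6" "foldl ?d q (alt_word n b a) = 6" for n
      using foldl_alt_word_sink[of ?d 6, OF sink] that by blast
    consider "{a, b} = {r, s}" | "{a, b} = {s, t}" | "{a, b} = {r, t}" | "a \<notin> {r, s, t} \<or> b \<notin> {r, s, t}"
      using D(3) by blast
    then show ?thesis
    proof cases
      case 1
      then have "3 \<le> M a b" using M D(3) sym J by (auto simp: doubleton_eq_iff)
      then have "3 \<le> the_enat (M a b)" using D(4) by (metis enat_ord_simps(1) numeral_eq_enat)
      moreover have "foldl ?d q (alt_word 3 a b) = 6 \<and> foldl ?d q (alt_word 3 b a) = 6"
        using state_cases[of q] 1 unfolding doubleton_eq_iff
        by (elim disjE conjE) (simp_all add: G2_table[OF J(4)])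
      ultimately show ?thesis using s by metis
    next
      case 2
      then have "6 \<le> M a b" using M D(3) sym J by (auto simp: doubleton_eq_iff)
      then have "6 \<le> the_enat (M a b)" using D(4) by (metis enat_ord_simps(1) numeral_eq_enat)
      moreover have "foldl ?d q (alt_word 6 a b) = 6 \<and> foldl ?d q (alt_word 6 b a) = 6"
        using state_cases[of q] 2 unfolding doubleton_eq_iff
        by (elim disjE conjE) (simp_all add: G2_table[OF J(4)])
      ultimately show ?thesis using s by metis
    next
      case 3
      then have "M a b = 2" using M(1) sym J by (auto simp: doubleton_eq_iff)
      then have "the_enat (M a b) = 2" by (metis numeral_eq_enat the_enat.simps)
      moreover have "foldl ?d q (alt_word 2 a b) = foldl ?d q (alt_word 2 b a)"
        using state_cases[of q] 3 unfolding doubleton_eq_iff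
        by (elim disjE conjE) (simp_all add: G2_table[OF J(4)])
      ultimately show ?thesis by simp
    next
      case 4
      moreover have "foldl ?d q (alt_word 2 a b) = 6 \<and> foldl ?d q (alt_word 2 b a) = 6"
        using state_cases[of q] 4 J(4)
          by (elim disjE) (auto simp: G2_step_def)
      ultimately show ?thesis using s[OF D(5)] by metis
    qed
  qed
  have "foldl ?d 0 ?p = 0" using J(4) by (simp add: G2_table[OF J(4), simplified])
  then show False
    by (rule no_longest_if_accepting_cycle[of ?d 6 0 ?p "{r, s, t}" w, rotated 3])
      (use J w sink square braid in auto)
qed

text \<open>Two of the letters commute by \<open>no_longest_large\<close>. With these named
  \<open>a\<close>, \<open>c\<close> and the other entries ordered as
  \<open>M a b \<le> M b c\<close>, the affine patterns exclude \<open>4 \<le> M a b\<close> as well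
  as \<open>M a b = 3\<close> with \<open>6 \<le> M b c\<close>. What remains is the list A1 x
  I2(m), A3, C3, H3, where finiteness of m is established only at the point of use.\<close>

lemma longest_word_rank_3:
  assumes J: "r \<in> S" "s \<in> S" "t \<in> S" "distinct [r, s, t]"
    and w: "red w" "\<And>a. a \<in> {r, s, t} \<Longrightarrow> \<not> red (w @ [a])"
  obtains a b c where "{a, b, c} = {r, s, t}" "distinct [a, b, c]" "M a c = 2"
    "M a b = 2 \<or> M a b = 3 \<and> M b c \<in> {3, 4, 5}"
proof -
  note result = that
  have ge3: "3 \<le> M a b" if "a \<in> S" "b \<in> S" "a \<noteq> b" "M a b \<noteq> 2" for a b
  proof (cases "M a b")
    case (enat n)
    with off_diag[of a b] that show ?thesis by (simp add: numeral_eq_enat)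
  qed simp
  have ge4: "4 \<le> M a b" if "3 \<le> M a b" "M a b \<noteq> 3" for a b
    using that by (cases "M a b") (simp_all add: numeral_eq_enat)
  have ge6: "6 \<le> M a b" if "4 \<le> M a b" "M a b \<noteq> 4" "M a b \<noteq> 5" for a b
    using that by (cases "M a b") (simp_all add: numeral_eq_enat)
  have *: thesis
    if abc: "{a, b, c} = {r, s, t}" "distinct [a, b, c]" "M a c = 2" "M a b \<le> M b c" for a b c
  proof -
    have S: "a \<in> S" "b \<in> S" "c \<in> S" using J abc(1) by auto
    have w': "\<And>x. x \<in> {a, b, c} \<Longrightarrow> \<not> red (w @ [x])" using w(2) abc(1) by simp
    have "M a b = 2 \<or> M a b = 3 \<and> M b c \<in> {3, 4, 5}"
    proof (rule ccontr)
      assume "\<not> (M a b = 2 \<or> M a b = 3 \<and> M b c \<in> {3, 4, 5})"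
      then have n: "M a b \<noteq> 2" "M a b = 3 \<Longrightarrow> M b c \<notin> {3, 4, 5}" by auto
      then have 1: "3 \<le> M a b" using ge3 S abc by auto
      show False
      proof (cases "M a b = 3")
        case True
        then have "6 \<le> M b c" using ge4 ge6 n abc(4) by auto
        then show False using no_longest_G2_affine[OF S abc(2,3) 1 _ w(1) w'] by blast
      next
        case False
        then have "4 \<le> M a b" using ge4 1 by blast
        then show False using no_longest_C2_affine[OF S abc(2) _ _ w(1) w'] abc(4) by (meson order_trans)
      qed
    qed
    with result abc(1-3) show thesis by blast
  qed
  have **: thesis if abc: "{a, b, c} = {r, s, t}" "distinct [a, b, c]" "M a c = 2" for a b c
  proof (cases "M a b \<le> M b c")
    case True
    then show ?thesis using * abc by blast
  next
    case False
    have S: "a \<in> S" "b \<in> S" "c \<in> S" using J abc(1) by auto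
    have "M c b \<le> M b a" "M c a = 2" "{c, b, a} = {r, s, t}" "distinct [c, b, a]"
      using False abc S sym by auto
    then show ?thesis using * by blast
  qed
  show thesis
  proof (cases "M r s = 2 \<or> M s t = 2 \<or> M r t = 2")
    case True
    then consider "M r s = 2" | "M s t = 2" | "M r t = 2" by blast
    then show ?thesis
    proof cases
      case 1 then show ?thesis using **[of r t s] J by auto
    next
      case 2 then show ?thesis using **[of s r t] J by auto
    next
      case 3 then show ?thesis using **[of r s t] J by auto
    qed
  next
    case False
    then show ?thesis using no_longest_large[OF J _ _ _ w] ge3 J by auto
  qed
qed

text \<open>Up to equality in the group each word is a suffix of the other, and comparing lengths
  leaves nothing in front.\<close>

lemma longest_word_unique:
  assumes J: "J \<subseteq> S"
    and f: "red f" "set f \<subseteq> J" "\<And>s. s \<in> J \<Longrightarrow> \<not> red (f @ [s])"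
    and g: "red g" "set g \<subseteq> J" "\<And>s. s \<in> J \<Longrightarrow> \<not> red (g @ [s])"
  shows "f \<simeq> g"
proof -
  obtain x where x: "red (x @ f)" "x @ f \<simeq> g" using descents_suffix[OF g(1) J g(3) f(1,2)] by blast
  obtain y where y: "red (y @ g)" "y @ g \<simeq> f" using descents_suffix[OF f(1) J f(3) g(1,2)] by blast
  have "length (x @ f) = length g" "length (y @ g) = length f"
    using reduced_length_eq x y f(1) g(1) by blast+
  then have "length x = 0" unfolding length_append by linarith
  then have "x = []" by simp
  with x show ?thesis by simp
qed

end

subsection \<open>Homotopy of galleries\<close>

context groupoid
begin

lemma inv_unique:
  assumes "e \<in> edges G" "f \<in> edges G" "tgt G e = src G f" "gcomp G e f = gid G (src G e)"
  shows "f = ginv G e"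
proof -
  have "f = gcomp G (gcomp G (ginv G e) e) f"
    using assms id_left[of f] inv_left[of e] by simp
  also have "\<dots> = gcomp G (ginv G e) (gcomp G e f)"
    using assms by (intro assoc) (auto simp: inv_in tgt_inv)
  also have "\<dots> = ginv G e"
    using assms id_right[of "ginv G e"] by (simp add: inv_in tgt_inv)
  finally show ?thesis .
qed

lemma inv_inv: "e \<in> edges G \<Longrightarrow> ginv G (ginv G e) = e"
  using inv_unique[of "ginv G e" e] by (simp add: inv_in tgt_inv src_inv inv_left)

lemma inv_id: "v \<in> verts G \<Longrightarrow> ginv G (gid G v) = gid G v"
  using inv_unique[of "gid G v" "gid G v"] id_left[of "gid G v"] by (simp add: id_in src_id tgt_id)

end

definition edge_inv :: "('c, 'e, 's) weyl_data \<Rightarrow> 's \<times> 'e \<Rightarrow> 's \<times> 'e" where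
  "edge_inv W x = (fst x, ginv (panels W (fst x)) (snd x))"

definition edge_comp :: "('c, 'e, 's) weyl_data \<Rightarrow> 's \<times> 'e \<Rightarrow> 's \<times> 'e \<Rightarrow> 's \<times> 'e" where
  "edge_comp W x y = (fst x, gcomp (panels W (fst x)) (snd x) (snd y))"

definition path_inv :: "('c, 'e, 's) weyl_data \<Rightarrow> ('s \<times> 'e) list \<Rightarrow> ('s \<times> 'e) list" where
  "path_inv W xs = rev (map (edge_inv W) xs)"

abbreviation ty :: "('s \<times> 'e) list \<Rightarrow> 's list" where
  "ty xs \<equiv> map fst xs"

lemma fst_edge_inv [simp]: "fst (edge_inv W x) = fst x"
  by (simp add: edge_inv_def)

lemma fst_edge_comp [simp]: "fst (edge_comp W x y) = fst x"
  by (simp add: edge_comp_def)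

lemma ty_path_inv [simp]: "ty (path_inv W xs) = rev (ty xs)"
  by (simp add: path_inv_def rev_map comp_def)

lemma path_inv_append [simp]: "path_inv W (xs @ ys) = path_inv W ys @ path_inv W xs"
  by (simp add: path_inv_def)

lemma path_inv_Cons [simp]: "path_inv W (x # xs) = path_inv W xs @ [edge_inv W x]"
  by (simp add: path_inv_def)

lemma path_inv_Nil [simp]: "path_inv W [] = []"
  by (simp add: path_inv_def)

lemma terminal_Nil [simp]: "terminal W (c, []) = c"
  by (simp add: terminal_def)

lemma terminal_Cons [simp]: "terminal W (c, x # xs) = terminal W (edge_tgt W x, xs)"
  by (simp add: terminal_def)

lemma terminal_append [simp]: "terminal W (c, xs @ ys) = terminal W (terminal W (c, xs), ys)"
  by (induction xs arbitrary: c) simp_all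

lemma map_eq_appendE3:
  assumes "map f xs = u @ w @ v"
  obtains us ws vs where "xs = us @ ws @ vs" "map f us = u" "map f ws = w" "map f vs = v"
proof -
  obtain us xs' where 1: "xs = us @ xs'" "u = map f us" "w @ v = map f xs'"
    using assms unfolding map_eq_append_conv by blast
  obtain ws vs where 2: "xs' = ws @ vs" "w = map f ws" "v = map f vs"
    using 1(3)[symmetric] unfolding map_eq_append_conv by blast
  show thesis by (rule that[of us ws vs]) (simp_all add: 1 2)
qed

context generalized_chamber_system
begin

abbreviation "path \<equiv> edge_path S W"
abbreviation "endpt c xs \<equiv> terminal W (c, xs)"

lemma cs_edge_chambers:
  assumes "cs_edge S W x"
  shows "edge_src W x \<in> chambers W" "edge_tgt W x \<in> chambers W"
  using assms groupoid.src_in[OF panel_groupoid] groupoid.tgt_in[OF panel_groupoid] verts_panel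
  by (auto simp: cs_edge_def edge_src_def edge_tgt_def)

lemma cs_edge_inv:
  assumes "cs_edge S W x"
  shows "cs_edge S W (edge_inv W x)" "edge_src W (edge_inv W x) = edge_tgt W x"
    "edge_tgt W (edge_inv W x) = edge_src W x" "edge_inv W (edge_inv W x) = x"
proof -
  have x: "fst x \<in> S" "snd x \<in> edges (panels W (fst x))"
    "snd x \<notin> gid (panels W (fst x)) ` verts (panels W (fst x))"
    using assms by (auto simp: cs_edge_def)
  interpret groupoid "panels W (fst x)" by (rule panel_groupoid[OF x(1)])
  show "edge_src W (edge_inv W x) = edge_tgt W x" "edge_tgt W (edge_inv W x) = edge_src W x"
    "edge_inv W (edge_inv W x) = x"
    using x by (simp_all add: edge_src_def edge_tgt_def edge_inv_def src_inv tgt_inv inv_inv)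
  show "cs_edge S W (edge_inv W x)"
    unfolding cs_edge_def edge_inv_def fst_conv snd_conv
    using x(1,3) inv_in[OF x(2)] inv_inv[OF x(2)] inv_id by (metis (no_types, lifting) imageE imageI)
qed

lemma cs_edge_comp:
  assumes "cs_edge S W x" "cs_edge S W y" "fst y = fst x" "edge_tgt W x = edge_src W y" "y \<noteq> edge_inv W x"
  shows "cs_edge S W (edge_comp W x y)" "edge_src W (edge_comp W x y) = edge_src W x"
    "edge_tgt W (edge_comp W x y) = edge_tgt W y"
proof -
  have x: "fst x \<in> S" "snd x \<in> edges (panels W (fst x))" "snd y \<in> edges (panels W (fst x))"
    "tgt (panels W (fst x)) (snd x) = src (panels W (fst x)) (snd y)"
    "snd y \<noteq> ginv (panels W (fst x)) (snd x)"
    using assms by (auto simp: cs_edge_def edge_src_def edge_tgt_def edge_inv_def prod_eq_iff)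
  interpret groupoid "panels W (fst x)" by (rule panel_groupoid[OF x(1)])
  have "gcomp (panels W (fst x)) (snd x) (snd y) \<noteq> gid (panels W (fst x)) v"
    if "v \<in> verts (panels W (fst x))" for v
    using inv_unique[OF x(2-4)] x(5) src_comp[OF x(2-4)] src_id[OF that] by metis
  then show "cs_edge S W (edge_comp W x y)"
    using x comp_in[OF x(2-4)] by (auto simp: cs_edge_def edge_comp_def)
  show "edge_src W (edge_comp W x y) = edge_src W x" "edge_tgt W (edge_comp W x y) = edge_tgt W y"
    using assms(3) src_comp[OF x(2-4)] tgt_comp[OF x(2-4)]
    by (simp_all add: edge_src_def edge_tgt_def edge_comp_def)
qed

lemma path_chambers: "path c xs \<Longrightarrow> c \<in> chambers W"
  by (cases xs) auto

lemma path_append: "path c (xs @ ys) \<longleftrightarrow> path c xs \<and> path (endpt c xs) ys"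
  by (induction xs arbitrary: c) (auto dest: path_chambers cs_edge_chambers)

lemma path_endpt: "path c xs \<Longrightarrow> endpt c xs \<in> chambers W"
  using path_append[of c xs "[]"] by simp

lemma path_single: "path c [x] \<longleftrightarrow> cs_edge S W x \<and> edge_src W x = c"
  using cs_edge_chambers[of x] by auto

lemma path_ty: "path c xs \<Longrightarrow> set (ty xs) \<subseteq> S"
  by (induction xs arbitrary: c) (auto simp: cs_edge_def)

lemma path_path_inv: "path c xs \<Longrightarrow> path (endpt c xs) (path_inv W xs) \<and> endpt (endpt c xs) (path_inv W xs) = c"
proof (induction xs arbitrary: c)
  case (Cons x xs)
  then have *: "path (endpt (edge_tgt W x) xs) (path_inv W xs)"
    "endpt (endpt (edge_tgt W x) xs) (path_inv W xs) = edge_tgt W x"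
    and x: "cs_edge S W x" "edge_src W x = c" by auto
  with cs_edge_inv[OF x(1)] show ?case by (auto simp: path_append cs_edge_chambers)
qed simp

lemma path_inv_path_inv: "path c xs \<Longrightarrow> path_inv W (path_inv W xs) = xs"
  by (induction xs arbitrary: c) (auto simp: cs_edge_inv)

end

context weyl_data
begin

abbreviation "hom c xs ys \<equiv> homotopic S M W (c, xs) (c, ys)"

lemma hom_refl [simp]: "hom c xs xs"
  by (simp add: homotopic_def)

lemma hom_trans [trans]: "hom c xs ys \<Longrightarrow> hom c ys zs \<Longrightarrow> hom c xs zs"
  unfolding homotopic_def by (rule equivclp_trans)

lemma hom_sym: "hom c xs ys \<Longrightarrow> hom c ys xs"
  unfolding homotopic_def by (rule equivclp_sym)

lemma elementary_homotopy_path: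
  assumes "elementary_homotopy S M W a b"
  shows "fst b = fst a \<and> path (fst a) (snd a) \<and> path (fst b) (snd b) \<and> terminal W a = terminal W b"
  using assms
proof (induction rule: elementary_homotopy.induct)
  case (cancel c xs s e ys)
  define x where "x = (s, e)"
  have "path c (xs @ [x, edge_inv W x] @ ys)" using cancel by (simp add: gallery_def x_def edge_inv_def)
  moreover from this have "edge_tgt W (edge_inv W x) = endpt c xs" by (auto simp: path_append cs_edge_inv)
  moreover have "(s, ginv (panels W s) e) = edge_inv W x" by (simp add: x_def edge_inv_def)
  ultimately show ?case by (auto simp: path_append simp flip: x_def)
next
  case (compose c xs s e f ys)
  define x y where "x = (s, e)" and "y = (s, f)"
  have xy: "(s, gcomp (panels W s) e f) = edge_comp W x y" "y \<noteq> edge_inv W x" "fst y = fst x"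
    using compose by (simp_all add: x_def y_def edge_comp_def edge_inv_def)
  have "path c (xs @ [x, y] @ ys)" using compose by (simp add: gallery_def x_def y_def)
  then have "cs_edge S W x" "cs_edge S W y" "edge_tgt W x = edge_src W y" by (auto simp: path_append)
  from cs_edge_comp[OF this(1,2) xy(3) this(3) xy(2)] \<open>path c (xs @ [x, y] @ ys)\<close>
  show ?case unfolding xy(1) by (auto simp: path_append simp flip: x_def y_def)
next
  case (suite c xs zs ys s t)
  then have "st_cycle S M W s t (endpt c xs, zs)" using suites by blast
  then have "endpt (endpt c xs) zs = endpt c xs" by (simp add: st_cycle_def is_cycle_def initial_def)
  with suite show ?case by (auto simp: gallery_def path_append)
qed

lemma homotopic_path:
  assumes "homotopic S M W a b"
  shows "fst b = fst a \<and> terminal W b = terminal W a \<and> (path (fst a) (snd a) \<longleftrightarrow> path (fst b) (snd b))"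
  using assms unfolding homotopic_def
  by (induction rule: equivclp_induct) (use elementary_homotopy_path in force)+

lemma hom_endpt: "hom c xs ys \<Longrightarrow> endpt c ys = endpt c xs"
  using homotopic_path by fastforce

lemma hom_path: "hom c xs ys \<Longrightarrow> path c xs \<longleftrightarrow> path c ys"
  using homotopic_path by fastforce

lemma elementary_homotopy_context:
  assumes "elementary_homotopy S M W a b" "fst a = endpt c us" "path c us" "path (terminal W a) vs"
  shows "elementary_homotopy S M W (c, us @ snd a @ vs) (c, us @ snd b @ vs)"
  using assms
proof (induction rule: elementary_homotopy.induct)
  case (cancel d xs s e ys)
  then have "gallery S W (c, (us @ xs) @ [(s, e), (s, ginv (panels W s) e)] @ ys @ vs)"
    by (simp add: gallery_def path_append)
  from elementary_homotopy.cancel[OF this] show ?case by simp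
next
  case (compose d xs s e f ys)
  then have "gallery S W (c, (us @ xs) @ [(s, e), (s, f)] @ ys @ vs)"
    by (simp add: gallery_def path_append)
  from elementary_homotopy.compose[OF this compose(2)] show ?case by simp
next
  case (suite d xs zs ys s t)
  then have "gallery S W (c, (us @ xs) @ zs @ ys @ vs)" "(endpt c (us @ xs), zs) \<in> weyl_data.suites W s t"
    by (simp_all add: gallery_def path_append)
  from elementary_homotopy.suite[OF this(1) suite(2) this(2)] show ?case by simp
qed

lemma hom_context:
  assumes "hom (endpt c us) xs ys" "path c us" "path (endpt c (us @ xs)) vs"
  shows "hom c (us @ xs @ vs) (us @ ys @ vs)"
proof -
  have "homotopic S M W (c, us @ xs @ vs) (c, us @ snd b @ vs)"
    if "homotopic S M W (endpt c us, xs) b" for b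
    using that unfolding homotopic_def
  proof (induction rule: equivclp_induct)
    case (step y z)
    have "fst y = endpt c us" "terminal W y = endpt c (us @ xs)"
      "fst z = endpt c us" "terminal W z = endpt c (us @ xs)"
      using homotopic_path[of "(endpt c us, xs)" y] step(1,2) homotopic_path[of "(endpt c us, xs)" z]
        equivclp_into_equivclp[OF step(1,2)]
      unfolding homotopic_def by auto
    then have "equivclp (elementary_homotopy S M W) (c, us @ snd y @ vs) (c, us @ snd z @ vs)"
      using step(2) elementary_homotopy_context[of y z c us vs] elementary_homotopy_context[of z y c us vs]
        assms(2,3) by auto
    with step(3) show ?case by (rule equivclp_trans)
  qed simp
  from this[OF assms(1)] show ?thesis by simp
qed

lemma hom_left: "hom (endpt c us) xs ys \<Longrightarrow> path c us \<Longrightarrow> path (endpt c us) xs \<Longrightarrow> hom c (us @ xs) (us @ ys)"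
  using hom_context[of c us xs ys "[]"] path_endpt[of "endpt c us" xs] by simp

lemma hom_right: "hom c xs ys \<Longrightarrow> path c (xs @ vs) \<Longrightarrow> hom c (xs @ vs) (ys @ vs)"
  using hom_context[of c "[]" xs ys vs] path_chambers[of c "xs @ vs"] by (simp add: path_append)

lemma hom_cancel:
  assumes "path c [x]"
  shows "hom c [x, edge_inv W x] []"
proof -
  have "path c [x, edge_inv W x]" using assms cs_edge_inv[of x] cs_edge_chambers[of x] by auto
  then show ?thesis
    using elementary_homotopy.cancel[of S W c "[]" "fst x" "snd x" "[]" M]
    by (auto simp: gallery_def edge_inv_def homotopic_def)
qed

lemma hom_comp:
  assumes "path c [x, y]" "fst y = fst x" "y \<noteq> edge_inv W x"
  shows "hom c [x, y] [edge_comp W x y]"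
proof -
  have y: "y = (fst x, snd y)" using assms(2) by (simp add: prod_eq_iff)
  have "gallery S W (c, [] @ [(fst x, snd x), (fst x, snd y)] @ [])" using assms(1) y by (simp add: gallery_def)
  from elementary_homotopy.compose[OF this, of M] assms(3) y
  show ?thesis by (auto simp: edge_inv_def edge_comp_def homotopic_def prod_eq_iff)
qed

lemma hom_inv_right: "path c xs \<Longrightarrow> hom c (xs @ path_inv W xs) []"
proof (induction xs arbitrary: c)
  case (Cons x xs)
  then have x: "path c [x]" "path (edge_tgt W x) xs" using path_chambers by auto
  have inv: "path (edge_tgt W x) [edge_inv W x]" using x cs_edge_inv[of x] by (simp add: path_single)
  have IH: "hom (edge_tgt W x) (xs @ path_inv W xs) []" using Cons by auto
  have "hom c ([x] @ (xs @ path_inv W xs) @ [edge_inv W x]) ([x] @ [] @ [edge_inv W x])"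
    by (rule hom_context) (use x IH inv path_path_inv[OF x(2)] in simp_all)
  also have "hom c ([x] @ [] @ [edge_inv W x]) []" using hom_cancel[OF x(1)] by simp
  finally show ?case by simp
qed simp

lemma hom_inv_left: "path c xs \<Longrightarrow> hom (endpt c xs) (path_inv W xs @ xs) []"
  using hom_inv_right[of "endpt c xs" "path_inv W xs"] path_path_inv path_inv_path_inv by force

lemma hom_cancel_left:
  assumes "hom c (us @ xs) (us @ ys)" "path c us" "path (endpt c us) xs"
  shows "hom (endpt c us) xs ys"
proof -
  let ?d = "endpt c us" and ?i = "path_inv W us"
  have i: "path ?d ?i" "endpt ?d ?i = c" using path_path_inv[OF assms(2)] by auto
  have p: "path ?d ys" using assms hom_path[OF assms(1)] by (simp add: path_append)
  have e: "hom ?d ((?i @ us) @ zs) zs" if "path ?d zs" for zs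
    using hom_right[OF hom_inv_left[OF assms(2)], of zs] i assms(2) that by (simp add: path_append)
  have "hom ?d (?i @ us @ xs) (?i @ us @ ys)"
    by (rule hom_left) (use i assms in \<open>simp_all add: path_append\<close>)
  with e[OF assms(3)] e[OF p] show ?thesis by simp (meson hom_sym hom_trans)
qed

lemma hom_move_right:
  assumes "hom c (xs @ vs) ys" "path c (xs @ vs)"
  shows "hom c xs (ys @ path_inv W vs)"
proof -
  have v: "path (endpt c xs) vs" "path c xs" using assms(2) by (auto simp: path_append)
  note i = path_path_inv[OF v(1)]
  have "hom c (xs @ (vs @ path_inv W vs)) (xs @ [])"
    by (rule hom_left[OF hom_inv_right[OF v(1)] v(2)]) (use v i in \<open>simp add: path_append\<close>)
  moreover have "hom c ((xs @ vs) @ path_inv W vs) (ys @ path_inv W vs)"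
    by (rule hom_right[OF assms(1)]) (use assms i in \<open>simp add: path_append\<close>)
  ultimately show ?thesis by simp (meson hom_sym hom_trans)
qed

lemma hom_move_left:
  assumes "hom c (us @ xs) ys" "path c (us @ xs)"
  shows "hom (endpt c us) xs (path_inv W us @ ys)"
proof -
  have v: "path (endpt c us) xs" "path c us" using assms(2) by (auto simp: path_append)
  note i = path_path_inv[OF v(2)]
  have y: "path c ys" using hom_path assms by blast
  have "hom c ((us @ path_inv W us) @ ys) ([] @ ys)"
    by (rule hom_right[OF hom_inv_right[OF v(2)]]) (use v i y in \<open>simp add: path_append\<close>)
  then have "hom c (us @ xs) (us @ path_inv W us @ ys)"
    using assms(1) by simp (meson hom_sym hom_trans)
  then show ?thesis by (rule hom_cancel_left) (use v in auto)
qed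

lemma hom_cancel_right: "hom c (xs @ vs) (ys @ vs) \<Longrightarrow> path c (xs @ vs) \<Longrightarrow> hom c xs ys"
proof -
  assume a: "hom c (xs @ vs) (ys @ vs)" "path c (xs @ vs)"
  have v: "path c ys" "path (endpt c ys) vs" using a hom_path[OF a(1)] by (auto simp: path_append)
  note i = path_path_inv[OF v(2)]
  have "hom c xs ((ys @ vs) @ path_inv W vs)" by (rule hom_move_right[OF a])
  also have "hom c ((ys @ vs) @ path_inv W vs) (ys @ [])"
    using hom_left[OF hom_inv_right[OF v(2)] v(1)] v i by (simp add: path_append)
  finally show ?thesis by simp
qed

text \<open>Cancelling \<open>x\<close> puts its inverse in front of \<open>y\<close>, and as the
  edges differ these two compose to one edge \<open>z\<close>. A difference in the first edges thus
  turns into one extra edge of the same type, which the rigidity arguments can contradict.\<close>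

lemma hom_distinct_first_edges:
  assumes "hom c (x # xs) (y # ys)" "path c (x # xs)" "fst y = fst x" "x \<noteq> y"
  obtains z where "fst z = fst x" "path (edge_tgt W x) (z # ys)" "hom (edge_tgt W x) (z # ys) xs"
proof
  let ?d = "edge_tgt W x" and ?i = "edge_inv W x"
  let ?z = "edge_comp W ?i y"
  have py: "path c (y # ys)" using assms hom_path by blast
  have x: "cs_edge S W x" "edge_src W x = c" "cs_edge S W y" "edge_src W y = c" using assms py by auto
  note inv = cs_edge_inv[OF x(1)]
  have ne: "y \<noteq> edge_inv W ?i" using inv assms by simp
  have e: "edge_tgt W ?i = edge_src W y" using inv x by simp
  note comp = cs_edge_comp[OF inv(1) x(3) _ e ne]
  show "fst ?z = fst x" by simp
  show p: "path ?d (?z # ys)" using comp inv assms py cs_edge_chambers[OF x(1)] by auto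
  have "hom ?d ([?i, y] @ ys) ([?z] @ ys)"
  proof (rule hom_right[OF hom_comp])
    show "path ?d [?i, y]" "path ?d ([?i, y] @ ys)"
      using inv x py cs_edge_chambers[OF x(1)] cs_edge_chambers[OF x(3)] by auto
  qed (use assms ne in simp_all)
  moreover have "hom ?d xs ([?i] @ y # ys)" using hom_move_left[of c "[x]" xs "y # ys"] assms by simp
  ultimately show "hom ?d (?z # ys) xs" by simp (meson hom_sym hom_trans)
qed

text \<open>Two distinct edges of the same type and the same terminal chamber combine to a single edge, so
  a last difference between two homotopic galleries would lengthen one of them by one letter.\<close>

lemma homotopic_same_type_unique:
  assumes G: "\<And>u s. G (u @ [s]) \<Longrightarrow> G u" "\<And>u. G u \<Longrightarrow> reduced S M u"
    and hom_length: "\<And>c xs ys. \<lbrakk>path c xs; path c ys; G (ty xs); G (ty ys); hom c xs ys\<rbrakk>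
      \<Longrightarrow> cox_elt S M (ty xs) = cox_elt S M (ty ys)"
    and xs: "path c xs" "hom c xs ys" "ty ys = ty xs" "G (ty xs)"
  shows "xs = ys"
  using xs
proof (induction xs arbitrary: ys rule: rev_induct)
  case (snoc x xs)
  then obtain ys' y where ys: "ys = ys' @ [y]" "ty ys' = ty xs" "fst y = fst x"
    by (cases ys rule: rev_cases) auto
  have py: "path c (ys' @ [y])" using snoc hom_path ys by blast
  have "y = x"
  proof (rule ccontr)
    assume ne: "y \<noteq> x"
    have x: "cs_edge S W x" "edge_src W x = endpt c xs" "cs_edge S W y" "edge_src W y = endpt c ys'"
      "path c xs" "path c ys'" "edge_tgt W y = edge_tgt W x"
      using snoc.prems py hom_endpt[OF snoc.prems(2)] unfolding ys by (auto simp: path_append)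
    note inv = cs_edge_inv[OF x(1)]
    have "edge_inv W x \<noteq> edge_inv W y" using cs_edge_inv(4) x ne by metis
    note comp = cs_edge_comp[OF x(3) inv(1) _ _ this]
    have p: "path (endpt c ys') [y, edge_inv W x]"
      using x inv cs_edge_chambers[OF x(3)] cs_edge_chambers[OF x(1)] by auto
    have "hom c xs (ys' @ [y, edge_inv W x])"
      using hom_move_right[of c xs "[x]" ys] snoc.prems(1,2) unfolding ys(1) by simp
    also have "hom c (ys' @ [y, edge_inv W x]) (ys' @ [edge_comp W y (edge_inv W x)])"
      by (rule hom_left[OF hom_comp[OF p] x(6)])
        (use p ys(3) \<open>edge_inv W x \<noteq> edge_inv W y\<close> in simp_all)
    finally have h: "hom c xs (ys' @ [edge_comp W y (edge_inv W x)])" by simp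
    have "cox_elt S M (ty xs) = cox_elt S M (ty (ys' @ [edge_comp W y (edge_inv W x)]))"
      by (rule hom_length[OF x(5) _ _ _ h]) (use h x(5) hom_path snoc.prems G ys in auto)
    then have "cox_elt S M (ty xs) = cox_elt S M (ty (xs @ [x]))" using ys by simp
    moreover have "reduced S M (ty (xs @ [x]))" using G snoc.prems by blast
    moreover have "set (ty xs) \<subseteq> S" "length (ty xs) < length (ty (xs @ [x]))"
      using x(5) path_ty by simp_all
    ultimately show False unfolding reduced_def by blast
  qed
  moreover have "hom c xs ys'" using snoc.prems ys \<open>y = x\<close> hom_cancel_right by blast
  then have "xs = ys'" using snoc.IH snoc.prems(1,4) ys(2) G(1) by (auto simp: path_append)
  ultimately show ?case using ys by simp
qed simp

end

subsection \<open>Braiding of galleries\<close>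

context coxeter_matrix
begin

section \<open>Alternating words and convenient longest words in rank 3\<close>

lemma reduced_single: "s \<in> S \<Longrightarrow> red [s]"
  unfolding reduced_iff using word_eq_even by (metis One_nat_def Suc_leI empty_iff even_zero insert_iff
    length_0_conv length_Cons length_greater_0_conv list.set(1,2) odd_one subsetI)

lemma reduced_dihedral:
  assumes "red u" "set u \<subseteq> {s, t}"
  shows "u = alt_word (length u) s t \<or> u = alt_word (length u) t s"
  using assms
proof (induction u)
  case (Cons x u)
  then have IH: "u = alt_word (length u) s t \<or> u = alt_word (length u) t s"
    using reduced_suffix[of "[x]" u] by auto
  show ?case
  proof (cases u)
    case Nil
    then show ?thesis using Cons by auto
  next
    case (Cons y v)
    then have "x \<noteq> y" using not_reduced_square[of "[]" x v] Cons.prems by auto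
    with IH Cons Cons.prems show ?thesis by auto
  qed
qed simp

lemma reduced_max_alt_word: "finite_pair S M s t \<Longrightarrow> red (max_word s t)"
  using reduced_alt_word[OF finite_pairD(1-3)] finite_pairD(4) by simp

lemma descent_if_word_eq:
  assumes "red f" "f \<simeq> g @ [t]" "length f = Suc (length g)" "set (g @ [t]) \<subseteq> S"
  shows "\<not> red (f @ [t])"
  using descent_if_word_eq_snoc[OF assms(1) _ assms(2)] reduced_if_word_eq[OF assms(1,2,4)] assms(3) by simp

lemma braid_relation: "finite_pair S M s t \<Longrightarrow> max_word s t \<simeq> opp_word s t"
  using braid_step_word_eq[OF braid_step.intros[of S M s t "[]" "[]"]] by simp

text \<open>The types of alternating geodesics, as a property of words alone. Words of length at
  most 1 are listed separately since a letter need not belong to any finite pair.\<close>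

definition alternating :: "'s list \<Rightarrow> bool" where
  "alternating u \<longleftrightarrow> red u \<and> (length u \<le> 1 \<or> (\<exists>s t. finite_pair S M s t \<and> (\<exists>m. u = alt_word m s t)))"

lemma alternating_reduced: "alternating u \<Longrightarrow> red u"
  by (simp add: alternating_def)

lemma alternating_single: "s \<in> S \<Longrightarrow> alternating [s]"
  by (simp add: alternating_def reduced_single)

lemma alternating_dihedral: "finite_pair S M s t \<Longrightarrow> red u \<Longrightarrow> set u \<subseteq> {s, t} \<Longrightarrow> alternating u"
  using reduced_dihedral[of u s t] finite_pair_sym[of s t] unfolding alternating_def by metis

lemma alternating_max: "finite_pair S M s t \<Longrightarrow> alternating (max_word s t)"
  using reduced_max_alt_word unfolding alternating_def by blast

lemma alternating_butlast: "alternating (u @ [s]) \<Longrightarrow> alternating u"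
proof -
  assume a: "alternating (u @ [s])"
  then have r: "red u" by (blast dest: alternating_reduced reduced_prefix)
  show "alternating u"
  proof (cases "length u \<le> 1")
    case False
    then obtain x y m where xy: "finite_pair S M x y" "u @ [s] = alt_word m x y"
      using a by (auto simp: alternating_def)
    then have "set (u @ [s]) \<subseteq> {x, y}" using set_alt_word_subset by metis
    with alternating_dihedral[OF xy(1) r] show ?thesis by simp
  qed (use r in \<open>simp add: alternating_def\<close>)
qed

text \<open>\<open>a\<close> commutes with \<open>b\<close> and \<open>c\<close> and can be moved to
  the end, and the longest word in \<open>b\<close>, \<open>c\<close> can be made to end in either
  letter. This longest word is chosen because a single letter precedes a dihedral part, which suits
  \<open>rigid_A1_I2\<close>.\<close>

lemma longest_word_A1_I2:
  assumes bc: "finite_pair S M b c" and a: "a \<in> S" "a \<notin> {b, c}" "M a b = 2" "M a c = 2"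
  defines "f \<equiv> a # max_word b c"
  shows "red f" "x \<in> {a, b, c} \<Longrightarrow> \<not> red (f @ [x])"
proof -
  define m where "m = the_enat (M b c)"
  note D = finite_pairD[OF bc, folded m_def]
  have fp: "finite_pair S M a b" "finite_pair S M a c" "the_enat (M a b) = 2" "the_enat (M a c) = 2"
    using a D by (auto simp: finite_pair_def numeral_eq_enat)
  have two: "red [a, x]" "[a, x] \<simeq> [x, a]" if "x \<in> {b, c}" for x
    using that reduced_max_alt_word[OF fp(1)] reduced_max_alt_word[OF fp(2)]
      braid_relation[OF fp(1)] braid_relation[OF fp(2)] fp by auto
  show red: "red f"
    using reduced_append_if_no_descents[of "[a]" "{b, c}" "alt_word m b c"] reduced_single[OF a(1)] D(1,2)
      two(1) reduced_max_alt_word[OF bc] set_alt_word_subset[of m b c] by (simp add: f_def m_def)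
  have commute: "[a] @ u \<simeq> u @ [a]" if "set u \<subseteq> {b, c}" for u
    using that
  proof (induction u)
    case (Cons x u)
    have "[a, x] @ u \<simeq> [x, a] @ u" using two(2)[of x] Cons.prems word_eq_context[of "[a, x]" "[x, a]" "[]" u] by auto
    also have "[x, a] @ u \<simeq> [x] @ u @ [a]"
      using word_eq_context[of "[a] @ u" "u @ [a]" "[x]" "[]"] Cons by auto
    finally show ?case by simp
  qed simp
  obtain k where k: "m = Suc k" using D(5) by (cases m) auto
  have len: "length f = Suc m" by (simp add: f_def m_def)
  have fS: "set f \<subseteq> S" using reduced_subset[OF red] .
  have u: "alt_word m b c \<simeq> alt_word m c b" using braid_relation[OF bc] by (simp add: m_def)
  have eq: "alt_word m b c \<simeq> rev (alt_word m x y)" if "{x, y} = {b, c}" "x \<noteq> y" for x y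
    using that u by (auto simp: rev_alt_word doubleton_eq_iff)
  have *: "\<not> red (f @ [x])" if "{x, y} = {b, c}" "x \<noteq> y" for x y
  proof (rule descent_if_word_eq[OF red])
    have "f \<simeq> [a] @ rev (alt_word m x y)"
      using word_eq_append[OF _ eq[OF that], of "[a]" "[a]"] by (simp add: f_def m_def)
    then show "f \<simeq> (a # rev (alt_word k y x)) @ [x]" by (simp add: k)
    show "length f = Suc (length (a # rev (alt_word k y x)))" using len k by simp
    show "set ((a # rev (alt_word k y x)) @ [x]) \<subseteq> S"
      using set_alt_word_subset[of k y x] that D(1,2) a(1) by (auto simp: doubleton_eq_iff)
  qed
  show "\<not> red (f @ [x])" if "x \<in> {a, b, c}"
  proof -
    have "\<not> red (f @ [a])"
      by (rule descent_if_word_eq[OF red, of "alt_word m b c"])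
        (use commute[OF set_alt_word_subset] fS len in \<open>auto simp: f_def m_def\<close>)
    with that *[of b c] *[of c b] D(3) show ?thesis by auto
  qed
qed

text \<open>The word is \<open>[a, b, c]\<close>, which has no descents in \<open>{a, b}\<close>,
  followed by the longest word in \<open>a\<close>, \<open>b\<close>. From this form
  \<open>rigid_A3\<close> can peel off the first three edges and end in a dihedral part.\<close>

lemma longest_word_A3:
  assumes J: "a \<in> S" "b \<in> S" "c \<in> S" "distinct [a, b, c]"
    and M: "M a b = 3" "M b c = 3" "M a c = 2"
  defines "f \<equiv> [a, b, c, a, b, a]"
  shows "red f" "x \<in> {a, b, c} \<Longrightarrow> \<not> red (f @ [x])"
proof -
  have fp: "finite_pair S M a b" "finite_pair S M b c" "finite_pair S M a c" and
    m: "the_enat (M a b) = 3" "the_enat (M b c) = 3" "the_enat (M a c) = 2"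
    using J M by (auto simp: finite_pair_def numeral_eq_enat)
  have braid: "[a, b, a] \<simeq> [b, a, b]" "[b, c, b] \<simeq> [c, b, c]" "[a, c] \<simeq> [c, a]"
    using braid_relation[OF fp(1)] braid_relation[OF fp(2)] braid_relation[OF fp(3)] by (simp_all add: m)
  have r: "red [a, b, a]" "red [b, c, b]" "red [a, c]"
    using reduced_max_alt_word[OF fp(1)] reduced_max_alt_word[OF fp(2)] reduced_max_alt_word[OF fp(3)]
    by (simp_all add: m)
  have r2: "red [a, b]" "red [c, b]" "red [c, a]"
    using reduced_infix[of "[]" "[a, b]" "[a]"] reduced_infix[of "[b]" "[c, b]" "[]"] r
      reduced_rev[of "[a, c]"] by simp_all
  have "red [a, b, c, b]"
    using reduced_append_if_no_descents[of "[a]" "{b, c}" "[b, c, b]"] reduced_single J r r2 by auto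
  moreover have "red [a, b, c, a]"
  proof -
    have "red [c, a, b, a]"
      using reduced_append_if_no_descents[of "[c]" "{a, b}" "[a, b, a]"] reduced_single J r r2 by auto
    then have "red [a, b, a, c]" using reduced_rev[of "[c, a, b, a]"] by simp
    then show ?thesis
      using reduced_if_word_eq[of "[a, b, a, c]" "[a, b, c, a]"] word_eq_context[OF braid(3), of "[a, b]" "[]"] J
      by simp
  qed
  ultimately show red: "red f"
    using reduced_append_if_no_descents[of "[a, b, c]" "{a, b}" "[a, b, a]"] r J
      reduced_prefix[of "[a, b, c]" "[b]"] by (auto simp: f_def)
  have 1: "f \<simeq> [a, b, c, b, a] @ [b]" using word_eq_context[OF braid(1), of "[a, b, c]" "[]"] by (simp add: f_def)
  have "[a, b, c, b, a] @ [b] \<simeq> [a, c, b, c, a, b]" using word_eq_context[OF braid(2), of "[a]" "[a, b]"] by simp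
  also have "\<dots> \<simeq> [c, a, b, c, a, b]" using word_eq_context[OF braid(3), of "[]" "[b, c, a, b]"] by simp
  also have "\<dots> \<simeq> [c, a, b, a, c, b]"
    using word_eq_context[OF braid(3)[THEN equivclp_sym], of "[c, a, b]" "[b]"] by simp
  also have "\<dots> \<simeq> [c, b, a, b, c, b]" using word_eq_context[OF braid(1), of "[c]" "[c, b]"] by simp
  also have "\<dots> \<simeq> [c, b, a, c, b] @ [c]" using word_eq_context[OF braid(2), of "[c, b, a]" "[]"] by simp
  finally have 2: "f \<simeq> [c, b, a, c, b] @ [c]" using 1 by (blast intro: word_eq_trans)
  show "\<not> red (f @ [x])" if "x \<in> {a, b, c}"
  proof -
    have "\<not> red (f @ [a])" by (rule descent_if_word_eq[OF red, of "[a, b, c, a, b]"]) (use J in \<open>auto simp: f_def\<close>)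
    moreover have "\<not> red (f @ [b])" by (rule descent_if_word_eq[OF red 1]) (use J in \<open>auto simp: f_def\<close>)
    moreover have "\<not> red (f @ [c])" by (rule descent_if_word_eq[OF red 2]) (use J in \<open>auto simp: f_def\<close>)
    ultimately show ?thesis using that by blast
  qed
qed

end

text \<open>The replacement \<open>q\<close> is any homotopic gallery of the opposite type: PW1
  provides one, and 2W makes it the only one. In the use as \<open>gstep\<close> homotopy is that of
  the whole graph, also when the edges lie in a residue.\<close>

inductive gallery_braid_step ::
  "'s set \<Rightarrow> ('s \<Rightarrow> 's \<Rightarrow> enat) \<Rightarrow> ('c, 'e, 's) weyl_data \<Rightarrow> 'c
    \<Rightarrow> ('s \<times> 'e) list \<Rightarrow> ('s \<times> 'e) list \<Rightarrow> bool"
  for S M W c where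
  "\<lbrakk>finite_pair S M s t; edge_path S W c (us @ p @ vs);
    ty p = alt_word (the_enat (M s t)) s t; ty q = alt_word (the_enat (M s t)) t s;
    homotopic S M W (terminal W (c, us), p) (terminal W (c, us), q)\<rbrakk>
    \<Longrightarrow> gallery_braid_step S M W c (us @ p @ vs) (us @ q @ vs)"

section \<open>Lifting braid moves from words to galleries\<close>

locale coxeter_weyl = coxeter_matrix S M + two_weyl_graph S M W
  for S :: "'s set" and M :: "'s \<Rightarrow> 's \<Rightarrow> enat" and W :: "('c, 'e, 's) weyl_data"
begin

abbreviation "gstep \<equiv> gallery_braid_step S M W"

abbreviation "braided c \<equiv> (gstep c)\<^sup>*\<^sup>*"

lemma gallery_braid_step_hom: "gstep c xs ys \<Longrightarrow> hom c xs ys"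
proof (induction rule: gallery_braid_step.induct)
  case (1 s t us p vs q)
  then show ?case by (intro hom_context) (auto simp: path_append)
qed

lemma gallery_braid_step_path: "gstep c xs ys \<Longrightarrow> path c xs \<and> path c ys"
  using hom_path[OF gallery_braid_step_hom] by (auto elim: gallery_braid_step.cases)

lemma gallery_braid_step_ty: "gstep c xs ys \<Longrightarrow> braid_step S M (ty xs) (ty ys)"
proof (induction rule: gallery_braid_step.induct)
  case (1 s t us p vs q)
  then show ?case using braid_step.intros[OF 1(1), of "ty us" "ty vs"] by simp
qed

lemma gallery_braid_step_sym: "gstep c xs ys \<Longrightarrow> gstep c ys xs"
proof -
  assume a: "gstep c xs ys"
  then have p: "path c ys" using gallery_braid_step_path by blast
  from a p show ?thesis
  proof (induction rule: gallery_braid_step.induct)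
    case (1 s t us p vs q)
    then show ?case
      using gallery_braid_step.intros[of S M t s W c us q vs p] finite_pair_sym[of s t] hom_sym by auto
  qed
qed

lemma braided_hom: "braided c xs ys \<Longrightarrow> hom c xs ys"
  by (induction rule: rtranclp_induct) (auto intro: hom_trans gallery_braid_step_hom)

lemma braided_path: "braided c xs ys \<Longrightarrow> path c xs \<longleftrightarrow> path c ys"
  using hom_path[OF braided_hom] .

lemma braided_endpt: "braided c xs ys \<Longrightarrow> endpt c ys = endpt c xs"
  using hom_endpt[OF braided_hom] .

lemma braided_ty: "braided c xs ys \<Longrightarrow> braids (ty xs) (ty ys)"
  by (induction rule: rtranclp_induct) (auto intro: rtranclp.rtrancl_into_rtrancl gallery_braid_step_ty)

lemma braided_reduced: "braided c xs ys \<Longrightarrow> red (ty xs) \<longleftrightarrow> red (ty ys)"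
  using braided_ty braid_reduced braid_sym by blast

lemma braided_length: "braided c xs ys \<Longrightarrow> length ys = length xs"
  using braid_length[OF braided_ty] by fastforce

lemma braided_word_eq: "braided c xs ys \<Longrightarrow> ty xs \<simeq> ty ys"
  using braid_word_eq[OF braided_ty] .

lemma braided_sym: "braided c xs ys \<Longrightarrow> braided c ys xs"
  by (induction rule: rtranclp_induct) (auto intro: converse_rtranclp_into_rtranclp gallery_braid_step_sym)

lemma braided_trans [trans]: "braided c xs ys \<Longrightarrow> braided c ys zs \<Longrightarrow> braided c xs zs"
  by (rule rtranclp_trans)

lemma gallery_braid_step_context:
  assumes "gstep d xs ys" "d = endpt c us" "path c us" "path (endpt d xs) vs"
  shows "gstep c (us @ xs @ vs) (us @ ys @ vs)"
  using assms(1,4)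
proof (induction rule: gallery_braid_step.induct)
  case (1 s t us' p vs' q)
  then show ?case
    using gallery_braid_step.intros[of S M s t W c "us @ us'" p "vs' @ vs" q] assms(2,3)
    by (simp add: path_append)
qed

lemma braided_context:
  assumes "braided (endpt c us) xs ys" "path c us" "path (endpt c (us @ xs)) vs"
  shows "braided c (us @ xs @ vs) (us @ ys @ vs)"
  using assms(1)
proof (induction rule: rtranclp_induct)
  case (step y z)
  have "gstep c (us @ y @ vs) (us @ z @ vs)"
    by (rule gallery_braid_step_context[OF step(2) _ assms(2)])
      (use assms(3) braided_endpt[OF step(1)] in auto)
  with step show ?case by simp
qed simp

lemma braided_left: "braided (endpt c us) xs ys \<Longrightarrow> path c (us @ xs) \<Longrightarrow> braided c (us @ xs) (us @ ys)"
  using braided_context[of c us xs ys "[]"] path_endpt[of c "us @ xs"] by (simp add: path_append)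

lemma braided_right: "braided c xs ys \<Longrightarrow> path c (xs @ vs) \<Longrightarrow> braided c (xs @ vs) (ys @ vs)"
  using braided_context[of c "[]" xs ys vs] path_chambers[of c "xs @ vs"] by (simp add: path_append)

lemma opposite_max_geodesic:
  assumes "finite_pair S M s t" "path c p" "ty p = max_word s t"
  obtains q where "ty q = opp_word s t" "hom c p q"
proof -
  have "max_st_geodesic S M W s t (c, p)" using assms by (simp add: max_st_geodesic_def gallery_def gtype_def)
  then obtain d q where q: "max_st_geodesic S M W t s (d, q)" "homotopic S M W (c, p) (d, q)"
    using PW1[OF assms(1)] by (metis surj_pair)
  then have "d = c" using homotopic_path by fastforce
  with q show ?thesis
    using that[of q] finite_pair_sym[OF assms(1)] by (simp add: max_st_geodesic_def gtype_def)
qed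

lemma alternating_cox_elt_eq:
  assumes "path c xs" "path c ys" "alternating (ty xs)" "alternating (ty ys)" "hom c xs ys"
  shows "cox_elt S M (ty xs) = cox_elt S M (ty ys)"
proof -
  have "alternating_geodesic S M W (c, zs)" if "path c zs" "alternating (ty zs)" for zs
    using that by (auto simp: alternating_geodesic_def gallery_def st_geodesic_def geodesic_def gtype_def alternating_def)
  from two_W[OF this[OF assms(1,3)] this[OF assms(2,4)] assms(5)] show ?thesis
    by (simp add: W_length_def gtype_def)
qed

text \<open>Alternating words stay alternating on dropping the last letter, and for them 2W is the
  length hypothesis of \<open>homotopic_same_type_unique\<close>.\<close>

lemma alternating_unique:
  assumes "path c xs" "hom c xs ys" "ty ys = ty xs" "alternating (ty xs)"
  shows "xs = ys"
  using homotopic_same_type_unique[of alternating c xs ys] alternating_butlast alternating_reduced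
    alternating_cox_elt_eq assms by blast

text \<open>A step of the word is carried out in the galleries \<open>xs\<close> and \<open>ys\<close> at the same place, where
  uniqueness of the opposite maximal geodesic makes it injective.\<close>

lemma gallery_braid_step_lift2:
  assumes "braid_step S M f g" "path c xs" "path c ys" "ty xs = f" "ty ys = f"
  shows "\<exists>xs' ys'. ty xs' = g \<and> ty ys' = g \<and> gstep c xs xs' \<and>
    gstep c ys ys' \<and> (xs' = ys' \<longrightarrow> xs = ys)"
  using assms
proof (induction rule: braid_step.induct)
  case (1 s t u v)
  let ?m = "the_enat (M s t)"
  obtain us p vs where xs: "xs = us @ p @ vs" "ty us = u" "ty p = alt_word ?m s t" "ty vs = v"
    using map_eq_appendE3[OF 1(4)] by metis
  obtain us' p' vs' where ys: "ys = us' @ p' @ vs'" "ty us' = u" "ty p' = alt_word ?m s t" "ty vs' = v"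
    using map_eq_appendE3[OF 1(5)] by metis
  have pth: "path (endpt c us) p" "path (endpt c us') p'" using 1 xs ys by (auto simp: path_append)
  obtain q where q: "ty q = alt_word ?m t s" "hom (endpt c us) p q"
    using opposite_max_geodesic[OF 1(1) pth(1) xs(3)] by blast
  obtain q' where q': "ty q' = alt_word ?m t s" "hom (endpt c us') p' q'"
    using opposite_max_geodesic[OF 1(1) pth(2) ys(3)] by blast
  have "gstep c xs (us @ q @ vs)" "gstep c ys (us' @ q' @ vs')"
    using 1 xs ys q q' by (auto intro!: gallery_braid_step.intros)
  moreover have "xs = ys" if eq: "us @ q @ vs = us' @ q' @ vs'"
  proof -
    have "length us = length us'" "length q = length q'"
      using xs(2) ys(2) q(1) q'(1) by (metis length_map)+
    then have e: "us = us'" "q = q'" "vs = vs'" using eq by auto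
    then have "hom (endpt c us) p p'" using q q' by (blast intro: hom_trans hom_sym)
    then have "p = p'" using alternating_unique[OF pth(1)] alternating_max[OF 1(1)] xs(3) ys(3) by simp
    with e xs ys show ?thesis by simp
  qed
  ultimately show ?case using xs ys q q' by (intro exI[of _ "us @ q @ vs"] exI[of _ "us' @ q' @ vs'"]) auto
qed

lemma braided_lift2:
  assumes "braids f g" "path c xs" "path c ys" "ty xs = f" "ty ys = f"
  shows "\<exists>xs' ys'. ty xs' = g \<and> ty ys' = g \<and> braided c xs xs' \<and> braided c ys ys' \<and> (xs' = ys' \<longrightarrow> xs = ys)"
  using assms(1)
proof (induction rule: rtranclp_induct)
  case base
  then show ?case using assms by blast
next
  case (step y z)
  then obtain xs' ys' where *: "ty xs' = y" "ty ys' = y" "braided c xs xs'" "braided c ys ys'"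
    "xs' = ys' \<longrightarrow> xs = ys" by blast
  obtain xs'' ys'' where "ty xs'' = z" "ty ys'' = z" "gstep c xs' xs''"
    "gstep c ys' ys''" "xs'' = ys'' \<longrightarrow> xs' = ys'"
    using gallery_braid_step_lift2[OF step(2) _ _ *(1,2)] assms(2,3) braided_path *(3,4) by blast
  with * show ?case by (intro exI[of _ xs''] exI[of _ ys'']) auto
qed

text \<open>Matsumoto's theorem supplies braid moves from the type of \<open>xs\<close> to
  \<open>g\<close>, and each of them lifts.\<close>

lemma braided_lift:
  assumes "path c xs" "red (ty xs)" "red g" "ty xs \<simeq> g"
  obtains ys where "ty ys = g" "braided c xs ys"
  using braided_lift2[OF matsumoto_tits[OF assms(2-4)] assms(1,1)] that by blast

lemma descent_last_edge:
  assumes "path c xs" "red (ty xs)" "s \<in> S" "\<not> red (ty xs @ [s])"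
  obtains ys e where "braided c xs (ys @ [e])" "fst e = s"
proof -
  obtain v where v: "red (v @ [s])" "v @ [s] \<simeq> ty xs"
    by (rule shorter_if_not_reduced_snoc[OF assms(2-4)])
  obtain zs where zs: "ty zs = v @ [s]" "braided c xs zs"
    using braided_lift[OF assms(1,2) v(1)] v(2) word_eq_sym by blast
  then obtain ys e where "zs = ys @ [e]" "fst e = s" by (auto simp: map_eq_append_conv)
  with zs that show ?thesis by blast
qed

section \<open>Reducing galleries up to homotopy, and rigidity obtained from 2W\<close>

lemma hom_last_cancel: "path c (xs @ [e, edge_inv W e]) \<Longrightarrow> hom c (xs @ [e, edge_inv W e]) xs"
  using hom_left[OF hom_cancel, of c xs e] cs_edge_chambers by (fastforce simp: path_append)

lemma hom_last_comp:
  "path c (xs @ [e, x]) \<Longrightarrow> fst x = fst e \<Longrightarrow> x \<noteq> edge_inv W e \<Longrightarrow> hom c (xs @ [e, x]) (xs @ [edge_comp W e x])"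
  using hom_left[OF hom_comp, of c xs e x] by (auto simp: path_append)

text \<open>If the type of the new edge \<open>x\<close> is a descent, the gallery is braided to end
  in an edge \<open>e\<close> of that type, and then \<open>e\<close> and \<open>x\<close> cancel or
  compose. No new types appear, which \<open>alternating_confined\<close> relies on.\<close>

lemma ex_reduced_gallery_snoc:
  assumes "path c (xs @ [x])" "red (ty xs)"
  shows "\<exists>ys. path c ys \<and> red (ty ys) \<and> set (ty ys) \<subseteq> set (ty (xs @ [x])) \<and> hom c (xs @ [x]) ys"
proof (cases "red (ty (xs @ [x]))")
  case True
  then show ?thesis using assms by (intro exI[of _ "xs @ [x]"]) simp
next
  case False
  have S: "path c xs" "fst x \<in> S" using assms path_ty[OF assms(1)] by (auto simp: path_append)
  obtain zs e where ze: "braided c xs (zs @ [e])" "fst e = fst x"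
    using descent_last_edge[OF S(1) assms(2) S(2)] False by auto
  then have h: "hom c (xs @ [x]) (zs @ [e, x])"
    using hom_right[OF braided_hom[OF ze(1)] assms(1)] by simp
  have p: "path c (zs @ [e, x])" using hom_path[OF h] assms by blast
  have r: "red (ty (zs @ [e]))" using braided_reduced[OF ze(1)] assms(2) by blast
  have st: "set (ty (zs @ [e])) = set (ty xs)" using braid_set[OF braided_ty[OF ze(1)]] by simp
  show ?thesis
  proof (cases "x = edge_inv W e")
    case True
    then have "hom c (xs @ [x]) zs" using h hom_last_cancel p hom_trans by blast
    moreover have "red (ty zs)" using r reduced_prefix by simp
    ultimately show ?thesis using p st by (intro exI[of _ zs]) (auto simp: path_append)
  next
    case False
    then have "hom c (xs @ [x]) (zs @ [edge_comp W e x])" using h hom_last_comp[OF p] ze(2) hom_trans by metis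
    then show ?thesis using r st assms hom_path by (intro exI[of _ "zs @ [edge_comp W e x]"]) auto
  qed
qed

lemma ex_reduced_gallery:
  assumes "path c xs"
  shows "\<exists>ys. path c ys \<and> red (ty ys) \<and> set (ty ys) \<subseteq> set (ty xs) \<and> hom c xs ys"
  using assms
proof (induction xs rule: rev_induct)
  case Nil
  then show ?case by (intro exI[of _ "[]"]) simp
next
  case (snoc x xs)
  then obtain ys where ys: "path c ys" "red (ty ys)" "set (ty ys) \<subseteq> set (ty xs)" "hom c xs ys"
    by (auto simp: path_append)
  have h: "hom c (xs @ [x]) (ys @ [x])" by (rule hom_right[OF ys(4) snoc.prems])
  then have "path c (ys @ [x])" using hom_path snoc.prems by blast
  then obtain zs where "path c zs" "red (ty zs)" "set (ty zs) \<subseteq> set (ty (ys @ [x]))" "hom c (ys @ [x]) zs"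
    using ex_reduced_gallery_snoc ys(2) by blast
  moreover from this have "set (ty zs) \<subseteq> set (ty (xs @ [x]))" using ys(3) unfolding map_append set_append by blast
  ultimately show ?case using h hom_trans by blast
qed

text \<open>Cancelling the surroundings makes \<open>xs\<close> homotopic to a gallery over
  \<open>{r, s}\<close>, which reduces to an alternating geodesic over these types. By 2W both
  geodesics have the same W-length, and reduced words of one element have the same letters.\<close>

lemma alternating_confined:
  assumes rs: "finite_pair S M r s" and p: "path d (us @ xs @ vs)" and h: "hom d (us @ xs @ vs) zs"
    and alt: "alternating (ty xs)" and sub: "set (ty us) \<union> set (ty vs) \<union> set (ty zs) \<subseteq> {r, s}"
  shows "set (ty xs) \<subseteq> {r, s}"
proof -
  have "hom (endpt d us) (xs @ vs) (path_inv W us @ zs)" using hom_move_left[OF h p] .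
  then have h': "hom (endpt d us) xs ((path_inv W us @ zs) @ path_inv W vs)"
    by (rule hom_move_right) (use p in \<open>simp add: path_append\<close>)
  have px: "path (endpt d us) xs" using p by (auto simp: path_append)
  obtain ys where ys: "path (endpt d us) ys" "red (ty ys)"
    "set (ty ys) \<subseteq> set (ty ((path_inv W us @ zs) @ path_inv W vs))"
    "hom (endpt d us) ((path_inv W us @ zs) @ path_inv W vs) ys"
    using ex_reduced_gallery hom_path[OF h'] px by blast
  have "set (ty ((path_inv W us @ zs) @ path_inv W vs)) \<subseteq> {r, s}" using sub by simp
  with ys(3) have s: "set (ty ys) \<subseteq> {r, s}" by (rule subset_trans)
  have "cox_elt S M (ty xs) = cox_elt S M (ty ys)"
    using alternating_cox_elt_eq[OF px ys(1) alt alternating_dihedral[OF rs ys(2) s]] h' ys(4) hom_trans by blast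
  then have "set (ty xs) = set (ty ys)"
    using reduced_set_eq alternating_reduced[OF alt] ys(2) cox_elt_eq_iff by blast
  with s show ?thesis by simp
qed

text \<open>If the first edges differed, an edge \<open>z\<close> of type \<open>a\<close> would be
  homotopic to a gallery over \<open>{b, c}\<close>, against \<open>alternating_confined\<close>.
  Then only the dihedral parts remain, for which 2W gives uniqueness.\<close>

lemma rigid_A1_I2:
  assumes bc: "finite_pair S M b c" and a: "a \<in> S" "a \<notin> {b, c}"
    and xs: "path d xs" "ty xs = a # max_word b c" "ty ys = ty xs" "hom d xs ys"
  shows "xs = ys"
proof -
  obtain x A y B where xy: "xs = x # A" "ys = y # B" "fst x = a" "fst y = a"
    and AB: "ty A = max_word b c" "ty B = ty A"
    using xs(2,3) by (auto simp: map_eq_Cons_conv)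
  have pA: "path (edge_tgt W x) A" "path d [x]" using xs(1) xy path_chambers by auto
  have "x = y"
  proof (rule ccontr)
    assume "x \<noteq> y"
    then obtain z where z: "fst z = a" "path (edge_tgt W x) (z # B)" "hom (edge_tgt W x) (z # B) A"
      using hom_distinct_first_edges[of d x A y B] xs xy by metis
    have "set (ty [z]) \<subseteq> {b, c}"
      by (rule alternating_confined[OF bc, where us = "[]" and vs = B and zs = A, of "edge_tgt W x"])
        (use z a AB set_alt_word_subset[of _ b c] alternating_single in auto)
    with z a show False by simp
  qed
  moreover have "A = B"
    using alternating_unique[OF pA(1), of B] hom_cancel_left[of d "[x]" A B] xs(4) xy \<open>x = y\<close> pA AB
      alternating_max[OF bc] by simp
  ultimately show ?thesis using xy by simp
qed

text \<open>The first three edges are compared one at a time. A difference produces an alternating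
  geodesic involving \<open>c\<close> that is homotopic to a gallery over \<open>{a, b}\<close>,
  against \<open>alternating_confined\<close>: a single edge of type \<open>c\<close> for the third
  edge, and a gallery of type \<open>c b c\<close> for the second and the first. In the case of the
  first edge it has to be uncovered by braiding.\<close>

lemma rigid_A3:
  assumes J: "a \<in> S" "b \<in> S" "c \<in> S" "distinct [a, b, c]"
    and M: "M a b = 3" "M b c = 3" "M a c = 2"
    and xs: "path d xs" "ty xs = [a, b, c, a, b, a]" "ty ys = ty xs" "hom d xs ys"
  shows "xs = ys"
proof -
  have fp: "finite_pair S M a b" "finite_pair S M b c" "finite_pair S M a c" "finite_pair S M b a"
    "finite_pair S M c b" "finite_pair S M c a" and
    m: "the_enat (M a b) = 3" "the_enat (M b c) = 3" "the_enat (M a c) = 2"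
    "the_enat (M b a) = 3" "the_enat (M c b) = 3" "the_enat (M c a) = 2"
    using J M sym[of a b] sym[of b c] sym[of a c] by (auto simp: finite_pair_def numeral_eq_enat)
  have alt_cbc: "alternating [c, b, c]" using alternating_max[OF fp(5)] by (simp add: m)
  obtain x1 x2 x3 A y1 y2 y3 B where xy: "xs = [x1, x2, x3] @ A" "ys = [y1, y2, y3] @ B"
    "fst x1 = a" "fst x2 = b" "fst x3 = c" "fst y1 = a" "fst y2 = b" "fst y3 = c"
    and AB: "ty A = [a, b, a]" "ty B = [a, b, a]"
    using xs(2,3) by (auto simp: map_eq_Cons_conv)
  have px: "path d [x1]" "path (edge_tgt W x1) [x2]" "path (edge_tgt W x2) [x3]" "path (edge_tgt W x3) A"
    using xs(1) xy path_chambers by auto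
  have sA: "set (ty (A @ path_inv W B)) \<subseteq> {a, b}" "set (ty A) \<subseteq> {a, b}" "set (ty B) \<subseteq> {a, b}"
    using AB by auto
  have e1: "x1 = y1"
  proof (rule ccontr)
    assume "x1 \<noteq> y1"
    then obtain z where z: "fst z = a" "path (edge_tgt W x1) (z # y2 # y3 # B)"
      "hom (edge_tgt W x1) (z # y2 # y3 # B) (x2 # x3 # A)"
      using hom_distinct_first_edges[of d x1 "x2 # x3 # A" y1 "y2 # y3 # B"] xs xy by auto
    let ?D = "edge_tgt W x3" and ?p = "edge_inv W x3" and ?q = "edge_inv W x2"
    have "hom (edge_tgt W x1) ([x2, x3] @ A) (z # y2 # y3 # B)" using z(3) hom_sym by simp
    then have h1: "hom ?D A ([?p, ?q, z, y2, y3] @ B)"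
      using hom_move_left[of "edge_tgt W x1" "[x2, x3]" A] xs(1) xy by auto
    then have p1: "path ?D ([?p, ?q, z, y2, y3] @ B)" using hom_path px(4) by blast
    \<comment> \<open>By \<open>h1\<close> the gallery \<open>A\<close> is homotopic to one of type
      \<open>c b a b c\<close> followed by \<open>B\<close>, and \<open>c b a b c\<close> is not
      alternating. The replacements \<open>u\<close>, \<open>v\<close>, \<open>w\<close> turn it
      into \<open>c a b a c\<close> and then, by two commutations, into \<open>a c b c a\<close>,
      which contains the alternating \<open>c b c\<close>.\<close>
    obtain u where u: "ty u = [a, b, a]" "hom (edge_tgt W ?p) [?q, z, y2] u"
      using opposite_max_geodesic[OF fp(4), of "edge_tgt W ?p" "[?q, z, y2]"] p1 xy z(1) path_chambers
      by (auto simp: m)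
    then obtain u1 u2 u3 where u123: "u = [u1, u2, u3]" "fst u1 = a" "fst u2 = b" "fst u3 = a"
      by (auto simp: map_eq_Cons_conv)
    have h2: "hom ?D ([?p] @ [?q, z, y2] @ y3 # B) ([?p] @ u @ y3 # B)"
      by (rule hom_context) (use u(2) p1 path_chambers in auto)
    then have p2: "path ?D ([?p, u1] @ [u2] @ [u3, y3] @ B)" using hom_path[OF h2] p1 u123 by simp
    obtain v where v: "ty v = [a, c]" "hom ?D [?p, u1] v"
      using opposite_max_geodesic[OF fp(6), of ?D "[?p, u1]"] p2 xy u123 path_chambers by (auto simp: m)
    then obtain v1 v2 where v12: "v = [v1, v2]" "fst v1 = a" "fst v2 = c" by (auto simp: map_eq_Cons_conv)
    obtain w where w: "ty w = [c, a]" "hom (edge_tgt W u2) [u3, y3] w"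
      using opposite_max_geodesic[OF fp(3), of "edge_tgt W u2" "[u3, y3]"] p2 xy u123 path_chambers by (auto simp: m)
    then obtain w1 w2 where w12: "w = [w1, w2]" "fst w1 = c" "fst w2 = a" by (auto simp: map_eq_Cons_conv)
    have h3: "hom ?D ([?p, u1, u2] @ [u3, y3] @ B) ([?p, u1, u2] @ w @ B)"
      by (rule hom_context) (use w(2) p2 path_chambers in auto)
    have p3: "path ?D ([?p, u1] @ [u2] @ w @ B)" using hom_path[OF h3] p2 by simp
    have h4: "hom ?D ([?p, u1] @ [u2] @ w @ B) (v @ [u2] @ w @ B)"
      by (rule hom_right[OF v(2) p3])
    have h5: "hom ?D ([v1] @ [v2, u2, w1] @ w2 # B) A"
      using h1 h2 h3 h4 unfolding u123 v12 w12 by simp (meson hom_sym hom_trans)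
    have p5: "path ?D ([v1] @ [v2, u2, w1] @ w2 # B)" using hom_path[OF h5] px(4) by blast
    have "set (ty [v2, u2, w1]) \<subseteq> {a, b}"
      by (rule alternating_confined[OF fp(1) p5 h5]) (use v12 w12 u123 alt_cbc sA in auto)
    with v12 J show False by auto
  qed
  then have h: "hom (edge_tgt W x1) (x2 # x3 # A) (y2 # y3 # B)"
    using hom_cancel_left[of d "[x1]" "x2 # x3 # A" "y2 # y3 # B"] xs xy px by auto
  have e2: "x2 = y2"
  proof (rule ccontr)
    assume "x2 \<noteq> y2"
    then obtain z where z: "fst z = b" "path (edge_tgt W x2) (z # y3 # B)"
      "hom (edge_tgt W x2) (z # y3 # B) (x3 # A)"
      using hom_distinct_first_edges[OF h] xs(1) xy by auto
    have "hom (edge_tgt W x2) ([x3] @ A) (z # y3 # B)" using z(3) hom_sym by simp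
    then have h1: "hom (edge_tgt W x3) A ([edge_inv W x3, z, y3] @ B)"
      using hom_move_left[of "edge_tgt W x2" "[x3]" A] xs(1) xy by auto
    have "set (ty [edge_inv W x3, z, y3]) \<subseteq> {a, b}"
      by (rule alternating_confined[OF fp(1), where us = "[]" and vs = B and zs = A, of "edge_tgt W x3"])
        (use hom_sym[OF h1] hom_path[OF h1] px(4) xy z alt_cbc sA in auto)
    with xy J show False by auto
  qed
  then have h': "hom (edge_tgt W x2) (x3 # A) (y3 # B)"
    using hom_cancel_left[of "edge_tgt W x1" "[x2]" "x3 # A" "y3 # B"] h xs(1) xy px by auto
  have e3: "x3 = y3"
  proof (rule ccontr)
    assume "x3 \<noteq> y3"
    then obtain z where z: "fst z = c" "path (edge_tgt W x3) (z # B)" "hom (edge_tgt W x3) (z # B) A"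
      using hom_distinct_first_edges[OF h'] xs(1) xy by auto
    have "set (ty [z]) \<subseteq> {a, b}"
      by (rule alternating_confined[OF fp(1), where us = "[]" and vs = B and zs = A, of "edge_tgt W x3"])
        (use z J alternating_single sA in auto)
    with z J show False by auto
  qed
  then have "hom (edge_tgt W x3) A B"
    using hom_cancel_left[of "edge_tgt W x2" "[x3]" A B] h' xs(1) xy px by auto
  then have "A = B" using alternating_unique[OF px(4), of B] AB alternating_max[OF fp(1)] by (simp add: m)
  with e1 e2 e3 xy show ?thesis by simp
qed

end

subsection \<open>Residues\<close>

lemma panels_residue [simp]:
  "panels (residue J W C) s = full_subgroupoid (residue_chambers J W C) (panels W s)"
  by (simp add: residue_def)

lemma full_subgroupoid_simps [simp]:
  "src (full_subgroupoid V G) = src G" "tgt (full_subgroupoid V G) = tgt G"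
  "gcomp (full_subgroupoid V G) = gcomp G" "gid (full_subgroupoid V G) = gid G"
  "ginv (full_subgroupoid V G) = ginv G" "verts (full_subgroupoid V G) = verts G \<inter> V"
  "edges (full_subgroupoid V G) = {e \<in> edges G. src G e \<in> V \<and> tgt G e \<in> V}"
  by (simp_all add: full_subgroupoid_def)

lemma edge_src_residue [simp]: "edge_src (residue J W C) x = edge_src W x"
  by (simp add: edge_src_def)

lemma edge_tgt_residue [simp]: "edge_tgt (residue J W C) x = edge_tgt W x"
  by (simp add: edge_tgt_def)

lemma terminal_residue [simp]: "terminal (residue J W C) a = terminal W a"
  by (simp add: terminal_def)

lemma chambers_residue [simp]: "chambers (residue J W C) = residue_chambers J W C"
  by (simp add: residue_def)

lemma suites_residue:
  "suites (residue J W C) s t = {\<beta> \<in> suites W s t. gallery_chambers W \<beta> \<subseteq> residue_chambers J W C}"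
  by (simp add: residue_def)

context generalized_chamber_system
begin

lemma edge_path_restrict: "J \<subseteq> S \<Longrightarrow> edge_path J W c xs \<longleftrightarrow> path c xs \<and> set (ty xs) \<subseteq> J"
  by (induction xs arbitrary: c) (auto simp: cs_edge_def)

lemma residue_chambers_iff:
  assumes "J \<subseteq> S"
  shows "D \<in> residue_chambers J W C \<longleftrightarrow> (\<exists>xs. path C xs \<and> set (ty xs) \<subseteq> J \<and> endpt C xs = D)"
proof -
  have "D \<in> residue_chambers J W C \<longleftrightarrow> (\<exists>c xs. edge_path J W c xs \<and> c = C \<and> endpt c xs = D)"
    unfolding residue_chambers_def gallery_def initial_def mem_Collect_eq split_paired_Ex fst_conv snd_conv ..
  also have "\<dots> \<longleftrightarrow> (\<exists>xs. path C xs \<and> set (ty xs) \<subseteq> J \<and> endpt C xs = D)"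
    unfolding edge_path_restrict[OF assms] by blast
  finally show ?thesis .
qed

lemma residue_chambers_subset: "J \<subseteq> S \<Longrightarrow> residue_chambers J W C \<subseteq> chambers W"
  using path_endpt by (auto simp: residue_chambers_iff)

lemma cs_edge_residue:
  assumes "J \<subseteq> S"
  shows "cs_edge J (residue J W C) x \<longleftrightarrow> fst x \<in> J \<and> cs_edge S W x \<and>
    edge_src W x \<in> residue_chambers J W C \<and> edge_tgt W x \<in> residue_chambers J W C"
proof -
  \<comment> \<open>An identity edge determines its vertex as its source, so shrinking the vertex
    set turns no identity edge into a non-identity edge.\<close>
  have "v = src (panels W (fst x)) (snd x)"
    if "fst x \<in> S" "v \<in> verts (panels W (fst x))" "snd x = gid (panels W (fst x)) v" for v
    using groupoid.src_id[OF panel_groupoid[OF that(1)] that(2)] that(3) by simp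
  with assms show ?thesis unfolding cs_edge_def edge_src_def edge_tgt_def by auto
qed

lemma residue_edge_path:
  assumes "J \<subseteq> S" "edge_path J (residue J W C) c xs"
  shows "path c xs" "set (ty xs) \<subseteq> J"
  using assms(2)
proof (induction xs arbitrary: c)
  case Nil
  { case 1 then show ?case using residue_chambers_subset[OF assms(1)] by auto }
  { case 2 then show ?case by simp }
next
  case (Cons x xs)
  { case 1 then show ?case
      using Cons cs_edge_chambers[of x] by (auto simp: cs_edge_residue[OF assms(1)]) }
  { case 2 then show ?case using Cons by (auto simp: cs_edge_residue[OF assms(1)]) }
qed

lemma edge_path_residue:
  assumes "J \<subseteq> S" "c \<in> residue_chambers J W C" "path c xs" "set (ty xs) \<subseteq> J"
  shows "edge_path J (residue J W C) c xs"
  using assms(2-)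
proof (induction xs arbitrary: c)
  case (Cons x xs)
  obtain zs where "path C zs" "set (ty zs) \<subseteq> J" "endpt C zs = c"
    using Cons.prems(1) residue_chambers_iff[OF assms(1)] by blast
  then have "path C (zs @ [x])" "set (ty (zs @ [x])) \<subseteq> J" "endpt C (zs @ [x]) = edge_tgt W x"
    using Cons.prems cs_edge_chambers by (auto simp: path_append)
  then have "edge_tgt W x \<in> residue_chambers J W C" unfolding residue_chambers_iff[OF assms(1)] by blast
  with Cons show ?case by (simp add: cs_edge_residue[OF assms(1)])
qed simp

end

section \<open>Homotopy in a residue against homotopy in the whole graph\<close>

context weyl_data
begin

lemma residue_elementary_homotopy:
  assumes J: "J \<subseteq> S" and h: "elementary_homotopy J M (residue J W C) a b"
  shows "elementary_homotopy S M W a b"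
  using h
proof (induction rule: elementary_homotopy.induct)
  case (cancel c xs s e ys)
  then have "gallery S W (c, xs @ [(s, e), (s, ginv (panels W s) e)] @ ys)"
    using residue_edge_path(1)[OF J] by (simp add: gallery_def)
  from elementary_homotopy.cancel[OF this] show ?case by simp
next
  case (compose c xs s e f ys)
  then have "gallery S W (c, xs @ [(s, e), (s, f)] @ ys)"
    using residue_edge_path(1)[OF J] by (simp add: gallery_def)
  from elementary_homotopy.compose[OF this] compose(2) show ?case by simp
next
  case (suite c xs zs ys s t)
  then show ?case using residue_edge_path(1)[OF J] J
    by (intro elementary_homotopy.suite[of S W c xs zs ys M s t]) (auto simp: gallery_def finite_pair_def suites_residue)
qed

lemma residue_homotopic:
  assumes J: "J \<subseteq> S" and h: "homotopic J M (residue J W C) a b"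
  shows "homotopic S M W a b"
  using h unfolding homotopic_def
proof (induction rule: equivclp_induct)
  case (step y z)
  then have "equivclp (elementary_homotopy S M W) y z" using residue_elementary_homotopy[OF J] by blast
  with step(3) show ?case by (rule equivclp_trans)
qed simp

end

context coxeter_weyl
begin

text \<open>PW1 of the residue gives some \<open>q'\<close> homotopic to \<open>p\<close> there. In
  \<open>W\<close> it is homotopic to \<open>q\<close> and has the same type, so 2W forces
  \<open>q' = q\<close>. Thus a braid move of \<open>W\<close> is a homotopy of the residue,
  although homotopies of \<open>W\<close> in general need not be.\<close>

lemma residue_braid_step_hom:
  assumes J: "J \<subseteq> S" and R: "weyl_graph J M (residue J W C)"
    and step: "gstep c xs ys" and c: "c \<in> residue_chambers J W C" "set (ty xs) \<subseteq> J"
  shows "homotopic J M (residue J W C) (c, xs) (c, ys)"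
  using step c
proof (induction rule: gallery_braid_step.induct)
  case (1 s t us p vs q)
  interpret R: weyl_graph J M "residue J W C" by (rule R)
  have pR: "edge_path J (residue J W C) c (us @ p @ vs)"
    by (rule edge_path_residue[OF J]) (use 1 in auto)
  have stJ: "s \<in> J" "t \<in> J"
    using 1(3,7) set_alt_word[OF finite_pairD(5)[OF 1(1)], of s t] by auto
  then have fp: "finite_pair J M s t" using 1(1) by (simp add: finite_pair_def)
  have "max_st_geodesic J M (residue J W C) s t (endpt c us, p)"
    using pR 1(3) R.path_append by (simp add: max_st_geodesic_def gallery_def gtype_def)
  then obtain \<gamma> where g: "max_st_geodesic J M (residue J W C) t s \<gamma>"
    "homotopic J M (residue J W C) (endpt c us, p) \<gamma>"
    using R.PW1[OF fp] by blast
  then obtain q' where q': "\<gamma> = (endpt c us, q')" using R.homotopic_path[OF g(2)] by (cases \<gamma>) auto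
  have "hom (endpt c us) p q'" using residue_homotopic[OF J] g(2) q' by blast
  then have "hom (endpt c us) q q'" using 1(5) hom_sym hom_trans by blast
  moreover have "path (endpt c us) q" using hom_path[OF 1(5)] 1(2) by (simp add: path_append)
  moreover have "ty q' = ty q"
    using g(1) q' 1(4) finite_pair_sym[OF 1(1)] by (simp add: max_st_geodesic_def gtype_def)
  moreover have "alternating (ty q)"
    using alternating_max[of t s] finite_pair_sym[OF 1(1)] 1(4) by simp
  ultimately have "q = q'" using alternating_unique by metis
  with g(2) q' have "R.hom (endpt c us) p q" by simp
  then show ?case using R.hom_context[of c us p q vs] pR by (simp add: R.path_append)
qed

lemma residue_braided_hom:
  assumes J: "J \<subseteq> S" and R: "weyl_graph J M (residue J W C)"
    and b: "braided c xs ys" and c: "c \<in> residue_chambers J W C" "set (ty xs) \<subseteq> J"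
  shows "homotopic J M (residue J W C) (c, xs) (c, ys)"
  using b
proof (induction rule: rtranclp_induct)
  case base
  then show ?case by (simp add: homotopic_def)
next
  case (step y z)
  have "set (ty y) \<subseteq> J" using braid_set[OF braided_ty[OF step(1)]] c(2) by simp
  then have "homotopic J M (residue J W C) (c, y) (c, z)"
    using residue_braid_step_hom[OF J R step(2) c(1)] by blast
  with step(3) show ?case unfolding homotopic_def by (rule equivclp_trans)
qed

text \<open>Braids become homotopies of the residue, and there property (W) is the length hypothesis
  of \<open>homotopic_same_type_unique\<close> for all reduced words over \<open>J\<close>.\<close>

lemma rigid_residue:
  assumes J: "J \<subseteq> S" and R: "weyl_graph J M (residue J W c)"
    and xs: "path c xs" "set (ty xs) \<subseteq> J" "red (ty xs)" "braided c xs ys" "ty ys = ty xs"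
  shows "xs = ys"
proof -
  interpret R: weyl_graph J M "residue J W c" by (rule R)
  have c: "c \<in> residue_chambers J W c"
    unfolding residue_chambers_iff[OF J] using xs(1) path_chambers by (intro exI[of _ "[]"]) auto
  have G: "reduced J M u" if "reduced J M (u @ [s])" for u s
    using that reduced_prefix by (auto simp: sub_reduced_iff[OF J])
  have len: "cox_elt J M (ty xs) = cox_elt J M (ty ys)"
    if "R.path d xs" "R.path d ys" "reduced J M (ty xs)" "reduced J M (ty ys)" "R.hom d xs ys" for d xs ys
    using R.W[of "(d, xs)" "(d, ys)"] that by (simp add: geodesic_def gallery_def gtype_def W_length_def)
  show ?thesis
  proof (rule R.homotopic_same_type_unique[of "reduced J M" c])
    show "R.path c xs" by (rule edge_path_residue[OF J c xs(1,2)])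
    show "R.hom c xs ys" by (rule residue_braided_hom[OF J R xs(4) c xs(2)])
    show "reduced J M (ty xs)" using xs sub_reduced_iff[OF J] by blast
  qed (use G len xs in blast)+
qed

text \<open>With all three letters as descents the type is a longest word over
  \<open>{r, s, t}\<close>. Lifting braid moves is injective, so in types A1 x I2(m) and A3 rigidity
  of one convenient longest word is enough; in types C3 and H3 the residue handles the given word
  directly.\<close>

lemma rigid_rank_3:
  assumes res: "\<And>J C. J \<subseteq> S \<Longrightarrow> C \<in> chambers W \<Longrightarrow> type_C3 J M \<or> type_H3 J M
      \<Longrightarrow> weyl_graph J M (residue J W C)"
    and J: "r \<in> S" "s \<in> S" "t \<in> S" "distinct [r, s, t]"
    and desc: "\<And>x. x \<in> {r, s, t} \<Longrightarrow> \<not> red (ty xs @ [x])"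
    and xs: "path d xs" "set (ty xs) \<subseteq> {r, s, t}" "red (ty xs)" "braided d xs ys" "ty ys = ty xs"
  shows "xs = ys"
proof -
  obtain a b c where abc: "{a, b, c} = {r, s, t}" "distinct [a, b, c]" "M a c = 2"
    and ty: "M a b = 2 \<or> M a b = 3 \<and> M b c \<in> {3, 4, 5}"
    using longest_word_rank_3[OF J xs(3) desc] by metis
  have S: "a \<in> S" "b \<in> S" "c \<in> S" "{a, b, c} \<subseteq> S" using abc(1) J by auto
  have desc': "\<And>x. x \<in> {a, b, c} \<Longrightarrow> \<not> red (ty xs @ [x])" using desc abc(1) by simp
  have sub: "set (ty xs) \<subseteq> {a, b, c}" using xs(2) abc(1) by simp
  have ph: "path d ys" "hom d xs ys" using braided_path[OF xs(4)] xs(1) braided_hom[OF xs(4)] by auto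
  have transfer: "xs = ys"
    if f: "red f" "set f \<subseteq> {a, b, c}" "\<And>x. x \<in> {a, b, c} \<Longrightarrow> \<not> red (f @ [x])"
      and rigid: "\<And>xs ys. \<lbrakk>path d xs; ty xs = f; ty ys = ty xs; hom d xs ys\<rbrakk> \<Longrightarrow> xs = ys" for f
  proof -
    have "ty xs \<simeq> f" by (rule longest_word_unique[OF S(4) xs(3) sub desc' f])
    then have "braids (ty xs) f" using matsumoto_tits xs(3) f(1) by blast
    then obtain xs' ys' where *: "ty xs' = f" "ty ys' = f" "braided d xs xs'" "braided d ys ys'"
      "xs' = ys' \<longrightarrow> xs = ys"
      using braided_lift2[OF _ xs(1) ph(1) refl xs(5)] by blast
    have "hom d xs' ys'" using braided_hom *(3,4) ph(2) hom_sym hom_trans by blast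
    then have "xs' = ys'" using rigid[of xs' ys'] *(1,2) braided_path[OF *(3)] xs(1) by simp
    with * show ?thesis by blast
  qed
  have coxJ: "coxeter_matrix {a, b, c} M" "card {a, b, c} = 3"
    using sub_coxeter_matrix[OF S(4)] abc(2) by auto
  consider "M a b = 2" | "M a b = 3" "M b c = 3" | "M a b = 3" "M b c = 4" | "M a b = 3" "M b c = 5"
    using ty by blast
  then show ?thesis
  proof cases
    case 1
    \<comment> \<open>The classification does not bound \<open>M b c\<close> in this case; it is
      finite because \<open>b\<close> and \<open>c\<close> are both descents.\<close>
    have bc: "finite_pair S M b c"
      using descents_finite_pair[OF xs(3), of b c] S abc(2) desc' by simp
    have a: "a \<notin> {b, c}" using abc(2) by simp
    have "set (max_word b c) \<subseteq> {b, c}" by (rule set_alt_word_subset)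
    then show ?thesis
      using transfer[of "a # max_word b c"]
        longest_word_A1_I2[OF bc S(1) a 1 abc(3)] rigid_A1_I2[OF bc S(1) a] by auto
  next
    case 2
    show ?thesis
      using transfer[of "[a, b, c, a, b, a]"] longest_word_A3[OF S(1-3) abc(2) 2 abc(3)]
        rigid_A3[OF S(1-3) abc(2) 2 abc(3)] by auto
  next
    case 3
    then have "type_C3 {a, b, c} M" using coxJ abc(3) unfolding type_C3_def by blast
    then have "weyl_graph {a, b, c} M (residue {a, b, c} W d)" using res[OF S(4)] xs(1) path_chambers by blast
    then show ?thesis using rigid_residue[OF S(4)] xs sub by blast
  next
    case 4
    then have "type_H3 {a, b, c} M" using coxJ abc(3) unfolding type_H3_def by blast
    then have "weyl_graph {a, b, c} M (residue {a, b, c} W d)" using res[OF S(4)] xs(1) path_chambers by blast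
    then show ?thesis using rigid_residue[OF S(4)] xs sub by blast
  qed
qed

end

subsection \<open>Braiding back to the same type\<close>

text \<open>Isolates the rank 3 input from the case distinction behind it. It is phrased with
  \<open>braided\<close> and not with homotopy because that is what the hypothesis on residues
  yields.\<close>

locale rigid_weyl = coxeter_weyl S M W
  for S :: "'s set" and M :: "'s \<Rightarrow> 's \<Rightarrow> enat" and W :: "('c, 'e, 's) weyl_data" +
  assumes rigid: "\<lbrakk>r \<in> S; s \<in> S; t \<in> S; distinct [r, s, t];
    \<And>x. x \<in> {r, s, t} \<Longrightarrow> \<not> reduced S M (ty xs @ [x]);
    path d xs; set (ty xs) \<subseteq> {r, s, t}; reduced S M (ty xs); braided d xs ys; ty ys = ty xs\<rbrakk> \<Longrightarrow> xs = ys"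
begin

text \<open>The claim of the induction in \<open>last_rigid_all\<close>. Here \<open>n\<close>
  bounds the length of \<open>xs @ [x]\<close>, not of \<open>xs\<close>; at stage \<open>n\<close>,
  galleries of length \<open>n + 1\<close> are treated by applying it to what precedes their last
  edge.\<close>

definition last_rigid :: "nat \<Rightarrow> bool" where
  "last_rigid n \<longleftrightarrow> (\<forall>c xs x ys y. length xs < n \<longrightarrow> path c (xs @ [x]) \<longrightarrow> red (ty (xs @ [x])) \<longrightarrow>
    braided c (xs @ [x]) (ys @ [y]) \<longrightarrow> fst x = fst y \<longrightarrow> x = y \<and> braided c xs ys)"

definition same_last where
  "same_last c a b \<longleftrightarrow> (\<exists>xs x ys. a = xs @ [x] \<and> b = ys @ [x] \<and> braided c xs ys)"

text \<open>One change of the last type from \<open>s\<close> to \<open>t\<close>, up to braiding in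
  front of the last edge before and after. The words are reversed so that \<open>p\<close> ends in
  \<open>s\<close> and \<open>q\<close> in \<open>t\<close> for either parity of
  \<open>M s t\<close>.\<close>

definition last_switch where
  "last_switch c s t a b \<longleftrightarrow> (\<exists>us p q. finite_pair S M s t \<and> path c (us @ p) \<and>
    ty p = rev (max_word s t) \<and> ty q = rev (opp_word s t) \<and>
    hom (endpt c us) p q \<and> same_last c a (us @ p) \<and> same_last c (us @ q) b)"

text \<open>At most one change of the last type. That this relation is transitive on geodesics,
  shown in \<open>switch_trans\<close>, collapses a whole chain of braid moves into a single
  switch.\<close>

definition switch where
  "switch c a b \<longleftrightarrow> same_last c a b \<or> (\<exists>s t. last_switch c s t a b)"

lemma suffix_rigid:
  assumes "last_rigid n" "length (xs @ p) \<le> n" "path c (xs @ p)" "red (ty (xs @ p))"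
    "braided c (xs @ p) (ys @ q)" "ty p = ty q"
  shows "p = q \<and> braided c xs ys"
  using assms(2-)
proof (induction p arbitrary: q rule: rev_induct)
  case (snoc x p)
  then obtain q' y where q: "q = q' @ [y]" "ty p = ty q'" "fst x = fst y"
    by (cases q rule: rev_cases) auto
  have "x = y \<and> braided c (xs @ p) (ys @ q')"
    using assms(1)[unfolded last_rigid_def, rule_format, of "xs @ p" c x "ys @ q'" y] snoc.prems q by simp
  moreover from this have "p = q' \<and> braided c xs ys"
    using snoc.IH[of q'] snoc.prems q reduced_prefix[of "ty (xs @ p)" "[fst x]"]
      path_append[of c "xs @ p" "[x]"] by simp
  ultimately show ?case using q by simp
qed auto

lemma same_last_refl: "a \<noteq> [] \<Longrightarrow> same_last c a a"
  unfolding same_last_def by (metis rev_exhaust rtranclp.rtrancl_refl)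

lemma same_last_sym: "same_last c a b \<Longrightarrow> same_last c b a"
  unfolding same_last_def using braided_sym by blast

lemma same_last_trans: "same_last c a b \<Longrightarrow> same_last c b d \<Longrightarrow> same_last c a d"
  unfolding same_last_def using braided_trans by force

lemma same_last_braided: "same_last c a b \<Longrightarrow> path c a \<Longrightarrow> braided c a b"
  unfolding same_last_def using braided_right by blast

lemma same_last_ty: "same_last c a b \<Longrightarrow> fst (last a) = fst (last b)"
  unfolding same_last_def by auto

lemma same_last_context:
  "same_last (endpt c us) a b \<Longrightarrow> path c (us @ a) \<Longrightarrow> same_last c (us @ a) (us @ b)"
  unfolding same_last_def
  by (metis append_assoc braided_left path_append)

lemma max_rev_alternating: "finite_pair S M s t \<Longrightarrow> alternating (rev (max_word s t))"
  using alternating_max[of s t] alternating_max[of t s] finite_pair_sym[of s t] by (simp add: rev_alt_word)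

lemma opposite_max_geodesic_rev:
  assumes "finite_pair S M s t" "path c p" "ty p = rev (max_word s t)"
  obtains q where "ty q = rev (opp_word s t)" "hom c p q"
proof (cases "odd (the_enat (M s t))")
  case True
  then obtain q where "ty q = opp_word s t" "hom c p q"
    using opposite_max_geodesic[OF assms(1,2)] assms(3) by (auto simp: rev_alt_word)
  with True that show ?thesis by (simp add: rev_alt_word)
next
  case False
  then obtain q where "ty q = max_word s t" "hom c p q"
    using opposite_max_geodesic[of t s c p] finite_pair_sym[OF assms(1)] assms(2,3)
    by (auto simp: rev_alt_word)
  with False that show ?thesis by (simp add: rev_alt_word)
qed

lemma opposite_rev_braided:
  assumes "finite_pair S M s t" "path c (us @ p)" "ty p = rev (max_word s t)"
    "ty q = rev (opp_word s t)" "hom (endpt c us) p q"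
  shows "gstep c (us @ p) (us @ q)"
proof (cases "odd (the_enat (M s t))")
  case True
  then show ?thesis
    using gallery_braid_step.intros[of S M s t W c us p "[]" q] assms by (simp add: rev_alt_word)
next
  case False
  then show ?thesis
    using gallery_braid_step.intros[of S M t s W c us p "[]" q] assms finite_pair_sym[OF assms(1)]
    by (simp add: rev_alt_word)
qed

lemma rev_alt_word_last:
  assumes "finite_pair S M s t"
  obtains m where "rev (max_word s t) = rev (alt_word m t s) @ [s]"
    "rev (opp_word s t) = rev (alt_word m s t) @ [t]" "the_enat (M s t) = Suc m"
  using finite_pairD(5)[OF assms] by (cases "the_enat (M s t)") auto

lemma last_switch_ty:
  assumes "last_switch c s t a b"
  shows "fst (last a) = s" "fst (last b) = t" "s \<noteq> t"
proof -
  obtain us p q where *: "finite_pair S M s t" "ty p = rev (max_word s t)"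
    "ty q = rev (opp_word s t)" "same_last c a (us @ p)" "same_last c (us @ q) b"
    using assms unfolding last_switch_def by blast
  obtain m where "ty p = rev (alt_word m t s) @ [s]" "ty q = rev (alt_word m s t) @ [t]"
    using rev_alt_word_last[OF *(1)] *(2,3) by metis
  then have "fst (last (us @ p)) = s" "fst (last (us @ q)) = t"
    by (auto simp: map_eq_append_conv)
  then show "fst (last a) = s" "fst (last b) = t" "s \<noteq> t"
    using same_last_ty *(4,5) finite_pairD(3)[OF *(1)] by metis+
qed

lemma last_switch_sym: "last_switch c s t a b \<Longrightarrow> last_switch c t s b a"
proof -
  assume "last_switch c s t a b"
  then obtain us p q where *: "finite_pair S M s t" "path c (us @ p)"
    "ty p = rev (max_word s t)" "ty q = rev (opp_word s t)"
    "hom (endpt c us) p q" "same_last c a (us @ p)" "same_last c (us @ q) b"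
    unfolding last_switch_def by blast
  then have "path c (us @ q)" using hom_path by (auto simp: path_append)
  then show ?thesis unfolding last_switch_def
    using * finite_pair_sym[OF *(1)] hom_sym same_last_sym by (intro exI[of _ us] exI[of _ q] exI[of _ p]) simp
qed

lemma switch_sym: "switch c a b \<Longrightarrow> switch c b a"
  unfolding switch_def using last_switch_sym same_last_sym by blast

lemma switch_same_last_left: "same_last c a b \<Longrightarrow> switch c b d \<Longrightarrow> switch c a d"
  unfolding switch_def last_switch_def using same_last_trans by meson

lemma switch_same_last_right: "switch c a b \<Longrightarrow> same_last c b d \<Longrightarrow> switch c a d"
  using switch_same_last_left switch_sym same_last_sym by blast

lemma same_last_if_switch: "switch c a b \<Longrightarrow> fst (last a) = fst (last b) \<Longrightarrow> same_last c a b"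
  unfolding switch_def using last_switch_ty by metis

lemma switch_braided: "switch c a b \<Longrightarrow> path c a \<Longrightarrow> braided c a b"
proof -
  assume a: "switch c a b" "path c a"
  show ?thesis
  proof (cases "same_last c a b")
    case False
    then obtain s t us p q where *: "finite_pair S M s t" "path c (us @ p)"
      "ty p = rev (max_word s t)" "ty q = rev (opp_word s t)"
      "hom (endpt c us) p q" "same_last c a (us @ p)" "same_last c (us @ q) b"
      using a unfolding switch_def last_switch_def by blast
    have 1: "gstep c (us @ p) (us @ q)" by (rule opposite_rev_braided[OF *(1-5)])
    have "braided c a (us @ p)" using same_last_braided * a by blast
    also have "braided c (us @ p) (us @ q)" using 1 by blast
    also have "braided c (us @ q) b"
      using same_last_braided[OF *(7)] gallery_braid_step_path[OF 1] by blast
    finally show ?thesis .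
  qed (use a same_last_braided in blast)
qed

text \<open>A move away from the end leaves the last edge alone. A move at the end is a
  \<open>last_switch\<close>, from \<open>s\<close> to \<open>t\<close> or from \<open>t\<close> to
  \<open>s\<close> according to the parity of \<open>M s t\<close>.\<close>

lemma switch_gallery_braid_step:
  assumes "gstep c a b"
  shows "switch c a b"
  using assms
proof (induction rule: gallery_braid_step.induct)
  case (1 s t us p vs q)
  note fp = finite_pairD[OF 1(1)]
  have ne: "p \<noteq> []" "q \<noteq> []" using 1(3,4) fp(5) by (metis length_alt_word length_map list.size(3) not_numeral_le_zero)+
  show ?case
  proof (cases vs rule: rev_cases)
    case Nil
    have "last_switch c x y (us @ p) (us @ q)"
      if "finite_pair S M x y" "ty p = rev (max_word x y)"
        "ty q = rev (opp_word x y)" for x y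
      using that 1 Nil ne same_last_refl unfolding last_switch_def
      by (intro exI[of _ us] exI[of _ p] exI[of _ q]) simp
    from this[of s t] this[of t s] show ?thesis
      using 1(1,3,4) finite_pair_sym[OF 1(1)] Nil unfolding switch_def
      by (cases "odd (the_enat (M s t))") (auto simp: rev_alt_word)
  next
    case (snoc vs' x)
    have "path c (us @ p @ vs')" using 1(2) snoc by (simp add: path_append)
    then have "gstep c (us @ p @ vs') (us @ q @ vs')"
      using 1 by (intro gallery_braid_step.intros) auto
    then have "same_last c ((us @ p @ vs') @ [x]) ((us @ q @ vs') @ [x])"
      unfolding same_last_def by blast
    then show ?thesis using snoc by (simp add: switch_def)
  qed
qed

text \<open>Both switches start from galleries that share the last edge with \<open>a\<close> and
  have braided front parts of length \<open>n\<close>. Hence \<open>suffix_rigid\<close> identifies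
  their dihedral segments, and 2W the opposites of these.\<close>

lemma last_switch_functional:
  assumes n: "last_rigid n" and a: "path c a" "red (ty a)" "length a = Suc n"
    and sw: "last_switch c s t a b" "last_switch c s t a b'"
  shows "same_last c b b'"
proof -
  obtain us p q where 1: "finite_pair S M s t" "path c (us @ p)"
    "ty p = rev (max_word s t)" "ty q = rev (opp_word s t)"
    "hom (endpt c us) p q" "same_last c a (us @ p)" "same_last c (us @ q) b"
    using sw(1) unfolding last_switch_def by blast
  obtain us' p' q' where 2: "path c (us' @ p')"
    "ty p' = rev (max_word s t)" "ty q' = rev (opp_word s t)"
    "hom (endpt c us') p' q'" "same_last c a (us' @ p')" "same_last c (us' @ q') b'"
    using sw(2) unfolding last_switch_def by blast
  obtain m where m: "rev (max_word s t) = rev (alt_word m t s) @ [s]"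
    "rev (opp_word s t) = rev (alt_word m s t) @ [t]"
    using rev_alt_word_last[OF 1(1)] by metis
  obtain p0 x p0' x' where p: "p = p0 @ [x]" "p' = p0' @ [x']" "ty p0 = ty p0'"
    using 1(3) 2(2) unfolding m by (auto simp: map_eq_append_conv)
  have "same_last c (us @ p) (us' @ p')" using 1(6) 2(5) same_last_sym same_last_trans by blast
  then have b0: "x = x'" "braided c (us @ p0) (us' @ p0')" unfolding same_last_def p by auto
  have la: "braided c a (us @ p)" using same_last_braided 1(6) a(1) by blast
  have "path c (us @ p0)" "red (ty (us @ p0))" "length (us @ p0) \<le> n"
    using 1(2) braided_reduced[OF la] a(2,3) braided_length[OF la] reduced_prefix[of "ty (us @ p0)" "[fst x]"]
    unfolding p by (simp_all add: path_append)
  then have s: "p0 = p0'" "braided c us us'" using suffix_rigid[OF n _ _ _ b0(2) p(3)] by auto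
  have e: "endpt c us' = endpt c us" using braided_endpt[OF s(2)] .
  have "hom (endpt c us) q q'" using 1(5) 2(4) s(1) b0(1) p e hom_sym hom_trans by metis
  moreover have pq: "path (endpt c us) q" using hom_path[OF 1(5)] 1(2) by (simp add: path_append)
  ultimately have qq: "q = q'"
    using alternating_unique[OF pq, of q'] 1(4) 2(3) max_rev_alternating[of t s] finite_pair_sym[OF 1(1)] by simp
  obtain q0 y where q: "q = q0 @ [y]" using 1(4) unfolding m by (auto simp: map_eq_append_conv)
  have "braided c (us @ q0) (us' @ q0)"
    by (rule braided_right[OF s(2)]) (use 1(2) pq q in \<open>simp add: path_append\<close>)
  then have "same_last c (us @ q) (us' @ q')" unfolding same_last_def qq[symmetric] q by auto
  then show ?thesis using 1(7) 2(6) same_last_trans same_last_sym by blast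
qed

lemma switch_functional:
  assumes "last_rigid n" "path c a" "red (ty a)" "length a = Suc n"
    and sw: "switch c a b" "switch c a b'" "fst (last b) = fst (last b')"
  shows "same_last c b b'"
proof (cases "same_last c a b \<or> same_last c a b'")
  case True
  then show ?thesis
  proof
    assume h: "same_last c a b"
    then have "same_last c a b'" using same_last_if_switch[OF sw(2)] same_last_ty[OF h] sw(3) by simp
    then show ?thesis using h same_last_sym same_last_trans by blast
  next
    assume h: "same_last c a b'"
    then have "same_last c a b" using same_last_if_switch[OF sw(1)] same_last_ty[OF h] sw(3) by simp
    then show ?thesis using h same_last_sym same_last_trans by blast
  qed
next
  case False
  then obtain s t s' t' where l: "last_switch c s t a b" "last_switch c s' t' a b'"
    using sw unfolding switch_def by blast
  then have "s' = s" "t' = t" using last_switch_ty sw(3) by metis+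
  then show ?thesis using last_switch_functional[OF assms(1-4)] l by blast
qed

text \<open>Since \<open>y\<close> and the type of \<open>e\<close> are both descents, the word can
  be made to end in a longest word in these two letters. Only the part \<open>xs\<close> is braided
  for this, so that \<open>e\<close> stays the last edge and the change counts as one switch. The
  prefix \<open>us\<close> is untouched, which keeps the change inside a residue.\<close>

lemma switch_to_descent:
  assumes p: "path c (us @ xs @ [e])" "red (ty (xs @ [e]))" and y: "y \<in> S" "y \<noteq> fst e"
    "\<not> red (ty (xs @ [e]) @ [y])"
  obtains zs z where "switch c (us @ xs @ [e]) (us @ zs @ [z])" "braided (endpt c us) (xs @ [e]) (zs @ [z])" "fst z = y"
proof -
  let ?x = "fst e" and ?d = "endpt c us"
  have px: "path ?d (xs @ [e])" "path c us" using p by (auto simp: path_append)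
  have xS: "?x \<in> S" using path_ty[OF px(1)] by simp
  have dx: "\<not> red (ty (xs @ [e]) @ [?x])" using not_reduced_square[of "ty xs" ?x "[]"] by simp
  have fp: "finite_pair S M ?x y" using descents_finite_pair[OF p(2) xS y(1) _ dx y(3)] y(2) by auto
  define m where "m = the_enat (M ?x y)"
  obtain k where k: "rev (alt_word m ?x y) = rev (alt_word k y ?x) @ [?x]"
    "rev (alt_word m y ?x) = rev (alt_word k ?x y) @ [y]"
    using rev_alt_word_last[OF fp] m_def by metis
  have "red (rev (alt_word m ?x y))" unfolding reduced_rev m_def using reduced_max_alt_word[OF fp] .
  moreover have "set (rev (alt_word m ?x y)) \<subseteq> {?x, y}" using set_alt_word_subset[of m] by simp
  moreover have "\<And>s. s \<in> {?x, y} \<Longrightarrow> \<not> red (ty (xs @ [e]) @ [s])" using dx y(3) by auto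
  moreover have "{?x, y} \<subseteq> S" using xS y(1) by simp
  ultimately obtain g where g: "red (g @ rev (alt_word m ?x y))" "g @ rev (alt_word m ?x y) \<simeq> ty (xs @ [e])"
    using descents_suffix[OF p(2), of "{?x, y}"] by blast
  have "ty xs @ [?x] \<simeq> (g @ rev (alt_word k y ?x)) @ [?x]" using g(2) k(1) word_eq_sym by simp
  then have "ty xs \<simeq> g @ rev (alt_word k y ?x)" using word_eq_cancel_right[of "[?x]"] xS by simp
  moreover have "red (g @ rev (alt_word k y ?x))" using g(1) unfolding k by (metis append_assoc reduced_prefix)
  moreover have "red (ty xs)" using p(2) reduced_prefix by simp
  ultimately obtain xs' where xs': "ty xs' = g @ rev (alt_word k y ?x)" "braided ?d xs xs'"
    using braided_lift[of ?d xs] px(1) by (auto simp: path_append)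
  then obtain vs p0 where vp: "xs' = vs @ p0" "ty vs = g" "ty p0 = rev (alt_word k y ?x)"
    by (auto simp: map_eq_append_conv)
  have b1: "braided ?d (xs @ [e]) (vs @ p0 @ [e])"
    using braided_right[OF xs'(2) px(1)] vp(1) by simp
  have pv: "path ?d (vs @ p0 @ [e])" using braided_path[OF b1] px(1) by blast
  have tp: "ty (p0 @ [e]) = rev (alt_word m ?x y)" using vp(3) k(1) by simp
  obtain q where q: "ty q = rev (alt_word m y ?x)" "hom (endpt ?d vs) (p0 @ [e]) q"
    using opposite_max_geodesic_rev[OF fp, of "endpt ?d vs" "p0 @ [e]"] pv tp m_def by (auto simp: path_append)
  obtain q0 z where qz: "q = q0 @ [z]" "fst z = y" using q(1) unfolding k by (auto simp: map_eq_append_conv)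
  have b2: "braided ?d (vs @ p0 @ [e]) (vs @ q)"
    using opposite_rev_braided[OF fp pv] tp q m_def by blast
  have sl: "same_last c (us @ xs @ [e]) (us @ vs @ p0 @ [e])"
    using same_last_context[of c us "xs @ [e]" "xs' @ [e]"] p(1) xs'(2) vp(1)
    unfolding same_last_def by auto
  have p2: "path c ((us @ vs) @ p0 @ [e])" using pv px by (simp add: path_append)
  have "last_switch c ?x y (us @ xs @ [e]) (us @ vs @ q)"
    unfolding last_switch_def
    using fp p2 tp q sl same_last_refl[of "us @ vs @ q" c] qz m_def
    by (intro exI[of _ "us @ vs"] exI[of _ "p0 @ [e]"] exI[of _ q]) simp
  then have "switch c (us @ xs @ [e]) (us @ (vs @ q0) @ [z])" unfolding switch_def using qz by auto
  moreover have "braided ?d (xs @ [e]) ((vs @ q0) @ [z])" using b1 b2 qz braided_trans by simp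
  ultimately show ?thesis using that qz(2) by blast
qed

text \<open>The three last types are descents of one element, which factors as \<open>g @ h\<close>
  with \<open>h\<close> a longest word over them. Behind a prefix \<open>us\<close> of type
  \<open>g\<close>, switches from \<open>s\<close> to \<open>t\<close> to \<open>r\<close> to
  \<open>s\<close> are performed anew, starting from the last edge of \<open>a\<close>. The
  assumption \<open>rigid\<close> closes this circuit and \<open>switch_functional\<close>
  identifies its stations with \<open>b\<close> and \<open>d\<close>; its last switch, read
  backwards, leads from \<open>a\<close> to \<open>d\<close>.\<close>

lemma switch_triangle:
  assumes n: "last_rigid n" and a: "path c a" "red (ty a)" "length a = Suc n"
    and sw: "switch c a b" "switch c b d"
    and dist: "distinct [fst (last d), fst (last a), fst (last b)]"
  shows "switch c a d"
proof -
  define r s t where "r = fst (last d)" and "s = fst (last a)" and "t = fst (last b)"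
  let ?J = "{r, s, t}"
  have ab: "braided c a b" using switch_braided[OF sw(1) a(1)] .
  then have b: "path c b" "red (ty b)" "length b = Suc n"
    using braided_path braided_reduced braided_length a by metis+
  have bd: "braided c b d" using switch_braided[OF sw(2) b(1)] .
  then have d: "path c d" "red (ty d)" "length d = Suc n"
    using braided_path braided_reduced braided_length b by metis+
  have last_S: "fst (last z) \<in> S" "\<not> red (ty a @ [fst (last z)])"
    if z: "path c z" "red (ty z)" "length z = Suc n" "braided c a z" for z
  proof -
    obtain z0 e where ze: "z = z0 @ [e]" using z(3) by (cases z rule: rev_cases) auto
    then show "fst (last z) \<in> S" using path_ty[OF z(1)] by simp
    show "\<not> red (ty a @ [fst (last z)])"
      using descent_if_word_eq_snoc[OF a(2), of "ty z0" "fst e"] z(2) braided_word_eq[OF z(4)] ze by simp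
  qed
  have S: "r \<in> S" "s \<in> S" "t \<in> S" and desc: "\<And>x. x \<in> ?J \<Longrightarrow> \<not> red (ty a @ [x])"
    using last_S[OF d] last_S[OF a] last_S[OF b] ab bd braided_trans[OF ab bd]
    unfolding r_def s_def t_def by auto
  have JS: "?J \<subseteq> S" and dist': "distinct [r, s, t]" using S dist unfolding r_def s_def t_def by auto
  obtain g h where gh: "ty a \<simeq> g @ h" "set h \<subseteq> ?J" "red h" "\<And>k. red k \<Longrightarrow> set k \<subseteq> ?J \<Longrightarrow> red (g @ k)"
    using parabolic_decomposition[OF reduced_subset[OF a(2)] JS] by metis
  have rgh: "red (g @ h)" using gh by blast
  have desc_h: "\<not> red (h @ [x])" if "x \<in> ?J" for x
  proof
    assume "red (h @ [x])"
    then have "red (g @ h @ [x])" using gh(2) that by (intro gh(4)) auto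
    moreover have "(g @ h) @ [x] \<simeq> ty a @ [x]"
      by (rule word_eq_append) (use gh(1) word_eq_sym in auto)
    ultimately have "red (ty a @ [x])"
      using reduced_if_word_eq[of "g @ h @ [x]" "ty a @ [x]"] reduced_length_eq[OF a(2) rgh gh(1)]
        reduced_subset[OF a(2)] that JS by auto
    then show False using desc that by blast
  qed
  obtain h0 where h0: "red (h0 @ [s])" "h0 @ [s] \<simeq> h"
    by (rule shorter_if_not_reduced_snoc[OF gh(3) S(2)]) (use desc_h in auto)
  have sh0: "set (h0 @ [s]) \<subseteq> ?J" using reduced_set_eq[OF h0(1) gh(3) h0(2)] gh(2) by simp
  have rg0: "red (g @ h0 @ [s])" using gh(4) h0(1) sh0 by blast
  obtain a0 e where ae: "a = a0 @ [e]" "fst e = s" using a(3) s_def by (cases a rule: rev_cases) auto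
  have "ty a0 @ [s] \<simeq> (g @ h0) @ [s]"
    using word_eq_append[OF equivclp_refl h0(2), of g] gh(1) ae word_eq_sym by simp (meson word_eq_trans)
  then have "ty a0 \<simeq> g @ h0" using word_eq_cancel_right[of "[s]"] S by simp
  then obtain a1 where a1: "ty a1 = g @ h0" "braided c a0 a1"
    using braided_lift[of c a0 "g @ h0"] a ae rg0 reduced_prefix by (auto simp: path_append)
  then obtain us ks where uk: "a1 = us @ ks" "ty us = g" "ty ks = h0" by (auto simp: map_eq_append_conv)
  have sl0: "same_last c a (us @ ks @ [e])" unfolding same_last_def using ae a1 uk by auto
  have p0: "path c (us @ ks @ [e])" using braided_path[OF same_last_braided[OF sl0 a(1)]] a(1) by blast
  let ?d = "endpt c us"
  have word: "red (ty zs)" "set (ty zs) \<subseteq> ?J" "\<And>x. x \<in> ?J \<Longrightarrow> \<not> red (ty zs @ [x])" "path ?d zs" "path c (us @ zs)"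
    if "braided ?d (ks @ [e]) zs" for zs
  proof -
    have t: "ty (ks @ [e]) = h0 @ [s]" using uk ae by simp
    show r: "red (ty zs)" using braided_reduced[OF that] h0(1) unfolding t by blast
    show "set (ty zs) \<subseteq> ?J" using braid_set[OF braided_ty[OF that]] sh0 unfolding t by simp
    show p: "path ?d zs" using braided_path[OF that] p0 by (simp add: path_append)
    then show "path c (us @ zs)" using p0 by (simp add: path_append)
    show "\<not> red (ty zs @ [x])" if "x \<in> ?J" for x
    proof
      assume rx: "red (ty zs @ [x])"
      have "ty zs \<simeq> h0 @ [s]" using braided_word_eq[OF \<open>braided ?d (ks @ [e]) zs\<close>] word_eq_sym unfolding t by blast
      also note h0(2)
      finally have zh: "ty zs \<simeq> h" .
      then have "ty zs @ [x] \<simeq> h @ [x]" by (rule word_eq_append) simp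
      have "set (h @ [x]) \<subseteq> S" using gh(2) JS \<open>x \<in> ?J\<close> by auto
      then have "red (h @ [x])"
        using reduced_if_word_eq[OF rx \<open>ty zs @ [x] \<simeq> h @ [x]\<close>] reduced_length_eq[OF r gh(3) zh] by simp
      then show False using desc_h \<open>x \<in> ?J\<close> by blast
    qed
  qed
  note w0 = word[OF rtranclp.rtrancl_refl]
  obtain k1 e1 where k1: "switch c (us @ ks @ [e]) (us @ k1 @ [e1])" "braided ?d (ks @ [e]) (k1 @ [e1])" "fst e1 = t"
    by (rule switch_to_descent[OF p0 w0(1) S(3)]) (use w0(3) ae dist' in auto)
  note w1 = word[OF k1(2)]
  obtain k2 e2 where k2: "switch c (us @ k1 @ [e1]) (us @ k2 @ [e2])" "braided ?d (k1 @ [e1]) (k2 @ [e2])" "fst e2 = r"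
    by (rule switch_to_descent[OF w1(5,1) S(1)]) (use w1(3) k1 dist' in auto)
  have b2: "braided ?d (ks @ [e]) (k2 @ [e2])" using k1(2) k2(2) braided_trans by blast
  note w2 = word[OF b2]
  obtain k3 e3 where k3: "switch c (us @ k2 @ [e2]) (us @ k3 @ [e3])" "braided ?d (k2 @ [e2]) (k3 @ [e3])" "fst e3 = s"
    by (rule switch_to_descent[OF w2(5,1) S(2)]) (use w2(3) k2 dist' in auto)
  have b3: "braided ?d (ks @ [e]) (k3 @ [e3])" using b2 k3(2) braided_trans by blast
  note w3 = word[OF b3]
  have "ty k3 @ [s] \<simeq> ty ks @ [s]" using braided_word_eq[OF b3] k3(3) ae word_eq_sym by simp
  then have "ty k3 \<simeq> ty ks" using word_eq_cancel_right[of "[s]"] S by simp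
  \<comment> \<open>The circuit is back at last type \<open>s\<close>, but possibly with another
    word in front. Braiding this word back to \<open>ty ks\<close> gives two galleries of the same
    type, as \<open>rigid\<close> requires.\<close>
  then obtain k4 where k4: "ty k4 = ty ks" "braided ?d k3 k4"
    using braided_lift[of ?d k3 "ty ks"] w3(1,4) w0(1) reduced_prefix by (auto simp: path_append)
  have b4: "braided ?d (k3 @ [e3]) (k4 @ [e3])" by (rule braided_right[OF k4(2) w3(4)])
  have "ks @ [e] = k4 @ [e3]"
    by (rule rigid[OF S dist' w0(3,4,2,1)]) (use braided_trans[OF b3 b4] k4 k3 ae in auto)
  then have sl3: "same_last c (us @ k3 @ [e3]) (us @ ks @ [e])"
    using same_last_context[of c us "k3 @ [e3]" "ks @ [e]"] k4(2) w3(5) unfolding same_last_def by auto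
  have s1: "switch c a (us @ k1 @ [e1])" using switch_same_last_left[OF sl0 k1(1)] .
  have "same_last c b (us @ k1 @ [e1])"
    by (rule switch_functional[OF n a sw(1) s1]) (use k1(3) t_def in simp)
  then have s2: "switch c b (us @ k2 @ [e2])" using k2(1) switch_same_last_left by blast
  have sld: "same_last c d (us @ k2 @ [e2])"
    by (rule switch_functional[OF n b sw(2) s2]) (use k2(3) r_def in simp)
  have "switch c (us @ k2 @ [e2]) (us @ ks @ [e])" using k3(1) sl3 switch_same_last_right by blast
  then have "switch c d (us @ ks @ [e])" using sld switch_same_last_left by blast
  then show ?thesis using switch_sym switch_same_last_left[OF sl0] by blast
qed

text \<open>If two of the three last types coincide, \<open>same_last_if_switch\<close> or
  \<open>switch_functional\<close> removes the detour; three distinct types are the case of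
  \<open>switch_triangle\<close>.\<close>

lemma switch_trans:
  assumes n: "last_rigid n" and a: "path c a" "red (ty a)" "length a = Suc n"
    and sw: "switch c a b" "switch c b d"
  shows "switch c a d"
proof -
  have ab: "braided c a b" using switch_braided[OF sw(1) a(1)] .
  then have b: "path c b" "red (ty b)" "length b = Suc n"
    using braided_path braided_reduced braided_length a by metis+
  consider "fst (last a) = fst (last b)" | "fst (last b) = fst (last d)" | "fst (last a) = fst (last d)"
    | "fst (last a) \<noteq> fst (last b)" "fst (last b) \<noteq> fst (last d)" "fst (last a) \<noteq> fst (last d)" by blast
  then show ?thesis
  proof cases
    case 1
    then show ?thesis using same_last_if_switch[OF sw(1)] sw(2) switch_same_last_left by blast
  next
    case 2
    then show ?thesis using same_last_if_switch[OF sw(2)] sw(1) switch_same_last_right by blast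
  next
    case 3
    then show ?thesis using switch_functional[OF n b switch_sym[OF sw(1)] sw(2)] switch_def by blast
  next
    case 4
    then show ?thesis using switch_triangle[OF n a sw] by simp
  qed
qed

text \<open>By \<open>switch_trans\<close> a chain of braid moves is one switch, and a switch
  between galleries with the same last type leaves the last edge alone.\<close>

lemma last_rigid_all: "last_rigid n"
proof (induction n)
  case 0
  then show ?case by (simp add: last_rigid_def)
next
  case (Suc n)
  have "x = y \<and> braided c xs ys"
    if *: "length xs < Suc n" "path c (xs @ [x])" "red (ty (xs @ [x]))" "braided c (xs @ [x]) (ys @ [y])" "fst x = fst y"
    for c xs x ys y
  proof (cases "length xs < n")
    case True
    then show ?thesis using Suc * unfolding last_rigid_def by blast
  next
    case False
    then have len: "length (xs @ [x]) = Suc n" using *(1) by simp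
    from *(4) have "switch c (xs @ [x]) (ys @ [y])"
    proof (induction rule: rtranclp_induct)
      case base
      then show ?case using same_last_refl unfolding switch_def by blast
    next
      case (step b d)
      then show ?case using switch_trans[OF Suc *(2,3) len] switch_gallery_braid_step by blast
    qed
    then have "same_last c (xs @ [x]) (ys @ [y])" using same_last_if_switch *(5) by simp
    then show ?thesis unfolding same_last_def by auto
  qed
  then show ?case unfolding last_rigid_def by blast
qed

lemma braided_last:
  assumes "path c (xs @ [x])" "red (ty (xs @ [x]))" "braided c (xs @ [x]) (ys @ [y])" "fst x = fst y"
  shows "x = y" "braided c xs ys"
  using last_rigid_all[of "Suc (length xs)"] assms unfolding last_rigid_def by blast+

end

subsection \<open>Edges acting on braid classes\<close>

context weyl_data
begin

lemma suite_hom: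
  assumes "finite_pair S M s t" "(c, zs) \<in> weyl_data.suites W s t"
  shows "hom c zs []"
proof -
  have "st_cycle S M W s t (c, zs)" by (rule suites[OF assms])
  then have "gallery S W (c, [] @ zs @ [])" by (simp add: st_cycle_def is_cycle_def)
  from elementary_homotopy.suite[OF this assms(1)] assms(2) show ?thesis
    by (auto simp: homotopic_def)
qed

end

context rigid_weyl
begin

definition braid_class :: "'c \<Rightarrow> ('s \<times> 'e) list \<Rightarrow> ('s \<times> 'e) list set" where
  "braid_class c xs = {ys. braided c xs ys}"

text \<open>The action of an edge \<open>x\<close> on braid classes of geodesics starting at \<open>c\<close> and ending at the
  initial chamber of \<open>x\<close>.\<close>

definition act :: "'c \<Rightarrow> 's \<times> 'e \<Rightarrow> ('s \<times> 'e) list set \<Rightarrow> ('s \<times> 'e) list set" where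
  "act c x K = {ys. \<exists>xs\<in>K. red (ty (xs @ [x])) \<and> braided c (xs @ [x]) ys \<or>
    (\<exists>zs e. braided c xs (zs @ [e]) \<and> fst e = fst x \<and>
      (if x = edge_inv W e then braided c zs ys else braided c (zs @ [edge_comp W e x]) ys))}"

lemma in_act_iff: "ys \<in> act c x (braid_class c as) \<longleftrightarrow> (\<exists>xs. braided c as xs \<and>
    (red (ty (xs @ [x])) \<and> braided c (xs @ [x]) ys \<or> (\<exists>zs e. braided c xs (zs @ [e]) \<and> fst e = fst x \<and>
      (if x = edge_inv W e then braided c zs ys else braided c (zs @ [edge_comp W e x]) ys))))"
  unfolding act_def braid_class_def by simp

lemma braid_class_eq: "braided c xs ys \<Longrightarrow> braid_class c xs = braid_class c ys"
  unfolding braid_class_def using braided_trans braided_sym by blast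

lemma braid_class_eqD: "braid_class c xs = braid_class c ys \<Longrightarrow> braided c xs ys"
  unfolding braid_class_def by auto

lemma not_reduced_if_braided_last:
  assumes "red (ty (zs @ [e]))" "braided c xs (zs @ [e])"
  shows "\<not> red (ty xs @ [fst e])"
  using descent_if_word_eq_snoc[of "ty xs" "ty zs" "fst e"] assms braided_reduced[OF assms(2)]
    braided_word_eq[OF assms(2)] by simp

lemma act_up:
  assumes p: "path c (zs @ [x])" and r: "red (ty (zs @ [x]))"
  shows "act c x (braid_class c zs) = braid_class c (zs @ [x])"
proof -
  have b: "braided c (zs @ [x]) (xs @ [x])" "red (ty (xs @ [x]))" if "braided c zs xs" for xs
  proof -
    show b: "braided c (zs @ [x]) (xs @ [x])" by (rule braided_right[OF that p])
    show "red (ty (xs @ [x]))" using braided_reduced[OF b] r by blast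
  qed
  have "\<not> braided c xs (ws @ [e])" if "braided c zs xs" "fst e = fst x" for xs ws e
  proof
    assume h: "braided c xs (ws @ [e])"
    have "red (ty (ws @ [e]))"
      using braided_reduced[OF h] b(2)[OF that(1)] reduced_prefix[of "ty xs" "[fst x]"] by simp
    then show False using not_reduced_if_braided_last[OF _ h] b(2)[OF that(1)] that(2) by simp
  qed
  then have "ys \<in> act c x (braid_class c zs) \<longleftrightarrow> (\<exists>xs. braided c zs xs \<and> braided c (xs @ [x]) ys)" for ys
    unfolding in_act_iff using b(2) by blast
  also have "\<dots> ys \<longleftrightarrow> braided c (zs @ [x]) ys" for ys
    using b(1) braided_trans by blast
  finally show ?thesis unfolding braid_class_def by blast
qed

text \<open>\<open>act\<close> ranges over all ways to end a representative in an edge of the type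
  of \<open>x\<close>. By \<open>braided_last\<close> they share the edge \<open>e\<close> and the
  class of \<open>zs\<close>, so the result is a single braid class.\<close>

lemma act_down:
  assumes p: "path c (zs @ [e, x])" and r: "red (ty (zs @ [e]))" and x: "fst x = fst e"
  shows "act c x (braid_class c (zs @ [e])) =
    braid_class c (if x = edge_inv W e then zs else zs @ [edge_comp W e x])" (is "?L = ?R")
proof (intro equalityI subsetI)
  have p1: "path c (zs @ [e])" using p by (auto simp: path_append dest: cs_edge_chambers)
  have p2: "x \<noteq> edge_inv W e \<Longrightarrow> path c (zs @ [edge_comp W e x])"
    using hom_last_comp[OF p x] hom_path p by blast
  fix ys
  {
    assume "ys \<in> ?L"
    then obtain xs where xs: "braided c (zs @ [e]) xs" and
      d: "red (ty (xs @ [x])) \<and> braided c (xs @ [x]) ys \<or>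
        (\<exists>ws f. braided c xs (ws @ [f]) \<and> fst f = fst x \<and>
          (if x = edge_inv W f then braided c ws ys else braided c (ws @ [edge_comp W f x]) ys))"
      unfolding in_act_iff by (elim exE conjE) (rule that)
    have n: "\<not> red (ty (xs @ [x]))"
      using not_reduced_if_braided_last[OF r braided_sym[OF xs]] x by simp
    have "\<exists>ws f. braided c xs (ws @ [f]) \<and> fst f = fst x \<and>
          (if x = edge_inv W f then braided c ws ys else braided c (ws @ [edge_comp W f x]) ys)"
      by (rule disjE[OF d], erule conjE, erule notE[OF n], assumption)
    then obtain ws f where f: "braided c xs (ws @ [f])" "fst f = fst x"
      "if x = edge_inv W f then braided c ws ys else braided c (ws @ [edge_comp W f x]) ys"
      by (elim exE conjE) (rule that)
    have "fst e = fst f" using f(2) x by simp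
    then have fe: "e = f" "braided c zs ws"
      by (rule braided_last[OF p1 r braided_trans[OF xs f(1)]])+
    show "ys \<in> ?R"
    proof (cases "x = edge_inv W e")
      case True
      with f(3) fe(1) have "braided c ws ys" by simp
      then show ?thesis using True braided_trans[OF fe(2)] by (simp add: braid_class_def)
    next
      case False
      have "braided c (zs @ [edge_comp W e x]) (ws @ [edge_comp W e x])"
        by (rule braided_right[OF fe(2) p2[OF False]])
      moreover have "braided c (ws @ [edge_comp W e x]) ys" using f(3) fe(1) False by simp
      ultimately have "braided c (zs @ [edge_comp W e x]) ys" by (rule braided_trans)
      then show ?thesis using False by (simp add: braid_class_def)
    qed
  next
    assume "ys \<in> ?R"
    then show "ys \<in> ?L"
      unfolding in_act_iff using x
      by (intro exI[of _ "zs @ [e]"] conjI disjI2 exI[of _ zs] exI[of _ e])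
        (auto simp: braid_class_def)
  }
qed

text \<open>Coordinates for the action of edges of type \<open>s\<close>: \<open>g\<close> is an
  edge of the panel groupoid at the end of \<open>zs\<close>, and identities, which are not edges of
  the graph, stand for \<open>zs\<close> itself.\<close>

definition panel_class :: "'c \<Rightarrow> ('s \<times> 'e) list \<Rightarrow> 's \<Rightarrow> 'e \<Rightarrow> ('s \<times> 'e) list set" where
  "panel_class c zs s g = braid_class c (if g \<in> gid (panels W s) ` chambers W then zs else zs @ [(s, g)])"

definition panel_state :: "'c \<Rightarrow> ('s \<times> 'e) list \<Rightarrow> 's \<Rightarrow> 'e \<Rightarrow> bool" where
  "panel_state c zs s g \<longleftrightarrow> s \<in> S \<and> path c zs \<and> red (ty zs @ [s]) \<and> g \<in> edges (panels W s) \<and>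
    src (panels W s) g = endpt c zs"

text \<open>In these coordinates an edge acts by composition in the panel groupoid. An identity
  \<open>g\<close> is the case in which the gallery is lengthened, and composing with the inverse
  leads back to an identity.\<close>

lemma act_panel_class:
  assumes st: "panel_state c zs s g" and f: "cs_edge S W (s, f)" "src (panels W s) f = tgt (panels W s) g"
  shows "act c (s, f) (panel_class c zs s g) = panel_class c zs s (gcomp (panels W s) g f)"
    "panel_state c zs s (gcomp (panels W s) g f)"
    "tgt (panels W s) (gcomp (panels W s) g f) = tgt (panels W s) f"
proof -
  have a: "s \<in> S" "path c zs" "red (ty zs @ [s])" "g \<in> edges (panels W s)" "src (panels W s) g = endpt c zs"
    using st by (auto simp: panel_state_def)
  interpret P: groupoid "panels W s" by (rule panel_groupoid[OF a(1)])
  have v: "verts (panels W s) = chambers W" by (rule verts_panel[OF a(1)])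
  have fe: "f \<in> edges (panels W s)" "f \<notin> gid (panels W s) ` chambers W"
    using f(1) v by (auto simp: cs_edge_def)
  show "panel_state c zs s (gcomp (panels W s) g f)"
    "tgt (panels W s) (gcomp (panels W s) g f) = tgt (panels W s) f"
    using a f(2) fe P.comp_in P.src_comp P.tgt_comp by (simp_all add: panel_state_def)
  show "act c (s, f) (panel_class c zs s g) = panel_class c zs s (gcomp (panels W s) g f)"
  proof (cases "g \<in> gid (panels W s) ` chambers W")
    case True
    then obtain w where w: "g = gid (panels W s) w" "w \<in> chambers W" by blast
    then have sw: "src (panels W s) f = w" "endpt c zs = w" using f(2) a(5) P.src_id P.tgt_id v by auto
    then have gf: "gcomp (panels W s) g f = f" using P.id_left[OF fe(1)] w by simp
    have "path c (zs @ [(s, f)])" using a(2) f sw cs_edge_chambers[OF f(1)] by (simp add: path_append edge_src_def)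
    with True gf fe a(3) show ?thesis using act_up[of c zs "(s, f)"] by (simp add: panel_class_def)
  next
    case False
    then have e: "cs_edge S W (s, g)" using a v by (simp add: cs_edge_def)
    have p: "path c (zs @ [(s, g), (s, f)])"
      using a e f cs_edge_chambers[OF f(1)] cs_edge_chambers[OF e]
      by (simp add: path_append edge_src_def edge_tgt_def)
    note d = act_down[OF p]
    show ?thesis
    proof (cases "f = ginv (panels W s) g")
      case True
      then have "gcomp (panels W s) g f = gid (panels W s) (src (panels W s) g)" using P.inv_right[OF a(4)] by simp
      moreover have "src (panels W s) g \<in> chambers W" using P.src_in[OF a(4)] v by simp
      ultimately show ?thesis using d True False a(3) by (simp add: panel_class_def edge_inv_def)
    next
      case ne: False
      have "cs_edge S W (edge_comp W (s, g) (s, f))"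
        by (rule cs_edge_comp[OF e f(1)]) (use f ne in \<open>simp_all add: edge_inv_def edge_tgt_def edge_src_def\<close>)
      then have "gcomp (panels W s) g f \<notin> gid (panels W s) ` chambers W"
        using v by (simp add: cs_edge_def edge_comp_def)
      then show ?thesis using d ne False a(3) by (simp add: panel_class_def edge_inv_def edge_comp_def)
    qed
  qed
qed

text \<open>If \<open>s\<close> is no descent, \<open>xs\<close> itself with an identity will do;
  otherwise \<open>xs\<close> is braided to end in an edge of type \<open>s\<close>, which is split
  off.\<close>

lemma panel_class_cover:
  assumes p: "path c xs" "red (ty xs)" and s: "s \<in> S"
  obtains zs g where "panel_state c zs s g" "tgt (panels W s) g = endpt c xs"
    "braid_class c xs = panel_class c zs s g"
proof -
  interpret P: groupoid "panels W s" by (rule panel_groupoid[OF s])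
  have v: "verts (panels W s) = chambers W" by (rule verts_panel[OF s])
  show ?thesis
  proof (cases "red (ty xs @ [s])")
    case True
    have "endpt c xs \<in> verts (panels W s)" using path_endpt[OF p(1)] v by simp
    with True show ?thesis
      using that[of xs "gid (panels W s) (endpt c xs)"] p s v P.id_in P.src_id P.tgt_id
      by (simp add: panel_state_def panel_class_def)
  next
    case False
    obtain zs e where ze: "braided c xs (zs @ [e])" "fst e = s"
      by (rule descent_last_edge[OF p s False])
    have pe: "path c (zs @ [e])" using braided_path[OF ze(1)] p(1) by blast
    have r: "red (ty (zs @ [e]))" using braided_reduced[OF ze(1)] p(2) by blast
    have e: "e = (s, snd e)" "cs_edge S W e" "edge_src W e = endpt c zs" "path c zs"
      using pe ze(2) by (auto simp: path_append prod_eq_iff)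
    have "snd e \<in> edges (panels W s)" "snd e \<notin> gid (panels W s) ` chambers W"
      using e(2) ze(2) v by (auto simp: cs_edge_def)
    moreover have "tgt (panels W s) (snd e) = endpt c xs"
      using braided_endpt[OF ze(1)] ze(2) by (simp add: edge_tgt_def)
    moreover have "src (panels W s) (snd e) = endpt c zs" using e(3) ze(2) by (simp add: edge_src_def)
    ultimately show ?thesis
      using that[of zs "snd e"] s e(1,4) r ze(2) braid_class_eq[OF ze(1)]
      by (simp add: panel_state_def panel_class_def)
  qed
qed

lemma panel_class_geodesic:
  assumes st: "panel_state c zs s g"
  obtains xs where "path c xs" "red (ty xs)" "endpt c xs = tgt (panels W s) g"
    "panel_class c zs s g = braid_class c xs"
proof -
  have a: "s \<in> S" "path c zs" "red (ty zs @ [s])" "g \<in> edges (panels W s)" "src (panels W s) g = endpt c zs"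
    using st by (auto simp: panel_state_def)
  interpret P: groupoid "panels W s" by (rule panel_groupoid[OF a(1)])
  have v: "verts (panels W s) = chambers W" by (rule verts_panel[OF a(1)])
  show ?thesis
  proof (cases "g \<in> gid (panels W s) ` chambers W")
    case True
    then have "endpt c zs = tgt (panels W s) g" using a(5) P.src_id P.tgt_id v by auto
    then show ?thesis using that[of zs] True a reduced_prefix by (auto simp: panel_class_def)
  next
    case False
    then have e: "cs_edge S W (s, g)" using a v by (simp add: cs_edge_def)
    then have "path c (zs @ [(s, g)])" using a cs_edge_chambers[OF e] by (simp add: path_append edge_src_def)
    then show ?thesis using that[of "zs @ [(s, g)]"] False a by (simp add: panel_class_def edge_tgt_def)
  qed
qed

lemma act_geodesic:
  assumes "path c (xs @ [x])" "red (ty xs)"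
  obtains zs where "path c zs" "red (ty zs)" "endpt c zs = edge_tgt W x"
    "act c x (braid_class c xs) = braid_class c zs"
proof -
  have x: "path c xs" "cs_edge S W (fst x, snd x)" "fst x \<in> S" "edge_src W x = endpt c xs"
    using assms(1) by (auto simp: path_append cs_edge_def)
  obtain zs g where g: "panel_state c zs (fst x) g" "tgt (panels W (fst x)) g = endpt c xs"
    "braid_class c xs = panel_class c zs (fst x) g"
    by (rule panel_class_cover[OF x(1) assms(2) x(3)])
  have "src (panels W (fst x)) (snd x) = tgt (panels W (fst x)) g" using x(4) g(2) by (simp add: edge_src_def)
  note A = act_panel_class[OF g(1) x(2) this]
  show ?thesis
    by (rule panel_class_geodesic[OF A(2)]) (use A g(3) that in \<open>simp add: edge_tgt_def\<close>)
qed

text \<open>In terms of \<open>panel_class\<close> this is the inverse law of the panel groupoid,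
  just as \<open>act_comp\<close> is its associativity.\<close>

lemma act_cancel:
  assumes p: "path c (xs @ [x])" "red (ty xs)"
  shows "act c (edge_inv W x) (act c x (braid_class c xs)) = braid_class c xs"
proof -
  obtain s f where sf: "x = (s, f)" by (cases x)
  have x: "path c xs" "cs_edge S W (s, f)" "s \<in> S" "src (panels W s) f = endpt c xs"
    using p(1) sf by (auto simp: path_append cs_edge_def edge_src_def)
  interpret P: groupoid "panels W s" by (rule panel_groupoid[OF x(3)])
  obtain zs g where g: "panel_state c zs s g" "tgt (panels W s) g = endpt c xs"
    "braid_class c xs = panel_class c zs s g"
    by (rule panel_class_cover[OF x(1) p(2) x(3)])
  have ge: "g \<in> edges (panels W s)" "f \<in> edges (panels W s)" "tgt (panels W s) g = src (panels W s) f"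
    using g x by (auto simp: panel_state_def cs_edge_def)
  note A = act_panel_class[OF g(1) x(2) ge(3)[symmetric]]
  have inv: "edge_inv W x = (s, ginv (panels W s) f)" "cs_edge S W (s, ginv (panels W s) f)"
    using cs_edge_inv(1)[OF x(2)] sf by (simp_all add: edge_inv_def)
  have "src (panels W s) (ginv (panels W s) f) = tgt (panels W s) (gcomp (panels W s) g f)"
    using P.src_inv[OF ge(2)] A(3) by simp
  note B = act_panel_class[OF A(2) inv(2) this]
  have "gcomp (panels W s) (gcomp (panels W s) g f) (ginv (panels W s) f) = g"
    using P.assoc[OF ge(1,2) P.inv_in[OF ge(2)] ge(3)] P.src_inv[OF ge(2)] P.inv_right[OF ge(2)]
      P.id_right[OF ge(1)] ge(3) by simp
  with A(1) B(1) g(3) inv(1) sf show ?thesis by simp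
qed

lemma act_comp:
  assumes p: "path c (xs @ [x, y])" "red (ty xs)" and xy: "fst y = fst x" "y \<noteq> edge_inv W x"
  shows "act c y (act c x (braid_class c xs)) = act c (edge_comp W x y) (braid_class c xs)"
proof -
  obtain s f h where sf: "x = (s, f)" "y = (s, h)" using xy(1) by (cases x; cases y) auto
  have x: "path c xs" "cs_edge S W (s, f)" "s \<in> S" "src (panels W s) f = endpt c xs"
    "cs_edge S W (s, h)" "src (panels W s) h = tgt (panels W s) f"
    using p(1) sf by (auto simp: path_append cs_edge_def edge_src_def edge_tgt_def)
  interpret P: groupoid "panels W s" by (rule panel_groupoid[OF x(3)])
  obtain zs g where g: "panel_state c zs s g" "tgt (panels W s) g = endpt c xs"
    "braid_class c xs = panel_class c zs s g"
    by (rule panel_class_cover[OF x(1) p(2) x(3)])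
  have ge: "g \<in> edges (panels W s)" "f \<in> edges (panels W s)" "tgt (panels W s) g = src (panels W s) f"
    "h \<in> edges (panels W s)"
    using g x by (auto simp: panel_state_def cs_edge_def)
  note A = act_panel_class[OF g(1) x(2) ge(3)[symmetric]]
  have "src (panels W s) h = tgt (panels W s) (gcomp (panels W s) g f)" using x(6) A(3) by simp
  note B = act_panel_class[OF A(2) x(5) this]
  have c: "edge_comp W x y = (s, gcomp (panels W s) f h)" using sf by (simp add: edge_comp_def)
  have "cs_edge S W (edge_comp W x y)"
    by (rule cs_edge_comp) (use x sf xy in \<open>simp_all add: edge_src_def edge_tgt_def\<close>)
  moreover have "src (panels W s) (gcomp (panels W s) f h) = tgt (panels W s) g"
    using P.src_comp[OF ge(2,4)] x(6) ge(3) by simp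
  ultimately have C: "act c (edge_comp W x y) (panel_class c zs s g) =
      panel_class c zs s (gcomp (panels W s) g (gcomp (panels W s) f h))"
    using act_panel_class(1)[OF g(1)] c by simp
  have "gcomp (panels W s) (gcomp (panels W s) g f) h = gcomp (panels W s) g (gcomp (panels W s) f h)"
    using P.assoc[OF ge(1,2,4,3)] x(6) by simp
  with A(1) B(1) C g(3) sf show ?thesis by simp
qed

text \<open>2W gives both galleries the same element. Braiding \<open>xs\<close> to the type of
  \<open>ys\<close> yields a gallery homotopic to \<open>ys\<close> and of the same type, hence
  \<open>ys\<close> itself.\<close>

lemma dihedral_braided:
  assumes st: "finite_pair S M s t" and p: "path c xs" "hom c xs ys"
    and r: "red (ty xs)" "red (ty ys)" "set (ty xs) \<subseteq> {s, t}" "set (ty ys) \<subseteq> {s, t}"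
  shows "braided c xs ys"
proof -
  have py: "path c ys" using hom_path p by blast
  have alt: "alternating (ty xs)" "alternating (ty ys)" using alternating_dihedral[OF st] r by auto
  have "cox_elt S M (ty xs) = cox_elt S M (ty ys)" by (rule alternating_cox_elt_eq[OF p(1) py alt p(2)])
  then have "ty xs \<simeq> ty ys" by (simp only: cox_elt_eq_iff)
  then obtain zs where zs: "ty zs = ty ys" "braided c xs zs" using braided_lift[OF p(1) r(1,2)] by blast
  have "hom c ys zs" using p(2) braided_hom[OF zs(2)] hom_sym hom_trans by blast
  then have "ys = zs" using alternating_unique[OF py _ zs(1) alt(2)] by blast
  with zs show ?thesis by simp
qed

text \<open>By the assumption on \<open>us\<close>, reducedness of words over \<open>{s, t}\<close>
  behind it is decided in rank 2. So the action of edges of these types leaves \<open>us\<close>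
  alone and can be followed up to homotopy in the dihedral part.\<close>

lemma act_dihedral:
  assumes J: "\<And>k. red k \<Longrightarrow> set k \<subseteq> {s, t} \<Longrightarrow> red (ty us @ k)"
    and p: "path c (us @ xs @ [x])" and r: "red (ty xs)" "set (ty (xs @ [x])) \<subseteq> {s, t}"
  shows "\<exists>ys. red (ty ys) \<and> set (ty ys) \<subseteq> {s, t} \<and>
    act c x (braid_class c (us @ xs)) = braid_class c (us @ ys) \<and> hom (endpt c us) (xs @ [x]) ys"
proof (cases "red (ty (xs @ [x]))")
  case True
  then have "red (ty us @ ty (xs @ [x]))" using J r(2) by blast
  then have "act c x (braid_class c (us @ xs)) = braid_class c (us @ xs @ [x])"
    using act_up[of c "us @ xs" x] p by simp
  with True r(2) show ?thesis by (intro exI[of _ "xs @ [x]"]) simp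
next
  case False
  let ?d = "endpt c us"
  have px: "path ?d (xs @ [x])" "path c us" "path ?d xs" using p by (auto simp: path_append)
  have xS: "fst x \<in> S" using path_ty[OF px(1)] by simp
  obtain zs e where ze: "braided ?d xs (zs @ [e])" "fst e = fst x"
    by (rule descent_last_edge[OF px(3) r(1) xS]) (use False in auto)
  have pz: "path ?d (zs @ [e])" using braided_path[OF ze(1)] px(3) by blast
  have rz: "red (ty (zs @ [e]))" using braided_reduced[OF ze(1)] r(1) by blast
  have sz: "set (ty (zs @ [e])) \<subseteq> {s, t}" using braid_set[OF braided_ty[OF ze(1)]] r(2) by auto
  have h: "hom ?d (xs @ [x]) (zs @ [e, x])" using hom_right[OF braided_hom[OF ze(1)] px(1)] by simp
  then have pex: "path ?d (zs @ [e, x])" using hom_path px(1) by blast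
  have "braided c (us @ xs) (us @ zs @ [e])"
    by (rule braided_left[OF ze(1)]) (use px in \<open>simp add: path_append\<close>)
  then have k: "braid_class c (us @ xs) = braid_class c ((us @ zs) @ [e])" using braid_class_eq by simp
  have "red (ty ((us @ zs) @ [e]))" using J[OF rz sz] by simp
  then have a: "act c x (braid_class c ((us @ zs) @ [e])) =
      braid_class c (if x = edge_inv W e then us @ zs else (us @ zs) @ [edge_comp W e x])"
    using pex px(2) ze(2) by (intro act_down) (auto simp: path_append)
  show ?thesis
  proof (cases "x = edge_inv W e")
    case True
    then have "hom ?d (xs @ [x]) zs" using h hom_last_cancel pex hom_trans by blast
    with True a k rz sz show ?thesis
      using reduced_prefix[of "ty zs" "[fst e]"] by (intro exI[of _ zs]) auto
  next
    case False
    then have "hom ?d (xs @ [x]) (zs @ [edge_comp W e x])" using h hom_last_comp[OF pex] ze(2) hom_trans by metis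
    with False a k rz sz show ?thesis by (intro exI[of _ "zs @ [edge_comp W e x]"]) auto
  qed
qed

lemma fold_act_dihedral:
  assumes J: "\<And>k. red k \<Longrightarrow> set k \<subseteq> {s, t} \<Longrightarrow> red (ty us @ k)"
    and "path c (us @ xs @ vs)" "red (ty xs)" "set (ty (xs @ vs)) \<subseteq> {s, t}"
  shows "\<exists>ys. red (ty ys) \<and> set (ty ys) \<subseteq> {s, t} \<and>
    fold (act c) vs (braid_class c (us @ xs)) = braid_class c (us @ ys) \<and> hom (endpt c us) (xs @ vs) ys"
  using assms(2-)
proof (induction vs arbitrary: xs)
  case Nil
  then show ?case by (intro exI[of _ xs]) simp
next
  case (Cons x vs)
  have sx: "set (ty (xs @ [x])) \<subseteq> {s, t}" using Cons.prems(3) by simp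
  have p: "path c (us @ xs @ [x])" "path (endpt c us) ((xs @ [x]) @ vs)"
    using Cons.prems(1) by (auto simp: path_append dest: path_chambers)
  obtain ys where ys: "red (ty ys)" "set (ty ys) \<subseteq> {s, t}"
    "act c x (braid_class c (us @ xs)) = braid_class c (us @ ys)" "hom (endpt c us) (xs @ [x]) ys"
    using act_dihedral[of s t us c xs x, OF J p(1) Cons.prems(2) sx] by blast
  have h: "hom (endpt c us) ((xs @ [x]) @ vs) (ys @ vs)" by (rule hom_right[OF ys(4) p(2)])
  have "path c (us @ ys @ vs)" using hom_path[OF h] p by (simp add: path_append)
  then obtain zs where "red (ty zs)" "set (ty zs) \<subseteq> {s, t}"
    "fold (act c) vs (braid_class c (us @ ys)) = braid_class c (us @ zs)" "hom (endpt c us) (ys @ vs) zs"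
    using Cons.IH[of ys] ys Cons.prems(3) by auto
  with ys h show ?case by (intro exI[of _ zs]) (auto intro: hom_trans)
qed

text \<open>Behind a prefix \<open>us\<close> that is shortest modulo \<open>{s, t}\<close>, the
  suite changes the dihedral part \<open>vs\<close> into some \<open>ys\<close>. As the suite is
  null-homotopic, \<open>vs\<close> and \<open>ys\<close> are homotopic, and in rank 2 this makes
  them braided.\<close>

lemma fold_act_suite:
  assumes st: "finite_pair S M s t" and p: "path c (xs @ zs)" "red (ty xs)"
    and z: "(endpt c xs, zs) \<in> weyl_data.suites W s t"
  shows "fold (act c) zs (braid_class c xs) = braid_class c xs"
proof -
  have "st_cycle S M W s t (endpt c xs, zs)" by (rule suites[OF st z])
  then have sz: "set (ty zs) \<subseteq> {s, t}" using set_alt_word_subset by (metis gtype_def snd_conv st_cycle_def)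
  have px: "path c xs" using p(1) by (simp add: path_append)
  have JS: "{s, t} \<subseteq> S" using finite_pairD[OF st] by simp
  obtain g h where gh: "ty xs \<simeq> g @ h" "set h \<subseteq> {s, t}" "red h" "\<And>k. red k \<Longrightarrow> set k \<subseteq> {s, t} \<Longrightarrow> red (g @ k)"
    using parabolic_decomposition[OF reduced_subset[OF p(2)] JS] by metis
  obtain ws where ws: "ty ws = g @ h" "braided c xs ws"
    using braided_lift[OF px p(2) gh(4)[OF gh(3,2)] gh(1)] by blast
  obtain us vs where uv: "ws = us @ vs" "ty us = g" "ty vs = h" using ws(1) by (auto simp: map_eq_append_conv)
  have pw: "path c (us @ vs @ zs)"
    using hom_path[OF hom_right[OF braided_hom[OF ws(2)] p(1)]] p(1) uv(1) by simp
  have k: "braid_class c xs = braid_class c (us @ vs)" using braid_class_eq[OF ws(2)] uv(1) by simp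
  obtain ys where ys: "red (ty ys)" "set (ty ys) \<subseteq> {s, t}"
    "fold (act c) zs (braid_class c (us @ vs)) = braid_class c (us @ ys)" "hom (endpt c us) (vs @ zs) ys"
    using fold_act_dihedral[of s t us c vs zs] gh uv pw sz by auto
  have pv: "path (endpt c us) vs" "path c us" using pw by (auto simp: path_append)
  have e: "endpt c xs = endpt (endpt c us) vs" using braided_endpt[OF ws(2)] uv(1) by simp
  have "hom (endpt (endpt c us) vs) zs []" using suite_hom[OF st z] unfolding e .
  then have "hom (endpt c us) (vs @ zs) vs"
    using hom_left[of "endpt c us" vs zs "[]"] pw by (simp add: path_append)
  then have "hom (endpt c us) vs ys" using ys(4) hom_sym hom_trans by blast
  then have "braided (endpt c us) vs ys"
    using dihedral_braided[OF st pv(1)] gh(2,3) uv(3) ys(1,2) by simp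
  then have "braided c (us @ vs) (us @ ys)" by (rule braided_left) (use pv in \<open>simp add: path_append\<close>)
  then show ?thesis using ys(3) k braid_class_eq by simp
qed

section \<open>The action of whole galleries as a homotopy invariant\<close>

lemma fold_act_geodesic:
  assumes "path c xs"
  shows "\<exists>zs. path c zs \<and> red (ty zs) \<and> endpt c zs = endpt c xs \<and>
    fold (act c) xs (braid_class c []) = braid_class c zs"
  using assms
proof (induction xs rule: rev_induct)
  case Nil
  then show ?case by (intro exI[of _ "[]"]) simp
next
  case (snoc x xs)
  then obtain zs where zs: "path c zs" "red (ty zs)" "endpt c zs = endpt c xs"
    "fold (act c) xs (braid_class c []) = braid_class c zs" by (auto simp: path_append)
  have p: "path c (zs @ [x])" using snoc.prems zs by (simp add: path_append)
  obtain ys where "path c ys" "red (ty ys)" "endpt c ys = edge_tgt W x"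
    "act c x (braid_class c zs) = braid_class c ys"
    by (rule act_geodesic[OF p zs(2)])
  with zs(4) show ?case by (intro exI[of _ ys]) simp
qed

lemma fold_act_reduced:
  assumes "path c xs" "red (ty xs)"
  shows "fold (act c) xs (braid_class c []) = braid_class c xs"
  using assms
proof (induction xs rule: rev_induct)
  case (snoc x xs)
  then have "fold (act c) xs (braid_class c []) = braid_class c xs"
    using reduced_prefix[of "ty xs" "[fst x]"] by (simp add: path_append)
  then show ?case using act_up[OF snoc.prems] by simp
qed simp

lemma fold_act_elementary_homotopy:
  assumes "elementary_homotopy S M W a b"
  shows "fold (act (fst a)) (snd a) (braid_class (fst a) []) = fold (act (fst b)) (snd b) (braid_class (fst b) [])"
  using assms
proof (induction rule: elementary_homotopy.induct)
  case (cancel c xs s e ys)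
  define x where "x = (s, e)"
  have p: "path c xs" "path (endpt c xs) [x]"
    using cancel path_chambers by (auto simp: gallery_def path_append x_def)
  obtain zs where zs: "path c zs" "red (ty zs)" "endpt c zs = endpt c xs"
    "fold (act c) xs (braid_class c []) = braid_class c zs"
    using fold_act_geodesic[OF p(1)] by blast
  have "act c (edge_inv W x) (act c x (braid_class c zs)) = braid_class c zs"
    by (rule act_cancel) (use zs p in \<open>simp_all add: path_append\<close>)
  then show ?case using zs(4) by (simp add: x_def edge_inv_def)
next
  case (compose c xs s e f ys)
  define x y where "x = (s, e)" and "y = (s, f)"
  have p: "path c xs" "path (endpt c xs) [x, y]"
    using compose path_chambers by (auto simp: gallery_def path_append x_def y_def)
  obtain zs where zs: "path c zs" "red (ty zs)" "endpt c zs = endpt c xs"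
    "fold (act c) xs (braid_class c []) = braid_class c zs"
    using fold_act_geodesic[OF p(1)] by blast
  have "act c y (act c x (braid_class c zs)) = act c (edge_comp W x y) (braid_class c zs)"
    by (rule act_comp) (use zs p compose(2) in \<open>auto simp: path_append x_def y_def edge_inv_def\<close>)
  then show ?case using zs(4) by (simp add: x_def y_def edge_comp_def)
next
  case (suite c xs zs ys s t)
  have p: "path c xs" "path (endpt c xs) zs"
    using suite by (auto simp: gallery_def path_append)
  obtain ws where ws: "path c ws" "red (ty ws)" "endpt c ws = endpt c xs"
    "fold (act c) xs (braid_class c []) = braid_class c ws"
    using fold_act_geodesic[OF p(1)] by blast
  have "fold (act c) zs (braid_class c ws) = braid_class c ws"
    by (rule fold_act_suite[OF suite(2)]) (use ws p suite(3) in \<open>simp_all add: path_append\<close>)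
  then show ?case using ws(4) by simp
qed

text \<open>Acting on the class of the trivial gallery is a homotopy invariant, and a geodesic
  carries that class to its own braid class.\<close>

lemma homotopic_geodesics_braided:
  assumes "geodesic S M W \<beta>" "geodesic S M W \<gamma>" "homotopic S M W \<beta> \<gamma>"
  shows "braided (fst \<beta>) (snd \<beta>) (snd \<gamma>)"
proof -
  have "fold (act (fst \<beta>)) (snd \<beta>) (braid_class (fst \<beta>) []) = fold (act (fst \<gamma>)) (snd \<gamma>) (braid_class (fst \<gamma>) [])"
    using assms(3) unfolding homotopic_def
    by (induction rule: equivclp_induct) (auto dest: fold_act_elementary_homotopy)
  moreover have "fst \<gamma> = fst \<beta>" using homotopic_path[OF assms(3)] by simp
  ultimately show ?thesis
    using fold_act_reduced assms(1,2) braid_class_eqD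
    by (metis (no_types, lifting) geodesic_def gallery_def gtype_def)
qed

lemma is_weyl_graph: "weyl_graph S M W"
proof
  fix \<beta> \<gamma>
  assume "geodesic S M W \<beta>" "geodesic S M W \<gamma>" "homotopic S M W \<beta> \<gamma>"
  from braided_word_eq[OF homotopic_geodesics_braided[OF this]]
  show "W_length S M \<beta> = W_length S M \<gamma>" by (simp add: W_length_def gtype_def cox_elt_eq_iff)
qed

end

theorem theorem5p13:
  fixes S :: "'s set" and M :: "'s \<Rightarrow> 's \<Rightarrow> enat" and W :: "('c, 'e, 's) weyl_data"
  assumes "finite S" and "coxeter_matrix S M" and "two_weyl_graph S M W"
  shows "((\<forall>J C. J \<subseteq> S \<and> C \<in> chambers W \<and> (type_C3 J M \<or> type_H3 J M)
            \<longrightarrow> weyl_graph J M (residue J W C))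
          \<longrightarrow> weyl_graph S M W) \<and>
         (weyl_graph S M W
          \<longrightarrow> (\<forall>J C. J \<subseteq> S \<and> C \<in> chambers W \<and> (type_C3 J M \<or> type_H3 J M)
                 \<and> pre_weyl_graph J M (residue J W C)
                 \<longrightarrow> weyl_graph J M (residue J W C)))"
proof (intro conjI impI allI)
  interpret coxeter_weyl S M W using assms(2,3) by (rule coxeter_weyl.intro)
  {
    assume res: "\<forall>J C. J \<subseteq> S \<and> C \<in> chambers W \<and> (type_C3 J M \<or> type_H3 J M)
            \<longrightarrow> weyl_graph J M (residue J W C)"
    interpret rigid_weyl S M W
      by unfold_locales (rule rigid_rank_3, use res in auto)
    show "weyl_graph S M W" by (rule is_weyl_graph)
  next
    fix J C
    assume "weyl_graph S M W"
      and "J \<subseteq> S \<and> C \<in> chambers W \<and> (type_C3 J M \<or> type_H3 J M) \<and> pre_weyl_graph J M (residue J W C)"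
    then have J: "J \<subseteq> S" and R: "pre_weyl_graph J M (residue J W C)" and W: "weyl_graph S M W" by auto
    interpret J: coxeter_matrix J M by (rule sub_coxeter_matrix[OF J])
    have geo: "geodesic S M W \<beta>" if "geodesic J M (residue J W C) \<beta>" for \<beta>
      using that residue_edge_path(1)[OF J] sub_reduced_iff[OF J] by (auto simp: geodesic_def gallery_def)
    \<comment> \<open>Reducedness and homotopy pass from the residue to \<open>W\<close>, where (W)
      gives equality in the whole group; the embedding of the parabolic subgroup brings it back to
      \<open>J\<close>.\<close>
    have "W_length J M \<beta> = W_length J M \<gamma>"
      if h: "geodesic J M (residue J W C) \<beta>" "geodesic J M (residue J W C) \<gamma>"
        "homotopic J M (residue J W C) \<beta> \<gamma>" for \<beta> \<gamma>
    proof -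
      have "W_length S M \<beta> = W_length S M \<gamma>"
        by (rule weyl_graph.W[OF W geo[OF h(1)] geo[OF h(2)] residue_homotopic[OF J h(3)]])
      then show ?thesis
        using sub_word_eq_if_reduced[OF J] h(1,2)
        by (simp add: W_length_def cox_elt_eq_iff J.cox_elt_eq_iff geodesic_def)
    qed
    then show "weyl_graph J M (residue J W C)"
      by (intro weyl_graph.intro weyl_graph_axioms.intro R)
  }
qed

end
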